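(* Let $G = SL(n+1)$ (over $\mathbb{C}$), and let $P$ and $Q$ be parabolic subgroups of $G$. Suppose that the double flag variety $X = G/P \times G/Q$ is spherical for the diagonal action of $G$, i.e. a Borel subgroup of $G$ has an open orbit in $X$. Then the set of $G$-orbit closures in $X$ (Zariski closures of the $G$-orbits), partially ordered by inclusion, is a lattice.
   Context: $G$ acts on $X=G/P\times G/Q$ diagonally: $g\cdot(xP,yQ)=(gxP,gyQ)$. A normal $G$-variety is called spherical if a Borel subgroup of $G$ has an open orbit in it. The variety $G/P\times G/Q$ has finitely many $G$-orbits when it is spherical. *)

theory Defs
  imports
    "HOL-Analysis.Determinants"
    "HOL-Analysis.Abstract_Topology"
    "HOL-Algebra.Group_Action"
    "HOL-Algebra.Left_Coset"
    "HOL-Algebra.Solvable_Groups"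
    "HOL-Algebra.Lattice"
begin

subsection \<open>The Zariski topology on an affine space\<close>

text \<open>An affine space is presented by its set \<open>C\<close> of coordinate functions; its polynomial functions
  are the \<open>\<complex>\<close>-algebra generated by \<open>C\<close>, and its closed sets are the common zero loci of
  arbitrary families of polynomial functions.\<close>

inductive_set poly_funs :: "('a \<Rightarrow> complex) set \<Rightarrow> ('a \<Rightarrow> complex) set"
  for C :: "('a \<Rightarrow> complex) set"
where
  coord: "f \<in> C \<Longrightarrow> f \<in> poly_funs C"
| const: "(\<lambda>_. c) \<in> poly_funs C"
| add: "f \<in> poly_funs C \<Longrightarrow> g \<in> poly_funs C \<Longrightarrow> (\<lambda>x. f x + g x) \<in> poly_funs C"
| mult: "f \<in> poly_funs C \<Longrightarrow> g \<in> poly_funs C \<Longrightarrow> (\<lambda>x. f x * g x) \<in> poly_funs C"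

definition zariski :: "('a \<Rightarrow> complex) set \<Rightarrow> 'a topology" where
  "zariski C = topology (\<lambda>U. \<exists>F \<subseteq> poly_funs C. U = - {x. \<forall>f\<in>F. f x = 0})"

lemma openin_zariski:
  "openin (zariski C) U \<longleftrightarrow> (\<exists>F \<subseteq> poly_funs C. U = - {x. \<forall>f\<in>F. f x = 0})"
proof -
  let ?D = "\<lambda>F. - {x. \<forall>f\<in>F. f x = 0}"
  let ?L = "\<lambda>U. \<exists>F \<subseteq> poly_funs C. U = ?D F"
  have "istopology ?L"
    unfolding istopology_def
  proof (intro conjI allI impI)
    fix S T
    assume "?L S" "?L T"
    then obtain F F' where F: "F \<subseteq> poly_funs C" "S = ?D F"
      and F': "F' \<subseteq> poly_funs C" "T = ?D F'" by (elim exE conjE)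
    let ?H = "(\<lambda>(f, g) x. f x * g x) ` (F \<times> F')"
    have "?H \<subseteq> poly_funs C"
      using F(1) F'(1) by (auto intro: poly_funs.mult)
    moreover have "S \<inter> T = ?D ?H"
      unfolding F(2) F'(2) by auto
    ultimately show "?L (S \<inter> T)"
      by (intro exI[of _ ?H] conjI)
  next
    fix K
    assume K: "\<forall>S\<in>K. ?L S"
    define F where "F = {f \<in> poly_funs C. \<forall>x. f x \<noteq> 0 \<longrightarrow> x \<in> \<Union>K}"
    have "x \<in> ?D F" if S: "S \<in> K" and x: "x \<in> S" for x S
    proof -
      from K S obtain F' where F': "F' \<subseteq> poly_funs C" "S = ?D F'" by (elim ballE exE conjE) auto
      from x F'(2) obtain f where f: "f \<in> F'" "f x \<noteq> 0" by auto
      have "y \<in> S" if "f y \<noteq> 0" for y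
        unfolding F'(2) using f(1) that by auto
      with S F'(1) f(1) have "f \<in> F"
        by (auto simp: F_def)
      with f(2) show ?thesis by auto
    qed
    then have "\<Union>K = ?D F"
      by (auto simp: F_def)
    moreover have "F \<subseteq> poly_funs C"
      by (auto simp: F_def)
    ultimately show "?L (\<Union>K)"
      by (intro exI[of _ F] conjI)
  qed
  then show ?thesis
    unfolding zariski_def by (subst topology_inverse') (assumption, rule refl)
qed

lemma topspace_zariski [simp]: "topspace (zariski C) = UNIV"
proof -
  have "openin (zariski C) UNIV"
    unfolding openin_zariski
    by (rule exI[of _ "{\<lambda>_. 1}"]) (auto intro: poly_funs.const)
  then show ?thesis
    by (rule openin_subset[THEN top.extremum_uniqueI])
qed

subsection \<open>The quotient topology\<close>

definition quotient_topology :: "'a topology \<Rightarrow> ('a \<Rightarrow> 'b) \<Rightarrow> 'b topology" where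
  "quotient_topology T q =
     topology (\<lambda>U. U \<subseteq> q ` topspace T \<and> openin T {x \<in> topspace T. q x \<in> U})"

lemma openin_quotient_topology:
  "openin (quotient_topology T q) U \<longleftrightarrow>
     U \<subseteq> q ` topspace T \<and> openin T {x \<in> topspace T. q x \<in> U}"
proof -
  let ?L = "\<lambda>U. U \<subseteq> q ` topspace T \<and> openin T {x \<in> topspace T. q x \<in> U}"
  have "istopology ?L"
    unfolding istopology_def
  proof (intro conjI[of "\<forall>S T. _ S T"] allI impI)
    fix S S'
    assume *: "?L S" "?L S'"
    have "{x \<in> topspace T. q x \<in> S \<inter> S'} =
        {x \<in> topspace T. q x \<in> S} \<inter> {x \<in> topspace T. q x \<in> S'}" by blast
    with * show "?L (S \<inter> S')"
      by (metis (no_types, lifting) le_infI1 openin_Int)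
  next
    fix K
    assume *: "\<forall>S\<in>K. ?L S"
    have "{x \<in> topspace T. q x \<in> \<Union>K} = (\<Union>S\<in>K. {x \<in> topspace T. q x \<in> S})" by blast
    moreover have "openin T (\<Union>S\<in>K. {x \<in> topspace T. q x \<in> S})"
      using * by (intro openin_Union) auto
    moreover have "\<Union>K \<subseteq> q ` topspace T"
      using * by (intro Union_least) auto
    ultimately show "?L (\<Union>K)" by (simp only: simp_thms)
  qed
  then show ?thesis
    unfolding quotient_topology_def by (subst topology_inverse') (assumption, rule refl)
qed

lemma topspace_quotient_topology [simp]: "topspace (quotient_topology T q) = q ` topspace T"
proof (rule subset_antisym)
  show "topspace (quotient_topology T q) \<subseteq> q ` topspace T"
    using openin_topspace[of "quotient_topology T q"] unfolding openin_quotient_topology by (rule conjunct1)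
  have "{x \<in> topspace T. q x \<in> q ` topspace T} = topspace T" by blast
  then have "openin (quotient_topology T q) (q ` topspace T)"
    unfolding openin_quotient_topology by simp
  then show "q ` topspace T \<subseteq> topspace (quotient_topology T q)"
    by (rule openin_subset)
qed

subsection \<open>The special linear group, Borel and parabolic subgroups\<close>

definition SL :: "(complex^'n^'n) monoid" where
  "SL = \<lparr>carrier = {A. det A = 1}, mult = (**), one = mat 1\<rparr>"

lemma group_SL: "group (SL :: (complex^'n^'n) monoid)"
proof (rule groupI)
  fix A :: "complex^'n^'n"
  assume "A \<in> carrier SL"
  then have "det A = 1" by (simp add: SL_def)
  then have "invertible A" by (simp add: invertible_det_nz)
  then obtain B where B: "B ** A = mat 1" by (auto simp: invertible_def)
  then have "det B * det A = 1" by (metis det_I det_mul)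
  with \<open>det A = 1\<close> B show "\<exists>B\<in>carrier SL. B \<otimes>\<^bsub>SL\<^esub> A = \<one>\<^bsub>SL\<^esub>"
    by (auto simp: SL_def)
qed (auto simp: SL_def det_mul matrix_mul_assoc)

definition mat_coords :: "(complex^'n^'n \<Rightarrow> complex) set" where
  "mat_coords = {(\<lambda>A. A $ i $ j) | i j. True}"

definition SL_topology :: "(complex^'n^'n) topology" where
  "SL_topology = subtopology (zariski mat_coords) (carrier SL)"

definition conn_solv_subgroup :: "(complex^'n^'n) set \<Rightarrow> bool" where
  "conn_solv_subgroup H \<longleftrightarrow>
     subgroup H SL \<and> closedin SL_topology H \<and> connectedin SL_topology H \<and>
     solvable (SL\<lparr>carrier := H\<rparr>)"

definition borel_subgroup :: "(complex^'n^'n) set \<Rightarrow> bool" where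
  "borel_subgroup B \<longleftrightarrow>
     conn_solv_subgroup B \<and> (\<forall>H. conn_solv_subgroup H \<longrightarrow> B \<subseteq> H \<longrightarrow> H = B)"

definition parabolic_subgroup :: "(complex^'n^'n) set \<Rightarrow> bool" where
  "parabolic_subgroup P \<longleftrightarrow>
     subgroup P SL \<and> closedin SL_topology P \<and> (\<exists>B. borel_subgroup B \<and> B \<subseteq> P)"

subsection \<open>The double flag variety\<close>

definition mat_pair_coords :: "((complex^'n^'n) \<times> (complex^'n^'n) \<Rightarrow> complex) set" where
  "mat_pair_coords = (\<lambda>f. f \<circ> fst) ` mat_coords \<union> (\<lambda>f. f \<circ> snd) ` mat_coords"

text \<open>The Zariski topology of the variety \<open>G/P \<times> G/Q = (G \<times> G)/(P \<times> Q)\<close> is the quotient of the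
  Zariski topology of \<open>G \<times> G\<close>: the quotient of an algebraic group by a closed subgroup is a
  geometric quotient. (It is not the product of the Zariski topologies of the factors.)\<close>

definition double_flag_topology ::
    "(complex^'n^'n) set \<Rightarrow> (complex^'n^'n) set
      \<Rightarrow> ((complex^'n^'n) set \<times> (complex^'n^'n) set) topology" where
  "double_flag_topology P Q =
     quotient_topology (subtopology (zariski mat_pair_coords) (carrier SL \<times> carrier SL))
       (\<lambda>(x, y). (l_coset SL x P, l_coset SL y Q))"

definition double_flag ::
    "(complex^'n^'n) set \<Rightarrow> (complex^'n^'n) set
      \<Rightarrow> ((complex^'n^'n) set \<times> (complex^'n^'n) set) set" where
  "double_flag P Q = (lcosets\<^bsub>SL\<^esub> P) \<times> (lcosets\<^bsub>SL\<^esub> Q)"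

lemma topspace_double_flag_topology: "topspace (double_flag_topology P Q) = double_flag P Q"
  by (auto simp: double_flag_topology_def double_flag_def LCOSETS_def)

definition diag_act ::
    "complex^'n^'n \<Rightarrow> (complex^'n^'n) set \<times> (complex^'n^'n) set
      \<Rightarrow> (complex^'n^'n) set \<times> (complex^'n^'n) set" where
  "diag_act g = (\<lambda>(S, T). (l_coset SL g S, l_coset SL g T))"

lemma diag_act_cosets:
  "diag_act g (l_coset SL x P, l_coset SL y Q) =
     (l_coset SL (g \<otimes>\<^bsub>SL\<^esub> x) P, l_coset SL (g \<otimes>\<^bsub>SL\<^esub> y) Q)"
  by (auto simp: diag_act_def l_coset_def SL_def matrix_mul_assoc)

text \<open>Normality, which is part of the notion of a spherical variety, is not listed: homogeneous
  varieties are smooth, so \<open>G/P \<times> G/Q\<close> is always normal.\<close>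

definition spherical_double_flag :: "(complex^'n^'n) set \<Rightarrow> (complex^'n^'n) set \<Rightarrow> bool" where
  "spherical_double_flag P Q \<longleftrightarrow>
     (\<exists>B. borel_subgroup B \<and>
       (\<exists>Y\<in>orbits (SL\<lparr>carrier := B\<rparr>) (double_flag P Q) diag_act.
          openin (double_flag_topology P Q) Y))"

definition orbit_closures ::
    "(complex^'n^'n) set \<Rightarrow> (complex^'n^'n) set
      \<Rightarrow> ((complex^'n^'n) set \<times> (complex^'n^'n) set) set set" where
  "orbit_closures P Q =
     Abstract_Topology.closure_of (double_flag_topology P Q) ` orbits SL (double_flag P Q) diag_act"

end

theory Submission
  imports Defs "HOL-Computational_Algebra.Fundamental_Theorem_Algebra"
begin

text \<open>By the Lie--Kolchin theorem the Borel subgroups are the stabilizers of full flags, and by the Bruhat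
  decomposition a parabolic subgroup is the stabilizer of a partial flag. If both partial flags have at
  least two proper steps, then no Borel subgroup has an open orbit: once a generic first flag is fixed,
  the remaining group consists of block diagonal upper triangular matrices, and two products of two
  minors of the second flag have the same weight under it without being proportional.

  Hence one of the subgroups, say \<open>P\<close>, stabilizes a single subspace \<open>A\<close>. The orbit of \<open>(xP, yQ)\<close> is then
  determined by the dimensions \<open>d j\<close> of the intersections of \<open>xA\<close> with the steps of the flag of \<open>yQ\<close>, its
  closure consists of the orbits with \<open>d' \<ge> d\<close>, and the possible \<open>d\<close> are the restrictions of the
  functions with increments 0 or 1 and prescribed end points. These are closed under pointwise
  minimum and maximum, which gives the lattice operations.\<close>

section \<open>Polynomial functions and the Zariski topology\<close>

text \<open>A dimension count cannot exclude an open orbit: for matrices of size \<open>n\<close>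
  and steps 1 and \<open>n - 1\<close> in both flags, the Borel subgroup has larger dimension than
  \<open>X\<close> once \<open>n \<ge> 6\<close>. So a nonconstant rational invariant is needed. Two
  row indices \<open>\<rho>i\<close> and \<open>\<rho>j\<close> from different diagonal blocks trade
  places between a minor of size \<open>b1\<close> and one of size \<open>b2\<close>, which leaves
  the weight of the product unchanged. The \<open>b2 - b1\<close> additional rows of the larger
  minor are taken from the third block, which has to be large enough; this is why the middle steps
  of the two flags are compared and the flags exchanged if necessary.

  The topology is handled by curves. Along a curve with polynomial or rational entries a polynomial
  function becomes a function of one variable with finitely many zeros unless it vanishes
  identically. This gives both the irreducibility of \<open>SL\<close> and the membership of
  degenerate pairs in orbit closures. Quotients are avoided: vectors modulo \<open>U\<close> are
  congruences, and points of \<open>G/P\<close> are families of subspaces.\<close>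

lemma poly_funs_cmult: "f \<in> poly_funs C \<Longrightarrow> (\<lambda>x. c * f x) \<in> poly_funs C"
  using poly_funs.mult[OF poly_funs.const[of c]] .

lemma poly_funs_diff:
  assumes "f \<in> poly_funs C" "g \<in> poly_funs C"
  shows "(\<lambda>x. f x - g x) \<in> poly_funs C"
  using poly_funs.add[OF assms(1) poly_funs_cmult[OF assms(2), of "-1"]] by simp

lemma poly_funs_sum:
  "(\<And>i. i \<in> I \<Longrightarrow> f i \<in> poly_funs C) \<Longrightarrow> (\<lambda>x. \<Sum>i\<in>I. f i x) \<in> poly_funs C"
  by (induction I rule: infinite_finite_induct) (auto intro: poly_funs.const poly_funs.add)

lemma poly_funs_prod:
  "(\<And>i. i \<in> I \<Longrightarrow> f i \<in> poly_funs C) \<Longrightarrow> (\<lambda>x. \<Prod>i\<in>I. f i x) \<in> poly_funs C"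
  by (induction I rule: infinite_finite_induct) (auto intro: poly_funs.const poly_funs.mult)

lemma poly_funs_det:
  fixes M :: "'a \<Rightarrow> complex^'n^'n"
  assumes "\<And>i j. (\<lambda>x. M x $ i $ j) \<in> poly_funs C"
  shows "(\<lambda>x. det (M x)) \<in> poly_funs C"
  unfolding det_def
  by (intro poly_funs_sum poly_funs.mult poly_funs.const poly_funs_prod assms)

lemma poly_funs_mat_coord: "(\<lambda>A. A $ i $ j) \<in> poly_funs mat_coords"
  by (rule poly_funs.coord) (auto simp: mat_coords_def)

lemma poly_funs_fst_coord: "(\<lambda>z. fst z $ i $ j) \<in> poly_funs mat_pair_coords"
  by (rule poly_funs.coord) (force simp: mat_coords_def mat_pair_coords_def comp_def)

lemma poly_funs_snd_coord: "(\<lambda>z. snd z $ i $ j) \<in> poly_funs mat_pair_coords"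
  by (rule poly_funs.coord) (force simp: mat_coords_def mat_pair_coords_def comp_def)

lemma poly_funs_matrix_mult:
  fixes M N :: "'a \<Rightarrow> complex^'n^'n"
  assumes "\<And>i j. (\<lambda>x. M x $ i $ j) \<in> poly_funs C" "\<And>i j. (\<lambda>x. N x $ i $ j) \<in> poly_funs C"
  shows "(\<lambda>x. (M x ** N x) $ i $ j) \<in> poly_funs C"
  unfolding matrix_matrix_mult_def using assms
  by (auto intro!: poly_funs_sum poly_funs.mult)

lemma poly_funs_matrix_vector_mult:
  fixes M :: "'a \<Rightarrow> complex^'n^'n"
  assumes "\<And>i j. (\<lambda>x. M x $ i $ j) \<in> poly_funs C"
  shows "(\<lambda>x. (M x *v v) $ i) \<in> poly_funs C"
  unfolding matrix_vector_mult_def using assms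
  by (auto intro!: poly_funs_sum poly_funs.mult poly_funs.const)

text \<open>Agreement is required on \<open>S\<close> only, because inversion is given by
  polynomials on \<open>SL\<close> but not on all matrices.\<close>

lemma poly_funs_compose_on:
  assumes "f \<in> poly_funs C" and "\<And>c. c \<in> C \<Longrightarrow> \<exists>g\<in>poly_funs D. \<forall>x\<in>S. c (\<phi> x) = g x"
  shows "\<exists>g\<in>poly_funs D. \<forall>x\<in>S. f (\<phi> x) = g x"
  using assms(1)
proof induction
  case (const c)
  show ?case by (rule bexI[OF _ poly_funs.const[of c]]) auto
next
  case (add f g)
  then obtain f' g' where "f' \<in> poly_funs D" "g' \<in> poly_funs D"
    "\<forall>x\<in>S. f (\<phi> x) = f' x" "\<forall>x\<in>S. g (\<phi> x) = g' x" by blast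
  then show ?case by (intro bexI[OF _ poly_funs.add[of f' _ g']]) auto
next
  case (mult f g)
  then obtain f' g' where "f' \<in> poly_funs D" "g' \<in> poly_funs D"
    "\<forall>x\<in>S. f (\<phi> x) = f' x" "\<forall>x\<in>S. g (\<phi> x) = g' x" by blast
  then show ?case by (intro bexI[OF _ poly_funs.mult[of f' _ g']]) auto
qed (use assms(2) in blast)

text \<open>Nonvanishing loci of single polynomials form a basis of the topology; openness is tested
  below by exhibiting one polynomial for each point.\<close>

lemma openin_subtopology_zariski:
  "openin (subtopology (zariski C) S) U \<longleftrightarrow>
     U \<subseteq> S \<and> (\<forall>x\<in>U. \<exists>f\<in>poly_funs C. f x \<noteq> 0 \<and> {y\<in>S. f y \<noteq> 0} \<subseteq> U)"
proof
  assume "openin (subtopology (zariski C) S) U"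
  then obtain F where "F \<subseteq> poly_funs C" "U = - {x. \<forall>f\<in>F. f x = 0} \<inter> S"
    by (auto simp: openin_subtopology openin_zariski)
  then show "U \<subseteq> S \<and> (\<forall>x\<in>U. \<exists>f\<in>poly_funs C. f x \<noteq> 0 \<and> {y\<in>S. f y \<noteq> 0} \<subseteq> U)"
    by auto
next
  assume *: "U \<subseteq> S \<and> (\<forall>x\<in>U. \<exists>f\<in>poly_funs C. f x \<noteq> 0 \<and> {y\<in>S. f y \<noteq> 0} \<subseteq> U)"
  define F where "F = {f\<in>poly_funs C. {y\<in>S. f y \<noteq> 0} \<subseteq> U}"
  have "U = - {x. \<forall>f\<in>F. f x = 0} \<inter> S"
    using * by (auto simp: F_def)
  moreover have "F \<subseteq> poly_funs C" by (auto simp: F_def)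
  ultimately show "openin (subtopology (zariski C) S) U"
    unfolding openin_subtopology openin_zariski by blast
qed

lemma continuous_map_zariski:
  assumes "\<phi> \<in> S \<rightarrow> T" and "\<And>c. c \<in> C \<Longrightarrow> \<exists>g\<in>poly_funs D. \<forall>x\<in>S. c (\<phi> x) = g x"
  shows "continuous_map (subtopology (zariski D) S) (subtopology (zariski C) T) \<phi>"
  unfolding continuous_map_def
proof (intro conjI allI impI)
  show "\<phi> \<in> topspace (subtopology (zariski D) S) \<rightarrow> topspace (subtopology (zariski C) T)"
    using assms(1) by auto
next
  fix U assume U: "openin (subtopology (zariski C) T) U"
  have "\<exists>f\<in>poly_funs D. f x \<noteq> 0 \<and> {y\<in>S. f y \<noteq> 0} \<subseteq> {x\<in>S. \<phi> x \<in> U}" if x: "x \<in> S" "\<phi> x \<in> U" for x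
  proof -
    from U x(2) obtain f where f: "f \<in> poly_funs C" "f (\<phi> x) \<noteq> 0" "{y\<in>T. f y \<noteq> 0} \<subseteq> U"
      unfolding openin_subtopology_zariski by blast
    obtain g where "g \<in> poly_funs D" "\<forall>x\<in>S. f (\<phi> x) = g x"
      using poly_funs_compose_on[OF f(1), of D S \<phi>] assms(2) by blast
    then show ?thesis using f x assms(1) by (intro bexI[of _ g]) auto
  qed
  then show "openin (subtopology (zariski D) S) {x \<in> topspace (subtopology (zariski D) S). \<phi> x \<in> U}"
    unfolding openin_subtopology_zariski by simp
qed

text \<open>A curve inside \<open>SL\<close> acquires denominators when its determinant is
  normalised. Powers of \<open>d\<close> clear them, and the exponents add up under sums and
  products.\<close>

lemma poly_funs_rational_curve:
  fixes d :: "complex poly"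
  assumes "f \<in> poly_funs C"
    and "\<And>c. c \<in> C \<Longrightarrow> \<exists>p k. \<forall>t. poly d t \<noteq> 0 \<longrightarrow> c (\<phi> t) * poly d t ^ k = poly p t"
  shows "\<exists>p k. \<forall>t. poly d t \<noteq> 0 \<longrightarrow> f (\<phi> t) * poly d t ^ k = poly p t"
  using assms(1)
proof induction
  case (const c)
  show ?case by (rule exI[of _ "[:c:]"], rule exI[of _ 0]) simp
next
  case (add f g)
  then obtain p k q l where p: "\<forall>t. poly d t \<noteq> 0 \<longrightarrow> f (\<phi> t) * poly d t ^ k = poly p t"
    and q: "\<forall>t. poly d t \<noteq> 0 \<longrightarrow> g (\<phi> t) * poly d t ^ l = poly q t" by blast
  have "(f (\<phi> t) + g (\<phi> t)) * poly d t ^ (k + l) = poly (p * d ^ l + q * d ^ k) t"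
    if "poly d t \<noteq> 0" for t
    using p[rule_format, OF that] q[rule_format, OF that]
    by (simp add: algebra_simps power_add flip: p q)
  then show ?case by blast
next
  case (mult f g)
  then obtain p k q l where p: "\<forall>t. poly d t \<noteq> 0 \<longrightarrow> f (\<phi> t) * poly d t ^ k = poly p t"
    and q: "\<forall>t. poly d t \<noteq> 0 \<longrightarrow> g (\<phi> t) * poly d t ^ l = poly q t" by blast
  have "(f (\<phi> t) * g (\<phi> t)) * poly d t ^ (k + l) = poly (p * q) t"
    if "poly d t \<noteq> 0" for t
    using p[rule_format, OF that] q[rule_format, OF that]
    by (simp add: algebra_simps power_add flip: p q)
  then show ?case by blast
qed (use assms(2) in blast)

text \<open>A product of nonzero polynomials in one variable has finitely many roots, so
  nonvanishing at two different parameters yields nonvanishing at a common one. The irreducibility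
  of \<open>SL\<close> and of \<open>borel_std\<close> rests on this.\<close>

lemma rational_curve_common_nonzero:
  fixes d :: "complex poly"
  assumes fg: "f \<in> poly_funs C" "g \<in> poly_funs C"
    and curve: "\<And>c. c \<in> C \<Longrightarrow> \<exists>p k. \<forall>t. poly d t \<noteq> 0 \<longrightarrow> c (\<phi> t) * poly d t ^ k = poly p t"
    and nz: "poly d s \<noteq> 0" "poly d t \<noteq> 0" "f (\<phi> s) \<noteq> 0" "g (\<phi> t) \<noteq> 0"
    and X: "finite X"
  shows "\<exists>u. u \<notin> X \<and> poly d u \<noteq> 0 \<and> f (\<phi> u) \<noteq> 0 \<and> g (\<phi> u) \<noteq> 0"
proof -
  obtain p k where p: "\<forall>t. poly d t \<noteq> 0 \<longrightarrow> f (\<phi> t) * poly d t ^ k = poly p t"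
    using poly_funs_rational_curve[OF fg(1), of d \<phi>] curve by blast
  obtain q l where q: "\<forall>t. poly d t \<noteq> 0 \<longrightarrow> g (\<phi> t) * poly d t ^ l = poly q t"
    using poly_funs_rational_curve[OF fg(2), of d \<phi>] curve by blast
  have "poly p s \<noteq> 0" "poly q t \<noteq> 0" using p q nz by (metis mult_eq_0_iff power_eq_0_iff)+
  then have "d * p * q \<noteq> 0" using nz by auto
  then have "finite ({u. poly (d * p * q) u = 0} \<union> X)" using X poly_roots_finite by blast
  then obtain u where "u \<notin> {u. poly (d * p * q) u = 0} \<union> X"
    using ex_new_if_finite[OF infinite_UNIV_char_0] by blast
  then have u: "poly d u \<noteq> 0" "poly p u \<noteq> 0" "poly q u \<noteq> 0" "u \<notin> X" by auto
  then have "f (\<phi> u) \<noteq> 0" "g (\<phi> u) \<noteq> 0" using p q by (metis mult_zero_left)+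
  with u show ?thesis by blast
qed

lemma poly_funs_poly_curve:
  fixes \<phi> :: "complex \<Rightarrow> 'a"
  assumes "f \<in> poly_funs C" and "\<And>c. c \<in> C \<Longrightarrow> \<exists>p. \<forall>t. c (\<phi> t) = poly p t"
  shows "\<exists>p. \<forall>t. f (\<phi> t) = poly p t"
proof -
  have "\<exists>p k. \<forall>t. poly 1 t \<noteq> 0 \<longrightarrow> c (\<phi> t) * poly 1 t ^ k = poly p t" if "c \<in> C" for c
    using assms(2)[OF that] by auto
  from poly_funs_rational_curve[OF assms(1) this] show ?thesis by auto
qed

section \<open>The special linear group\<close>

lemma carrier_SL [simp]: "A \<in> carrier SL \<longleftrightarrow> det A = 1"
  and mult_SL [simp]: "A \<otimes>\<^bsub>SL\<^esub> B = A ** B"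
  and one_SL [simp]: "\<one>\<^bsub>SL\<^esub> = mat 1"
  by (simp_all add: SL_def)

interpretation SL: group SL by (rule group_SL)

lemma SL_inv:
  fixes A :: "complex^'n^'n"
  assumes "det A = 1"
  shows "A ** inv\<^bsub>SL\<^esub> A = mat 1" "inv\<^bsub>SL\<^esub> A ** A = mat 1" "det (inv\<^bsub>SL\<^esub> A) = 1"
  using SL.r_inv[of A] SL.l_inv[of A] SL.inv_closed[of A] assms by simp_all

lemma SL_cancel:
  fixes A :: "complex^'n^'n"
  assumes "det A = 1"
  shows "A ** (inv\<^bsub>SL\<^esub> A ** B) = B" "inv\<^bsub>SL\<^esub> A ** (A ** B) = B"
    "A *v (inv\<^bsub>SL\<^esub> A *v v) = v" "inv\<^bsub>SL\<^esub> A *v (A *v v) = v"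
  by (simp_all add: matrix_mul_assoc matrix_vector_mul_assoc SL_inv[OF assms])

lemmas matrix_mul_rassoc = matrix_mul_assoc[symmetric]

lemma SL_inv_eqI:
  fixes A B :: "complex^'n^'n"
  assumes "det A = 1" "A ** B = mat 1"
  shows "inv\<^bsub>SL\<^esub> A = B"
  using SL_cancel(2)[OF assms(1), of B] assms(2) by simp

lemma matrix_vector_mult_axis:
  fixes A :: "'a::comm_semiring_1^'n^'m"
  shows "(A *v axis j c) $ i = A $ i $ j * c"
proof -
  have "(\<Sum>k\<in>UNIV. A $ i $ k * axis j c $ k) = (\<Sum>k\<in>UNIV. if k = j then A $ i $ j * c else 0)"
    by (rule sum.cong) (auto simp: axis_def)
  then show ?thesis by (simp add: matrix_vector_mult_def)
qed

text \<open>Cramer's rule at determinant 1: the entries of the inverse are polynomials in the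
  entries of \<open>A\<close>.\<close>

lemma SL_inv_coord:
  fixes A :: "complex^'n^'n"
  assumes "det A = 1"
  shows "(inv\<^bsub>SL\<^esub> A) $ i $ j = det (\<chi> r s. if s = i then axis j 1 $ r else A $ r $ s)"
proof -
  have "A *v (inv\<^bsub>SL\<^esub> A *v axis j 1) = axis j 1"
    by (simp add: matrix_vector_mul_assoc SL_inv[OF assms])
  then have "inv\<^bsub>SL\<^esub> A *v axis j 1 = (\<chi> k. det (\<chi> r s. if s = k then axis j 1 $ r else A $ r $ s) / det A)"
    by (subst (asm) cramer) (use assms in auto)
  then have "(inv\<^bsub>SL\<^esub> A *v axis j 1) $ i = det (\<chi> r s. if s = i then axis j 1 $ r else A $ r $ s)"
    by (simp add: assms)
  then show ?thesis by (simp add: matrix_vector_mult_axis)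
qed

lemma poly_funs_cofactor:
  "(\<lambda>A. det (\<chi> r s. if s = i then axis j 1 $ r else A $ r $ s)) \<in> poly_funs mat_coords"
proof (rule poly_funs_det)
  fix r s
  show "(\<lambda>A. (\<chi> r s. if s = i then axis j 1 $ r else A $ r $ s) $ r $ s) \<in> poly_funs mat_coords"
    by (cases "s = i") (simp_all add: poly_funs_mat_coord poly_funs.const)
qed

lemma topspace_SL_topology [simp]: "topspace SL_topology = carrier SL"
  by (simp add: SL_topology_def)

lemma openin_SL_topology:
  "openin SL_topology U \<longleftrightarrow>
     U \<subseteq> carrier SL \<and> (\<forall>x\<in>U. \<exists>f\<in>poly_funs mat_coords. f x \<noteq> 0 \<and> {y\<in>carrier SL. f y \<noteq> 0} \<subseteq> U)"
  unfolding SL_topology_def openin_subtopology_zariski ..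

lemma continuous_map_SL:
  fixes \<phi> :: "complex^'n^'n \<Rightarrow> complex^'n^'n"
  assumes "\<phi> \<in> carrier SL \<rightarrow> carrier SL"
    and "\<And>i j. \<exists>g\<in>poly_funs mat_coords. \<forall>A\<in>carrier SL. \<phi> A $ i $ j = g A"
  shows "continuous_map SL_topology SL_topology \<phi>"
  unfolding SL_topology_def using assms
  by (intro continuous_map_zariski) (auto simp: mat_coords_def)

lemma continuous_map_SL_sandwich:
  fixes x y :: "complex^'n^'n"
  assumes "det x = 1" "det y = 1"
  shows "continuous_map SL_topology SL_topology (\<lambda>A. x ** A ** y)"
proof (rule continuous_map_SL)
  fix i j
  have "(\<lambda>A. (x ** A ** y) $ i $ j) \<in> poly_funs mat_coords"
    by (intro poly_funs_matrix_mult poly_funs.const poly_funs_mat_coord)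
  then show "\<exists>g\<in>poly_funs mat_coords. \<forall>A\<in>carrier SL. (x ** A ** y) $ i $ j = g A"
    by (rule bexI[rotated]) simp
qed (auto simp: det_mul assms)

text \<open>Applied to a connected group, this map shows that the commutators with a fixed
  \<open>y\<close> form a connected set through the identity.\<close>

lemma continuous_map_SL_commutator:
  fixes y :: "complex^'n^'n"
  assumes "det y = 1"
  shows "continuous_map SL_topology SL_topology (\<lambda>A. A ** y ** inv\<^bsub>SL\<^esub> A ** inv\<^bsub>SL\<^esub> y)"
proof (rule continuous_map_SL)
  fix i j :: 'n
  define G :: "'n \<Rightarrow> 'n \<Rightarrow> complex^'n^'n \<Rightarrow> complex" where
    "G i j A = det (\<chi> r s. if s = i then axis j 1 $ r else A $ r $ s)" for i j A
  have G: "G r s \<in> poly_funs mat_coords"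
    "A \<in> carrier SL \<Longrightarrow> (inv\<^bsub>SL\<^esub> A) $ r $ s = G r s A" for r s A
    unfolding G_def using poly_funs_cofactor[of r s] by (simp_all add: SL_inv_coord)
  define g where "g = (\<lambda>A. (A ** y ** (\<chi> r s. G r s A) ** inv\<^bsub>SL\<^esub> y) $ i $ j)"
  have "g \<in> poly_funs mat_coords" unfolding g_def
    by (intro poly_funs_matrix_mult poly_funs.const poly_funs_mat_coord) (simp add: G)
  moreover have "(A ** y ** inv\<^bsub>SL\<^esub> A ** inv\<^bsub>SL\<^esub> y) $ i $ j = g A" if "A \<in> carrier SL" for A
  proof -
    have "inv\<^bsub>SL\<^esub> A = (\<chi> r s. G r s A)" using G(2)[OF that] by (simp add: vec_eq_iff)
    then show ?thesis by (simp add: g_def)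
  qed
  ultimately show "\<exists>g\<in>poly_funs mat_coords. \<forall>A\<in>carrier SL.
      (A ** y ** inv\<^bsub>SL\<^esub> A ** inv\<^bsub>SL\<^esub> y) $ i $ j = g A" by blast
qed (auto simp: det_mul SL_inv assms)

section \<open>Triangular matrices\<close>

text \<open>An index type carries no order. An arbitrary enumeration supplies one, and triangular
  matrices and the standard flag refer to it.\<close>

definition idx :: "'n::finite \<Rightarrow> nat" where
  "idx = (SOME f. bij_betw f UNIV {..<CARD('n)})"

lemma bij_idx: "bij_betw (idx :: 'n::finite \<Rightarrow> nat) UNIV {..<CARD('n)}"
proof -
  have "\<exists>f::'n \<Rightarrow> nat. bij_betw f UNIV {..<CARD('n)}"
    using ex_bij_betw_finite_nat[of "UNIV::'n set"] by (auto simp: atLeast0LessThan)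
  then show ?thesis unfolding idx_def by (rule someI_ex)
qed

lemma inj_idx: "inj (idx :: 'n::finite \<Rightarrow> nat)"
  using bij_idx by (auto simp: bij_betw_def)

lemma idx_eq_iff [simp]: "idx i = idx j \<longleftrightarrow> i = j"
  using inj_idx by (auto dest: injD)

lemma idx_less [simp]: "idx (i::'n::finite) < CARD('n)"
  using bij_idx by (auto simp: bij_betw_def)

lemma idx_surj:
  assumes "k < CARD('n)"
  obtains i :: "'n::finite" where "idx i = k"
  using assms bij_idx[where 'n='n] by (metis (no_types, opaque_lifting) bij_betw_def imageE lessThan_iff)

text \<open>The order is a parameter so that lower triangular and reordered matrices are covered. A
  permutation \<open>p\<close> with \<open>e i \<le> e (p i)\<close> throughout preserves the sum of
  \<open>e\<close>, hence is the identity, so every other term of the determinant contains a zero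
  entry.\<close>

lemma det_triangular:
  fixes A :: "'a::comm_ring_1^'n^'n" and e :: "'n \<Rightarrow> nat"
  assumes e: "inj e" and A: "\<And>i j. e j < e i \<Longrightarrow> A $ i $ j = 0"
  shows "det A = (\<Prod>i\<in>UNIV. A $ i $ i)"
proof -
  have "of_int (sign p) * (\<Prod>i\<in>UNIV. A $ i $ p i) = 0"
    if p: "p permutes (UNIV::'n set)" and "p \<noteq> id" for p
  proof -
    have "\<exists>i. e (p i) < e i"
    proof (rule ccontr)
      assume "\<not> ?thesis"
      then have le: "\<And>i. e i \<le> e (p i)" by (simp add: not_less)
      have "(\<Sum>i\<in>UNIV. e (p i)) = (\<Sum>i\<in>UNIV. e i)"
        using sum.permute[OF p, of e] by (simp add: comp_def)
      then have "e (p i) = e i" for i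
        using sum_strict_mono_ex1[of UNIV e "\<lambda>i. e (p i)"] le by (metis finite_code iso_tuple_UNIV_I nat_less_le)
      then show False using e \<open>p \<noteq> id\<close> by (auto simp: fun_eq_iff dest: injD)
    qed
    then obtain i where "A $ i $ p i = 0" using A by blast
    then have "(\<Prod>i\<in>UNIV. A $ i $ p i) = 0" by (meson UNIV_I finite prod_zero)
    then show ?thesis by simp
  qed
  then have "det A = (\<Sum>p\<in>{id}. of_int (sign p) * (\<Prod>i\<in>UNIV. A $ i $ p i))"
    unfolding det_def
    by (intro sum.mono_neutral_right) (auto simp: permutes_id)
  then show ?thesis by (simp add: sign_id)
qed

definition upper :: "complex^'n^'n \<Rightarrow> bool" where
  "upper A \<longleftrightarrow> (\<forall>i j. idx j < idx i \<longrightarrow> A $ i $ j = 0)"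

lemma upperD: "upper A \<Longrightarrow> idx j < idx i \<Longrightarrow> A $ i $ j = 0"
  by (simp add: upper_def)

lemma det_upper: "upper A \<Longrightarrow> det A = (\<Prod>i\<in>UNIV. A $ i $ i)"
  by (rule det_triangular[OF inj_idx]) (rule upperD)

definition std :: "nat \<Rightarrow> (complex^'n) set" where
  "std k = {v. \<forall>i. k \<le> idx i \<longrightarrow> v $ i = 0}"

lemma subspace_std [simp]: "vec.subspace (std k)"
  by (auto simp: std_def vec.subspace_def)

lemma card_idx_less:
  assumes "k \<le> CARD('n)"
  shows "card {i::'n::finite. idx i < k} = k"
proof -
  have "m \<in> idx ` {i::'n. idx i < k}" if "m < k" for m
    using idx_surj[where 'n='n, of m] that assms by (metis imageI less_le_trans mem_Collect_eq)
  then have "idx ` {i::'n. idx i < k} = {..<k}" by auto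
  then show ?thesis by (metis card_image card_lessThan inj_idx inj_on_subset subset_UNIV)
qed

lemma dim_std:
  assumes "k \<le> CARD('n)"
  shows "vec.dim (std k :: (complex^'n) set) = k"
proof -
  have "std k = {x::complex^'n. \<forall>i. i \<notin> {i. idx i < k} \<longrightarrow> x $ i = 0}"
    by (auto simp: std_def not_less)
  then have "vec.dim (std k :: (complex^'n) set) = card {i::'n. idx i < k}"
    by (simp only: dim_substandard_cart)
  then show ?thesis using card_idx_less[OF assms] by simp
qed

lemma std_mono: "k \<le> l \<Longrightarrow> std k \<subseteq> std l"
  by (auto simp: std_def)

lemma std_0 [simp]: "std 0 = {0}"
  by (auto simp: std_def vec_eq_iff)

lemma std_card [simp]: "CARD('n) \<le> k \<Longrightarrow> (std k :: (complex^'n) set) = UNIV"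
proof -
  assume "CARD('n) \<le> k"
  then have "\<not> k \<le> idx i" for i :: 'n using idx_less[of i] by linarith
  then show ?thesis by (simp add: std_def)
qed

lemma axis_in_std: "axis i c \<in> std k \<longleftrightarrow> idx i < k \<or> c = 0"
  by (auto simp: std_def axis_def not_less)

text \<open>Triangularity becomes the stability of a flag, which makes it evident for products and,
  by a comparison of dimensions, for inverses.\<close>

lemma upper_iff_std: "upper A \<longleftrightarrow> (\<forall>k v. v \<in> std k \<longrightarrow> A *v v \<in> std k)"
proof
  assume "upper A"
  then show "\<forall>k v. v \<in> std k \<longrightarrow> A *v v \<in> std k"
    by (auto simp: std_def upper_def matrix_vector_mult_def intro!: sum.neutral)
       (metis le_less_trans not_le)
next
  assume *: "\<forall>k v. v \<in> std k \<longrightarrow> A *v v \<in> std k"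
  show "upper A" unfolding upper_def
  proof (intro allI impI)
    fix i j :: 'a assume "idx j < idx i"
    have "A *v axis j 1 \<in> std (Suc (idx j))" using * by (simp add: axis_in_std)
    then show "A $ i $ j = 0" using \<open>idx j < idx i\<close>
      by (simp add: std_def matrix_vector_mult_axis)
  qed
qed

lemma upper_mult: "upper A \<Longrightarrow> upper B \<Longrightarrow> upper (A ** B)"
  unfolding upper_iff_std by (simp flip: matrix_vector_mul_assoc)

lemma upper_mat_1 [simp]: "upper (mat 1)"
  by (auto simp: upper_def mat_def)

lemma matrix_image_subspace:
  fixes A :: "complex^'n^'m"
  shows "vec.subspace S \<Longrightarrow> vec.subspace ((*v) A ` S)"
  by (rule vec.subspace_image)

lemma inj_matrix_of_det:
  fixes A :: "complex^'n^'n"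
  assumes "det A \<noteq> 0"
  shows "inj ((*v) A)"
  using assms by (metis invertible_det_nz matrix_left_invertible_injective invertible_left_inverse)

lemma dim_matrix_image:
  fixes A :: "complex^'n^'n"
  assumes "det A \<noteq> 0"
  shows "vec.dim ((*v) A ` S) = vec.dim S"
proof -
  have "inj_on ((*v) A) (vec.span S)" using inj_matrix_of_det[OF assms] by (rule inj_on_subset) simp
  then show ?thesis by (rule vec.dim_image_eq[OF matrix_vector_mul_linear_gen])
qed

lemma matrix_image_eq_iff_subset:
  fixes A :: "complex^'n^'n"
  assumes "det A \<noteq> 0" "vec.subspace S" "vec.subspace T" "vec.dim S = vec.dim T"
  shows "(*v) A ` S = T \<longleftrightarrow> (*v) A ` S \<subseteq> T"
  using vec.subspace_dim_equal[OF matrix_image_subspace[OF assms(2)] assms(3), of A]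
    dim_matrix_image[OF assms(1), of S] assms(4) by auto

lemma upper_image_std:
  fixes A :: "complex^'n^'n"
  assumes "upper A" "det A \<noteq> 0"
  shows "(*v) A ` std k = std k"
  by (subst matrix_image_eq_iff_subset) (use assms in \<open>auto simp: upper_iff_std\<close>)

section \<open>The standard Borel subgroup\<close>

text \<open>Used to normalise determinants: dividing one column by the determinant brings an
  invertible matrix into \<open>SL\<close> and only rescales one vector of the basis formed by its
  columns.\<close>

lemma det_scale_column:
  fixes x :: "complex^'n^'n"
  shows "det (\<chi> i j. if j = i0 then c * x $ i $ j else x $ i $ j) = c * det x"
proof -
  define D :: "complex^'n^'n" where "D = (\<chi> i j. if i = j then (if j = i0 then c else 1) else 0)"
  have "(\<chi> i j. if j = i0 then c * x $ i $ j else x $ i $ j) = x ** D"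
    by (simp add: vec_eq_iff matrix_matrix_mult_def D_def if_distrib[of "\<lambda>c. _ * c"] cong: if_cong)
  moreover have "det D = (\<Prod>i\<in>UNIV. D $ i $ i)" by (rule det_diagonal) (simp add: D_def)
  ultimately show ?thesis by (simp add: det_mul D_def)
qed

text \<open>The rational curve joining \<open>x\<close> to \<open>y\<close> is the segment between them, with one column
  divided by the determinant.\<close>

lemma irreducible_linear_section:
  fixes L :: "(complex^'n^'n) set"
  assumes seg: "\<And>x y t. x \<in> L \<Longrightarrow> y \<in> L \<Longrightarrow> (\<chi> i j. (1 - t) * x $ i $ j + t * y $ i $ j) \<in> L"
    and scale: "\<And>x c. x \<in> L \<Longrightarrow> (\<chi> i j. if j = i0 then c * x $ i $ j else x $ i $ j) \<in> L"
    and fg: "f \<in> poly_funs mat_coords" "g \<in> poly_funs mat_coords"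
    and x: "x \<in> L" "det x = 1" "f x \<noteq> 0" and y: "y \<in> L" "det y = 1" "g y \<noteq> 0"
  shows "\<exists>z\<in>L. det z = 1 \<and> f z \<noteq> 0 \<and> g z \<noteq> 0"
proof -
  define M :: "complex \<Rightarrow> complex^'n^'n" where "M t = (\<chi> i j. (1 - t) * x $ i $ j + t * y $ i $ j)" for t
  have M: "M t $ i $ j = poly [:x $ i $ j, y $ i $ j - x $ i $ j:] t" for t i j
    by (simp add: M_def algebra_simps)
  have det_poly: "(\<lambda>A. det A) \<in> poly_funs mat_coords"
    by (rule poly_funs_det) (rule poly_funs_mat_coord)
  have "\<exists>d. \<forall>t. det (M t) = poly d t"
  proof (rule poly_funs_poly_curve[OF det_poly])
    fix c assume "c \<in> (mat_coords :: (complex^'n^'n \<Rightarrow> complex) set)"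
    then obtain i j where "c = (\<lambda>A. A $ i $ j)" by (auto simp: mat_coords_def)
    then show "\<exists>p. \<forall>t. c (M t) = poly p t" using M by blast
  qed
  then obtain d where d: "\<And>t. det (M t) = poly d t" by blast
  define \<phi> :: "complex \<Rightarrow> complex^'n^'n"
    where "\<phi> t = (\<chi> i j. if j = i0 then inverse (poly d t) * M t $ i $ j else M t $ i $ j)" for t
  have M01: "M 0 = x" "M 1 = y" by (simp_all add: M_def vec_eq_iff)
  then have d01: "poly d 0 = 1" "poly d 1 = 1" using d x y by metis+
  then have \<phi>01: "\<phi> 0 = x" "\<phi> 1 = y" by (simp_all add: \<phi>_def M01 vec_eq_iff)
  have curve: "\<exists>p k. \<forall>t. poly d t \<noteq> 0 \<longrightarrow> c (\<phi> t) * poly d t ^ k = poly p t" 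
    if c_coord: "c \<in> mat_coords" for c :: "complex^'n^'n \<Rightarrow> complex"
  proof -
    obtain i j where c: "c = (\<lambda>A. A $ i $ j)" using c_coord by (auto simp: mat_coords_def)
    show ?thesis
    proof (cases "j = i0")
      case True
      show ?thesis by (rule exI[of _ "[:x $ i $ j, y $ i $ j - x $ i $ j:]"], rule exI[of _ 1])
          (simp add: c \<phi>_def M True)
    next
      case False
      show ?thesis by (rule exI[of _ "[:x $ i $ j, y $ i $ j - x $ i $ j:]"], rule exI[of _ 0])
          (simp add: c \<phi>_def M False)
    qed
  qed
  obtain u where u: "poly d u \<noteq> 0" "f (\<phi> u) \<noteq> 0" "g (\<phi> u) \<noteq> 0"
    using rational_curve_common_nonzero[OF fg, of d \<phi> 0 1 "{}"] curve d01 \<phi>01 x y by auto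
  have "\<phi> u \<in> L" unfolding \<phi>_def by (rule scale) (unfold M_def, rule seg[OF x(1) y(1)])
  moreover have "det (\<phi> u) = 1" using u(1) by (simp add: \<phi>_def det_scale_column d)
  ultimately show ?thesis using u by blast
qed

lemma SL_irreducible:
  fixes x y :: "complex^'n^'n"
  assumes "f \<in> poly_funs mat_coords" "g \<in> poly_funs mat_coords"
    and "det x = 1" "f x \<noteq> 0" "det y = 1" "g y \<noteq> 0"
  shows "\<exists>z. det z = 1 \<and> f z \<noteq> 0 \<and> g z \<noteq> 0"
  using irreducible_linear_section[of UNIV _ f g x y] assms by simp

lemma SL_open_meet:
  fixes U V :: "(complex^'n^'n) set"
  assumes "openin SL_topology U" "openin SL_topology V" "U \<noteq> {}" "V \<noteq> {}"
  shows "U \<inter> V \<noteq> {}"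
proof -
  from assms obtain x y where "x \<in> U" "y \<in> V" by blast
  obtain f where f: "f \<in> poly_funs mat_coords" "f x \<noteq> 0" "{z\<in>carrier SL. f z \<noteq> 0} \<subseteq> U"
    using assms(1) \<open>x \<in> U\<close> unfolding openin_SL_topology by blast
  obtain g where g: "g \<in> poly_funs mat_coords" "g y \<noteq> 0" "{z\<in>carrier SL. g z \<noteq> 0} \<subseteq> V"
    using assms(2) \<open>y \<in> V\<close> unfolding openin_SL_topology by blast
  have "det x = 1" "det y = 1"
    using openin_subset[OF assms(1)] openin_subset[OF assms(2)] \<open>x \<in> U\<close> \<open>y \<in> V\<close> by auto
  then obtain z where "det z = 1" "f z \<noteq> 0" "g z \<noteq> 0"
    using SL_irreducible[of f g x y] f g by blast
  then show ?thesis using f(3) g(3) by auto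
qed

text \<open>Two open sets that meet \<open>H\<close> contain nonvanishing loci of polynomials around
  points of \<open>H\<close>. These meet inside \<open>H\<close>, so \<open>H\<close> has no
  separation.\<close>

lemma connectedin_SL_irreducible:
  assumes "H \<subseteq> carrier SL"
    and irr: "\<And>f g x y. f \<in> poly_funs mat_coords \<Longrightarrow> g \<in> poly_funs mat_coords \<Longrightarrow> x \<in> H \<Longrightarrow> y \<in> H
      \<Longrightarrow> f x \<noteq> 0 \<Longrightarrow> g y \<noteq> 0 \<Longrightarrow> \<exists>z\<in>H. f z \<noteq> 0 \<and> g z \<noteq> 0"
  shows "connectedin SL_topology H"
  unfolding connectedin
proof (intro conjI notI)
  assume "\<exists>E1 E2. openin SL_topology E1 \<and> openin SL_topology E2 \<and> H \<subseteq> E1 \<union> E2 \<and>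
    E1 \<inter> E2 \<inter> H = {} \<and> E1 \<inter> H \<noteq> {} \<and> E2 \<inter> H \<noteq> {}"
  then obtain E1 E2 x y where E: "openin SL_topology E1" "openin SL_topology E2"
    "E1 \<inter> E2 \<inter> H = {}" "x \<in> E1" "x \<in> H" "y \<in> E2" "y \<in> H" by blast
  obtain f where f: "f \<in> poly_funs mat_coords" "f x \<noteq> 0" "{z\<in>carrier SL. f z \<noteq> 0} \<subseteq> E1"
    using E unfolding openin_SL_topology by blast
  obtain g where g: "g \<in> poly_funs mat_coords" "g y \<noteq> 0" "{z\<in>carrier SL. g z \<noteq> 0} \<subseteq> E2"
    using E unfolding openin_SL_topology by blast
  show False using irr[of f g x y] f g E assms(1) by blast
qed (use assms in simp)

section \<open>The upper triangular group is connected and solvable\<close>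

definition borel_std :: "(complex^'n^'n) set" where
  "borel_std = {A. det A = 1 \<and> upper A}"

lemma upper_inv:
  fixes A :: "complex^'n^'n"
  assumes "upper A" "det A = 1"
  shows "upper (inv\<^bsub>SL\<^esub> A)"
  unfolding upper_iff_std
proof (intro allI impI)
  fix k and v :: "complex^'n" assume "v \<in> std k"
  then obtain u where "u \<in> std k" "v = A *v u" using upper_image_std[OF assms(1), of k] assms(2) by auto
  then show "inv\<^bsub>SL\<^esub> A *v v \<in> std k" by (simp add: matrix_vector_mul_assoc SL_inv assms)
qed

lemma subgroup_borel_std: "subgroup borel_std SL"
proof (rule SL.subgroupI)
  have "mat 1 \<in> borel_std" by (simp add: borel_std_def)
  then show "borel_std \<noteq> {}" by blast
qed (auto simp: borel_std_def det_mul upper_mult upper_inv SL_inv(3))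

lemma connected_borel_std: "connectedin SL_topology (borel_std :: (complex^'n^'n) set)"
proof (rule connectedin_SL_irreducible)
  fix f g :: "complex^'n^'n \<Rightarrow> complex" and x y
  assume *: "f \<in> poly_funs mat_coords" "g \<in> poly_funs mat_coords" "x \<in> borel_std" "y \<in> borel_std" "f x \<noteq> 0" "g y \<noteq> 0"
  obtain i0 :: 'n where True by simp
  have "\<exists>z\<in>Collect upper. det z = 1 \<and> f z \<noteq> 0 \<and> g z \<noteq> 0"
    by (rule irreducible_linear_section[of _ i0 f g x y]) (use * in \<open>auto simp: upper_def borel_std_def\<close>)
  then show "\<exists>z\<in>borel_std. f z \<noteq> 0 \<and> g z \<noteq> 0" by (auto simp: borel_std_def)
qed (auto simp: borel_std_def)

text \<open>The condition says that \<open>A - 1\<close> lowers the standard flag by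
  \<open>k\<close> steps. Truncated subtraction sends indices below \<open>k\<close> to
  \<open>std 0 = {0}\<close>, so \<open>unip 1\<close> is the unipotent triangular group and
  \<open>unip CARD('n)\<close> is trivial.\<close>

definition unip :: "nat \<Rightarrow> (complex^'n^'n) set" where
  "unip k = {A. det A = 1 \<and> (\<forall>j v. v \<in> std j \<longrightarrow> A *v v - v \<in> std (j - k))}"

lemma std_add: "u \<in> std k \<Longrightarrow> v \<in> std k \<Longrightarrow> u + v \<in> std k"
  and std_diff: "u \<in> std k \<Longrightarrow> v \<in> std k \<Longrightarrow> u - v \<in> std k"
  by (simp_all add: vec.subspace_add vec.subspace_diff)

lemma unip_upper: "(A :: complex^'n^'n) \<in> unip k \<Longrightarrow> upper A"
  unfolding upper_iff_std
proof (intro allI impI)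
  fix j and v :: "complex^'n" assume A: "A \<in> unip k" and v: "v \<in> std j"
  have "A *v v - v \<in> std j" using A v std_mono[of "j - k" j] by (auto simp: unip_def)
  from std_add[OF this v] show "A *v v \<in> std j" by simp
qed

lemma subgroup_unip: "subgroup (unip k :: (complex^'n^'n) set) SL"
proof (rule SL.subgroupI)
  show "unip k \<subseteq> (carrier SL :: (complex^'n^'n) set)" by (auto simp: unip_def)
  have "mat 1 \<in> (unip k :: (complex^'n^'n) set)" by (auto simp: unip_def vec.subspace_0)
  then show "(unip k :: (complex^'n^'n) set) \<noteq> {}" by blast
next
  fix A :: "complex^'n^'n" assume A: "A \<in> unip k"
  then have d: "det A = 1" by (simp add: unip_def)
  have u: "upper (inv\<^bsub>SL\<^esub> A)" using unip_upper[OF A] d by (rule upper_inv)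
  have "inv\<^bsub>SL\<^esub> A *v v - v \<in> std (j - k)" if "v \<in> std j" for j v
  proof -
    have "A *v v - v \<in> std (j - k)" using A that by (simp add: unip_def)
    then have "inv\<^bsub>SL\<^esub> A *v (A *v v - v) \<in> std (j - k)" using u by (simp add: upper_iff_std)
    then have "0 - inv\<^bsub>SL\<^esub> A *v (A *v v - v) \<in> std (j - k)" by (intro std_diff) (auto simp: vec.subspace_0)
    then show ?thesis
      by (simp add: matrix_vector_mult_diff_distrib matrix_vector_mul_assoc SL_inv[OF d])
  qed
  then show "inv\<^bsub>SL\<^esub> A \<in> unip k" using SL_inv[OF d] by (simp add: unip_def)
next
  fix A B :: "complex^'n^'n" assume A: "A \<in> unip k" and B: "B \<in> unip k"
  have "(A ** B) *v v - v \<in> std (j - k)" if v: "v \<in> std j" for j v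
  proof -
    have "B *v v - v \<in> std (j - k)" using B v by (simp add: unip_def)
    then have "A *v (B *v v - v) \<in> std (j - k)" using unip_upper[OF A] by (simp add: upper_iff_std)
    moreover have "A *v v - v \<in> std (j - k)" using A v by (simp add: unip_def)
    ultimately have "A *v (B *v v - v) + (A *v v - v) \<in> std (j - k)" by (rule std_add)
    then show ?thesis by (simp add: matrix_vector_mult_diff_distrib matrix_vector_mul_assoc)
  qed
  then show "A \<otimes>\<^bsub>SL\<^esub> B \<in> unip k" using A B by (simp add: unip_def det_mul)
qed

text \<open>With \<open>v = B A u\<close>, the difference of the commutator and the identity at
  \<open>v\<close> is \<open>(A B - B A) u\<close>, so no inverse has to be expanded.\<close>

lemma commutator_in_unip:
  fixes A B :: "complex^'n^'n"
  assumes "upper A" "upper B" "det A = 1" "det B = 1"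
    and "\<And>j u. u \<in> std j \<Longrightarrow> (A ** B) *v u - (B ** A) *v u \<in> std (j - k)"
  shows "A ** B ** inv\<^bsub>SL\<^esub> A ** inv\<^bsub>SL\<^esub> B \<in> unip k"
proof -
  have "(A ** B ** inv\<^bsub>SL\<^esub> A ** inv\<^bsub>SL\<^esub> B) *v v - v \<in> std (j - k)" if "v \<in> std j" for j v
  proof -
    define u where "u = (inv\<^bsub>SL\<^esub> A ** inv\<^bsub>SL\<^esub> B) *v v"
    have "u \<in> std j"
      using upper_mult[OF upper_inv upper_inv, of A B] assms that by (simp add: u_def upper_iff_std)
    moreover have "(B ** A) *v u = v"
      by (simp add: u_def SL_cancel assms flip: matrix_vector_mul_assoc)
    moreover have "(A ** B) *v u = (A ** B ** inv\<^bsub>SL\<^esub> A ** inv\<^bsub>SL\<^esub> B) *v v"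
      by (simp add: u_def matrix_vector_mul_assoc matrix_mul_assoc)
    ultimately show ?thesis using assms(5) by metis
  qed
  then show ?thesis using assms by (simp add: unip_def det_mul SL_inv)
qed

lemma upper_mult_diag:
  fixes A B :: "complex^'n^'n"
  assumes "upper A" "upper B"
  shows "(A ** B) $ i $ i = A $ i $ i * B $ i $ i"
proof -
  have "(\<Sum>k\<in>UNIV. A $ i $ k * B $ k $ i) = (\<Sum>k\<in>UNIV. if k = i then A $ i $ i * B $ i $ i else 0)"
  proof (rule sum.cong)
    fix k
    consider "k = i" | "idx k < idx i" | "idx i < idx k" by (metis idx_eq_iff linorder_less_linear)
    then show "A $ i $ k * B $ k $ i = (if k = i then A $ i $ i * B $ i $ i else 0)"
      by cases (use assms in \<open>auto simp: upperD\<close>)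
  qed simp
  then show ?thesis by (simp add: matrix_matrix_mult_def)
qed

text \<open>\<open>A B\<close> and \<open>B A\<close> have the same diagonal, so their difference is
  strictly upper triangular.\<close>

lemma commutator_borel_std:
  fixes A B :: "complex^'n^'n"
  assumes "A \<in> borel_std" "B \<in> borel_std"
  shows "A ** B ** inv\<^bsub>SL\<^esub> A ** inv\<^bsub>SL\<^esub> B \<in> unip 1"
proof (rule commutator_in_unip)
  have ul: "upper A" "upper B" "upper (A ** B)" "upper (B ** A)"
    using assms by (auto simp: borel_std_def intro: upper_mult)
  define M where "M = A ** B - B ** A"
  have M: "M $ i $ j = 0" if "idx j \<le> idx i" for i j
    using ul upper_mult_diag[OF ul(1,2), of i] upper_mult_diag[OF ul(2,1), of i] that
    by (cases "i = j") (auto simp: M_def upper_def order.order_iff_strict)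
  fix j and u :: "complex^'n" assume u: "u \<in> std j"
  have "M $ i $ k * u $ k = 0" if "j - 1 \<le> idx i" for i k
  proof (cases "idx k \<le> idx i")
    case False
    then have "j \<le> idx k" using that by linarith
    then show ?thesis using u by (simp add: std_def)
  qed (simp add: M)
  then have "M *v u \<in> std (j - 1)" by (auto simp: std_def matrix_vector_mult_def intro!: sum.neutral)
  then show "(A ** B) *v u - (B ** A) *v u \<in> std (j - 1)"
    by (simp add: M_def matrix_vector_mult_diff_rdistrib)
qed (use assms in \<open>auto simp: borel_std_def\<close>)

text \<open>Since \<open>A B - B A = (A - 1)(B - 1) - (B - 1)(A - 1)\<close>, the flag drops by
  \<open>2 k\<close> steps, which is at least \<open>k + 1\<close>.\<close>

lemma commutator_unip:
  fixes A B :: "complex^'n^'n"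
  assumes A: "A \<in> unip k" and B: "B \<in> unip k" and k: "k \<ge> 1"
  shows "A ** B ** inv\<^bsub>SL\<^esub> A ** inv\<^bsub>SL\<^esub> B \<in> unip (Suc k)"
proof (rule commutator_in_unip)
  fix j and u :: "complex^'n" assume u: "u \<in> std j"
  have 1: "A *v (B *v u - u) - (B *v u - u) \<in> std (j - k - k)"
    using A B u unfolding unip_def by blast
  have 2: "B *v (A *v u - u) - (A *v u - u) \<in> std (j - k - k)"
    using A B u unfolding unip_def by blast
  have "(A ** B) *v u - (B ** A) *v u \<in> std (j - k - k)"
    using std_diff[OF 1 2] by (simp add: matrix_vector_mult_diff_distrib matrix_vector_mul_assoc)
  then show "(A ** B) *v u - (B ** A) *v u \<in> std (j - Suc k)"
    by (rule subsetD[OF std_mono, rotated]) (use k in linarith)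
qed (use A B unip_upper in \<open>auto simp: unip_def\<close>)

lemma unip_card: "unip CARD('n) = {mat 1 :: complex^'n^'n}"
proof -
  have "A = mat 1" if "A \<in> unip CARD('n)" for A :: "complex^'n^'n"
  proof -
    have "A *v v - v \<in> std 0" for v
    proof -
      have "v \<in> std CARD('n)" by simp
      then have "A *v v - v \<in> std (CARD('n) - CARD('n))" using that unfolding unip_def by blast
      then show ?thesis by simp
    qed
    then have "A *v v = mat 1 *v v" for v by simp
    then show ?thesis by (simp add: matrix_eq)
  qed
  moreover have "mat 1 \<in> (unip k :: (complex^'n^'n) set)" for k
    using subgroup.one_closed[OF subgroup_unip[of k]] by simp
  ultimately show ?thesis by blast
qed

section \<open>Derived series and conjugates of the triangular group\<close>

lemma derived_subset_subgroup:
  assumes "subgroup K SL" "\<And>A B. A \<in> H \<Longrightarrow> B \<in> H \<Longrightarrow> A ** B ** inv\<^bsub>SL\<^esub> A ** inv\<^bsub>SL\<^esub> B \<in> K"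
  shows "derived SL H \<subseteq> K"
  unfolding derived_def by (rule SL.generate_subgroup_incl[OF _ assms(1)]) (use assms(2) in auto)

lemma solvable_seq_borel_std: "solvable_seq SL (borel_std :: (complex^'n^'n) set)"
proof -
  let ?B = "borel_std :: (complex^'n^'n) set"
  have "(derived SL ^^ Suc k) ?B \<subseteq> unip (Suc k)" for k
  proof (induction k)
    case 0
    show ?case using derived_subset_subgroup[OF subgroup_unip commutator_borel_std] by simp
  next
    case (Suc k)
    have "derived SL (unip (Suc k)) \<subseteq> (unip (Suc (Suc k)) :: (complex^'n^'n) set)"
      by (rule derived_subset_subgroup[OF subgroup_unip]) (rule commutator_unip, auto)
    then show ?case using SL.mono_derived[OF Suc.IH] by auto
  qed
  from this[of "CARD('n) - 1"] have "(derived SL ^^ CARD('n)) ?B \<subseteq> {mat 1}"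
    using unip_card[where 'n='n] by simp
  then have "(derived SL ^^ CARD('n)) ?B = {\<one>\<^bsub>SL\<^esub>}"
    using subgroup.one_closed[OF SL.exp_of_derived_is_subgroup[OF subgroup_borel_std], of "CARD('n)"]
    by auto
  then show ?thesis by (rule SL.trivial_derived_seq_imp_solvable[OF subgroup_borel_std])
qed

text \<open>Solvability refers to derived subgroups inside the structure with carrier
  \<open>H\<close>, whereas the filtration above lives in \<open>SL\<close>.\<close>

lemma derived_exp_consistent:
  assumes "subgroup H SL"
  shows "(derived (SL\<lparr>carrier := H\<rparr>) ^^ n) H = (derived SL ^^ n) H \<and> (derived SL ^^ n) H \<subseteq> H"
proof (induction n)
  case (Suc n)
  then show ?case
    using SL.derived_consistent[OF _ assms, of "(derived SL ^^ n) H"] SL.derived_incl[OF _ assms]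
    by simp
qed simp

lemma solvable_subgroup_iff:
  assumes "subgroup H SL"
  shows "solvable (SL\<lparr>carrier := H\<rparr>) \<longleftrightarrow> (\<exists>n. (derived SL ^^ n) H = {mat 1})"
proof -
  interpret H: group "SL\<lparr>carrier := H\<rparr>" by (rule SL.subgroup_imp_group[OF assms])
  show ?thesis using derived_exp_consistent[OF assms] by (simp add: H.solvable_iff_trivial_derived_seq)
qed

text \<open>The stabilizer of the full flag whose steps are the images of \<open>std k\<close> under
  \<open>W\<close>.\<close>

definition borel_of :: "complex^'n^'n \<Rightarrow> (complex^'n^'n) set" where
  "borel_of W = {A. det A = 1 \<and> upper (inv\<^bsub>SL\<^esub> W ** A ** W)}"

lemma borel_of_eq_image:
  assumes W: "det W = 1"
  shows "borel_of W = (\<lambda>A. W ** A ** inv\<^bsub>SL\<^esub> W) ` borel_std"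
proof -
  have "A \<in> (\<lambda>A. W ** A ** inv\<^bsub>SL\<^esub> W) ` borel_std" if "A \<in> borel_of W" for A
    by (rule image_eqI[of _ _ "inv\<^bsub>SL\<^esub> W ** A ** W"])
       (use that in \<open>auto simp: borel_of_def borel_std_def det_mul SL_inv matrix_mul_rassoc SL_cancel W\<close>)
  moreover have "W ** A ** inv\<^bsub>SL\<^esub> W \<in> borel_of W" if "A \<in> borel_std" for A
    using that by (simp add: borel_of_def borel_std_def det_mul SL_inv matrix_mul_rassoc SL_cancel W)
  ultimately show ?thesis by blast
qed

lemma conj_group_hom:
  assumes W: "det (W :: complex^'n^'n) = 1"
  shows "group_hom SL SL (\<lambda>A. W ** A ** inv\<^bsub>SL\<^esub> W)"
proof -
  have "W ** (A ** B) ** inv\<^bsub>SL\<^esub> W = W ** A ** inv\<^bsub>SL\<^esub> W ** (W ** B ** inv\<^bsub>SL\<^esub> W)" for A B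
    by (simp add: matrix_mul_rassoc SL_cancel W)
  then show ?thesis
    by unfold_locales (auto simp: hom_def det_mul W SL_inv)
qed

text \<open>Conjugation by \<open>W\<close> carries connectedness and solvability over from
  \<open>borel_std\<close>; closedness is read off from the entries below the diagonal.\<close>

lemma conn_solv_borel_of:
  assumes W: "det (W :: complex^'n^'n) = 1"
  shows "conn_solv_subgroup (borel_of W)"
proof -
  interpret h: group_hom SL SL "\<lambda>A. W ** A ** inv\<^bsub>SL\<^esub> W" by (rule conj_group_hom[OF W])
  have sub: "subgroup (borel_of W) SL"
    unfolding borel_of_eq_image[OF W] by (rule h.subgroup_img_is_subgroup[OF subgroup_borel_std])
  have "connectedin SL_topology (borel_of W)"
    unfolding borel_of_eq_image[OF W]
    by (rule connectedin_continuous_map_image[OF continuous_map_SL_sandwich connected_borel_std])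
       (simp_all add: W SL_inv)
  moreover have "solvable_seq SL (borel_of W)"
    unfolding borel_of_eq_image[OF W] by (rule h.solvable_imp_solvable_img[OF solvable_seq_borel_std])
  then have "solvable (SL\<lparr>carrier := borel_of W\<rparr>)"
    using solvable_subgroup_iff[OF sub] SL.solvable_imp_trivial_derived_seq by simp
  moreover have "closedin SL_topology (borel_of W)"
    unfolding closedin_def
  proof
    show "borel_of W \<subseteq> topspace SL_topology" by (auto simp: borel_of_def)
    show "openin SL_topology (topspace SL_topology - borel_of W)"
      unfolding openin_SL_topology
    proof (intro conjI ballI)
      fix x assume x: "x \<in> topspace SL_topology - borel_of W"
      then obtain i j where ij: "idx j < idx i" "(inv\<^bsub>SL\<^esub> W ** x ** W) $ i $ j \<noteq> 0"
        by (auto simp: borel_of_def upper_def)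
      have "(\<lambda>A. (inv\<^bsub>SL\<^esub> W ** A ** W) $ i $ j) \<in> poly_funs mat_coords"
        by (intro poly_funs_matrix_mult poly_funs.const poly_funs_mat_coord)
      then show "\<exists>f\<in>poly_funs mat_coords. f x \<noteq> 0 \<and> {y \<in> carrier SL. f y \<noteq> 0} \<subseteq> topspace SL_topology - borel_of W"
        using ij by (intro bexI[of _ "\<lambda>A. (inv\<^bsub>SL\<^esub> W ** A ** W) $ i $ j"]) (auto simp: borel_of_def upper_def)
    qed auto
  qed
  ultimately show ?thesis using sub by (simp add: conn_solv_subgroup_def)
qed

section \<open>The Lie--Kolchin theorem\<close>

text \<open>Linear independence is a property of sets, so a repetition among the vectors
  \<open>f k\<close> is treated separately: it is itself a relation.\<close>

lemma linear_relation:
  fixes f :: "nat \<Rightarrow> complex^'n"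
  shows "\<exists>c. (\<exists>k\<le>CARD('n). c k \<noteq> 0) \<and> (\<Sum>k\<le>CARD('n). c k *s f k) = 0"
proof (cases "inj_on f {..CARD('n)}")
  case True
  let ?S = "f ` {..CARD('n)}"
  have "card ?S = CARD('n) + 1" using True by (simp add: card_image)
  then have "vec.dependent ?S"
    using vec.independent_card_le_dim[of ?S UNIV] by (auto simp: vec_dim_card card_cart_basis)
  then obtain u where u: "\<exists>v\<in>?S. u v \<noteq> 0" "(\<Sum>v\<in>?S. u v *s v) = 0"
    by (auto simp: vec.dependent_finite)
  then have "(\<Sum>k\<le>CARD('n). u (f k) *s f k) = 0" by (simp add: sum.reindex[OF True])
  then show ?thesis using u(1) by (intro exI[of _ "\<lambda>k. u (f k)"]) auto
next
  case False
  then obtain i j where ij: "i \<le> CARD('n)" "j \<le> CARD('n)" "f i = f j" "i \<noteq> j" by (auto simp: inj_on_def)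
  define c where "c = (\<lambda>k. if k = i then 1 else if k = j then -1 else (0::complex))"
  have "(\<Sum>k\<le>CARD('n). c k *s f k) = (\<Sum>k\<in>{i,j}. c k *s f k)"
    by (rule sum.mono_neutral_right) (use ij in \<open>auto simp: c_def\<close>)
  also have "\<dots> = 0" using ij by (simp add: c_def)
  finally show ?thesis using ij by (intro exI[of _ c]) (auto simp: c_def)
qed

text \<open>This is \<open>p(A) v\<close>, built from the iterates of \<open>A\<close> on
  \<open>v\<close> without forming the matrix \<open>p(A)\<close>.\<close>

definition poly_act :: "complex^'n^'n \<Rightarrow> complex poly \<Rightarrow> complex^'n \<Rightarrow> complex^'n" where
  "poly_act A p v = (\<Sum>i\<le>degree p. coeff p i *s (((*v) A ^^ i) v))"

lemma poly_act_bound: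
  assumes "degree p \<le> m"
  shows "poly_act A p v = (\<Sum>i\<le>m. coeff p i *s (((*v) A ^^ i) v))"
  unfolding poly_act_def using assms
  by (intro sum.mono_neutral_left) (auto simp: coeff_eq_0)

lemma funpow_matrix_diff:
  fixes A :: "complex^'n^'n"
  shows "((*v) A ^^ i) (u - c *s v) = ((*v) A ^^ i) u - c *s ((*v) A ^^ i) v"
  by (induction i) (simp_all add: matrix_vector_mult_diff_distrib vec.scale)

lemma poly_act_linear_factor:
  fixes A :: "complex^'n^'n"
  shows "poly_act A ([:-c, 1:] * q) v = poly_act A q (A *v v - c *s v)"
proof -
  define m where "m = degree q"
  have co: "coeff ([:-c, 1:] * q) i = (case i of 0 \<Rightarrow> 0 | Suc j \<Rightarrow> coeff q j) - c * coeff q i" for i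
    by (simp add: coeff_pCons split: nat.split)
  have "degree ([:-c, 1:] * q) \<le> Suc m"
    using degree_mult_le[of "[:-c, 1:]" q] by (simp add: m_def)
  then have "poly_act A ([:-c, 1:] * q) v
      = (\<Sum>i\<le>Suc m. (case i of 0 \<Rightarrow> 0 | Suc j \<Rightarrow> coeff q j) *s (((*v) A ^^ i) v))
        - (\<Sum>i\<le>Suc m. (c * coeff q i) *s (((*v) A ^^ i) v))"
    by (simp only: poly_act_bound co vec.scale_left_diff_distrib sum_subtractf)
  also have "(\<Sum>i\<le>Suc m. (case i of 0 \<Rightarrow> 0 | Suc j \<Rightarrow> coeff q j) *s (((*v) A ^^ i) v))
      = (\<Sum>i\<le>m. coeff q i *s (((*v) A ^^ i) (A *v v)))"
    by (simp only: sum.atMost_Suc_shift) (simp add: funpow_swap1)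
  also have "(\<Sum>i\<le>Suc m. (c * coeff q i) *s (((*v) A ^^ i) v))
      = (\<Sum>i\<le>m. (c * coeff q i) *s (((*v) A ^^ i) v))"
    by (simp add: m_def coeff_eq_0)
  finally show ?thesis
    by (simp add: poly_act_bound[of q m] m_def funpow_matrix_diff vec.scale_right_diff_distrib
        sum_subtractf mult.commute)
qed

text \<open>Take a nonzero \<open>p\<close> with \<open>p(A) v\<close> in \<open>U\<close> and a
  root \<open>c\<close> of \<open>p\<close>. Either \<open>v\<close> is already an eigenvector
  modulo \<open>U\<close>, or \<open>(A - c) v\<close> replaces \<open>v\<close> and
  \<open>p\<close> loses a linear factor. A linear relation between the iterates of \<open>v\<close>
  provides the initial \<open>p\<close>.\<close>

lemma eigenvector_mod:
  fixes A :: "complex^'n^'n"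
  assumes U: "vec.subspace U" and E: "vec.subspace E" "\<And>u. u \<in> E \<Longrightarrow> A *v u \<in> E"
    and v: "v \<in> E" "v \<notin> U"
  shows "\<exists>w c. w \<in> E \<and> w \<notin> U \<and> A *v w - c *s w \<in> U"
proof -
  have *: "p \<noteq> 0 \<Longrightarrow> v \<in> E \<Longrightarrow> v \<notin> U \<Longrightarrow> poly_act A p v \<in> U \<Longrightarrow> ?thesis" for p v
  proof (induction "degree p" arbitrary: p v)
    case 0
    then obtain c where c: "p = [:c:]" "c \<noteq> 0" by (metis degree_eq_zeroE pCons_0_0)
    then have "c *s v \<in> U" using 0 by (simp add: poly_act_def)
    then have "inverse c *s (c *s v) \<in> U" by (rule vec.subspace_scale[OF U])
    then show ?case using c(2) 0 by simp
  next
    case (Suc m)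
    then obtain c where "poly p c = 0"
      using fundamental_theorem_of_algebra[of p] by (metis Zero_not_Suc constant_degree)
    then obtain q where q: "p = [:-c, 1:] * q" by (metis poly_eq_0_iff_dvd dvdE)
    have "q \<noteq> 0" using q Suc.prems by auto
    have "degree p = Suc (degree q)" unfolding q by (subst degree_mult_eq) (use \<open>q \<noteq> 0\<close> in auto)
    then have deg: "m = degree q" using Suc.hyps(2) by simp
    show ?case
    proof (cases "A *v v - c *s v \<in> U")
      case True
      then show ?thesis using Suc.prems by blast
    next
      case False
      have "A *v v - c *s v \<in> E"
        using Suc.prems E by (simp add: vec.subspace_diff vec.subspace_scale)
      moreover have "poly_act A q (A *v v - c *s v) \<in> U"
        using Suc.prems(4) unfolding q poly_act_linear_factor .
      ultimately show ?thesis using Suc.hyps(1)[OF deg \<open>q \<noteq> 0\<close> _ False] by blast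
    qed
  qed
  obtain c where c: "\<exists>k\<le>CARD('n). c k \<noteq> 0" "(\<Sum>k\<le>CARD('n). c k *s (((*v) A ^^ k) v)) = 0"
    using linear_relation[of "\<lambda>k. ((*v) A ^^ k) v"] by blast
  define p where "p = (\<Sum>k\<le>CARD('n). monom (c k) k)"
  have co: "coeff p k = (if k \<le> CARD('n) then c k else 0)" for k
    by (simp add: p_def coeff_sum)
  have "p \<noteq> 0" using c(1) co by (metis coeff_0)
  moreover have "degree p \<le> CARD('n)" by (rule degree_le) (simp add: co)
  then have "poly_act A p v = 0"
    using c(2) by (simp add: poly_act_bound co)
  ultimately show ?thesis using *[of p v] v vec.subspace_0[OF U] by simp
qed

section \<open>Finite spectra and constancy on connected sets\<close>

lemma mat_mult_vec:
  fixes v :: "complex^'n"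
  shows "mat c *v v = c *s v"
proof -
  have "(\<Sum>j\<in>UNIV. (if i = j then c else 0) * v $ j) = (\<Sum>j\<in>UNIV. if j = i then c * v $ i else 0)" for i
    by (rule sum.cong) auto
  then show ?thesis by (simp add: vec_eq_iff matrix_vector_mult_def mat_def)
qed

lemma det_eq_0_iff_kernel:
  fixes A :: "complex^'n^'n"
  shows "det A = 0 \<longleftrightarrow> (\<exists>v. v \<noteq> 0 \<and> A *v v = 0)"
  unfolding invertible_det_nz[symmetric, of A, THEN arg_cong[where f=Not], simplified]
    invertible_left_inverse matrix_left_invertible_ker by blast

text \<open>\<open>det (1 - t A)\<close> is a polynomial in \<open>t\<close> with value 1 at 0,
  hence has finitely many roots, and every nonzero eigenvalue is the inverse of a root.\<close>

lemma finite_spectrum: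
  fixes A :: "complex^'n^'n"
  shows "finite {c. det (A - mat c) = 0}"
proof -
  define M :: "complex \<Rightarrow> complex^'n^'n" where "M t = (\<chi> i j. (if i = j then 1 else 0) - t * A $ i $ j)" for t
  have det_poly: "(\<lambda>A. det A) \<in> poly_funs (mat_coords :: (complex^'n^'n \<Rightarrow> complex) set)"
    by (rule poly_funs_det) (rule poly_funs_mat_coord)
  have "\<exists>d. \<forall>t. det (M t) = poly d t"
  proof (rule poly_funs_poly_curve[OF det_poly])
    fix c assume "c \<in> (mat_coords :: (complex^'n^'n \<Rightarrow> complex) set)"
    then obtain i j where "c = (\<lambda>A. A $ i $ j)" by (auto simp: mat_coords_def)
    then have "\<forall>t. c (M t) = poly [:if i = j then 1 else 0, - A $ i $ j:] t" by (simp add: M_def)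
    then show "\<exists>p. \<forall>t. c (M t) = poly p t" by blast
  qed
  then obtain d where d: "\<And>t. det (M t) = poly d t" by blast
  have "M 0 = mat 1" by (simp add: M_def mat_def vec_eq_iff)
  then have "d \<noteq> 0" using d[of 0] by auto
  then have fin: "finite (insert 0 (inverse ` {t. poly d t = 0}))" by (simp add: poly_roots_finite)
  have "poly d (inverse c) = 0" if sing: "det (A - mat c) = 0" and nz: "c \<noteq> 0" for c
  proof -
    obtain v where v: "v \<noteq> 0" "(A - mat c) *v v = 0" using sing by (auto simp: det_eq_0_iff_kernel)
    have Av: "A *v v = c *s v" using v(2) by (simp add: matrix_vector_mult_diff_rdistrib mat_mult_vec)
    have "M (inverse c) = mat 1 - mat (inverse c) ** A"
    proof -
      have "(\<Sum>k\<in>UNIV. (if i = k then inverse c else 0) * A $ k $ j) = (\<Sum>k\<in>UNIV. if k = i then inverse c * A $ i $ j else 0)" for i j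
        by (rule sum.cong) auto
      then show ?thesis by (simp add: vec_eq_iff M_def mat_def matrix_matrix_mult_def)
    qed
    then have "M (inverse c) *v v = v - inverse c *s (c *s v)"
      by (simp add: matrix_vector_mult_diff_rdistrib mat_mult_vec Av flip: matrix_vector_mul_assoc)
    then have "M (inverse c) *v v = 0" using nz by simp
    then have "det (M (inverse c)) = 0" using v(1) det_eq_0_iff_kernel by blast
    then show ?thesis by (simp add: d)
  qed
  then have "c \<in> insert 0 (inverse ` {t. poly d t = 0})" if "det (A - mat c) = 0" for c
    using that image_eqI[of c inverse "inverse c" "{t. poly d t = 0}"] by (cases "c = 0") auto
  then have "{c. det (A - mat c) = 0} \<subseteq> insert 0 (inverse ` {t. poly d t = 0})" by blast
  then show ?thesis using fin by (rule finite_subset)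
qed

text \<open>Otherwise \<open>A - c\<close> would be injective and map the span of \<open>U\<close>
  and \<open>v\<close>, whose dimension is one more than that of \<open>U\<close>, into
  \<open>U\<close>.\<close>

lemma eigenvalue_mod_in_spectrum:
  fixes A :: "complex^'n^'n"
  assumes U: "vec.subspace U" "\<And>u. u \<in> U \<Longrightarrow> A *v u \<in> U" and v: "v \<notin> U" "A *v v - c *s v \<in> U"
  shows "det (A - mat c) = 0"
proof (rule ccontr)
  assume nz: "det (A - mat c) \<noteq> 0"
  have Ac: "(A - mat c) *v x = A *v x - c *s x" for x
    by (simp add: matrix_vector_mult_diff_rdistrib mat_mult_vec)
  have "(*v) (A - mat c) ` (insert v U) \<subseteq> U"
  proof (rule image_subsetI)
    fix x assume x: "x \<in> insert v U"
    show "(A - mat c) *v x \<in> U"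
    proof (cases "x = v")
      case False
      then have "x \<in> U" using x by simp
      then show ?thesis unfolding Ac by (intro vec.subspace_diff[OF U(1)] U(2) vec.subspace_scale[OF U(1)])
    qed (simp add: Ac v(2))
  qed
  then have "vec.dim ((*v) (A - mat c) ` (insert v U)) \<le> vec.dim U" by (rule vec.dim_subset)
  moreover have "vec.dim (insert v U) = vec.dim U + 1"
    using v(1) U(1) by (simp add: vec.dim_insert vec.span_eq_iff[THEN iffD2])
  ultimately show False using dim_matrix_image[OF nz, of "insert v U"] by simp
qed

text \<open>Turns membership in \<open>U\<close> into the vanishing of polynomial functions, so that
  conditions modulo \<open>U\<close> define closed sets.\<close>

lemma subspace_eq_kernel:
  fixes U :: "(complex^'n) set"
  assumes "vec.subspace U"
  obtains F :: "complex^'n^'n" where "\<And>v. v \<in> U \<longleftrightarrow> F *v v = 0"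
proof -
  obtain B where B: "B \<subseteq> U" "vec.independent B" "vec.span B = U"
    using vec.maximal_independent_subset[of U] assms by (metis vec.span_minimal subset_antisym)
  obtain B' where B': "B \<subseteq> B'" "vec.independent B'" "UNIV \<subseteq> vec.span B'"
    by (rule vec.maximal_independent_subset_extend[OF subset_UNIV B(2)])
  obtain f where f: "Vector_Spaces.linear (*s) (*s) f" "\<And>x. x \<in> B' \<Longrightarrow> f x = (if x \<in> B then 0 else x)"
    using vec.linear_independent_extend[OF B'(2), of "\<lambda>x. if x \<in> B then 0 else x"] by auto
  interpret f: Vector_Spaces.linear "(*s)" "(*s)" f by (rule f(1))
  have f0: "f v = 0" if "v \<in> vec.span B" for v
    using that by (rule f.eq_0_on_span[rotated]) (use f(2) B'(1) in auto)
  have f1: "f v = v" if "v \<in> vec.span (B' - B)" for v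
    using that by (induction rule: vec.span_induct_alt) (auto simp: f.zero f.add f.scale f(2))
  have "v \<in> U" if "f v = 0" for v
  proof -
    have "v \<in> vec.span (B \<union> (B' - B))" using B' by (simp add: Un_absorb1) blast
    then obtain x y where xy: "x \<in> vec.span B" "y \<in> vec.span (B' - B)" "v = x + y"
      unfolding vec.span_Un by blast
    then have "y = 0" using that f0[OF xy(1)] f1[OF xy(2)] by (simp add: f.add)
    then show ?thesis using xy B(3) by simp
  qed
  then have "v \<in> U \<longleftrightarrow> f v = 0" for v using f0 B(3) by auto
  then have "v \<in> U \<longleftrightarrow> matrix f *v v = 0" for v by (simp add: matrix_works[OF f(1)])
  then show ?thesis by (rule that)
qed

text \<open>One fibre and the finite union of the others would be a separation of \<open>H\<close>
  by closed sets.\<close>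

lemma connectedin_finite_valued_constant:
  fixes c :: "complex^'n^'n \<Rightarrow> complex"
  assumes H: "connectedin SL_topology H" and fin: "finite (c ` H)"
    and closed: "\<And>z. \<exists>K. closedin SL_topology K \<and> {h\<in>H. c h = z} = H \<inter> K"
    and xy: "x \<in> H" "y \<in> H"
  shows "c x = c y"
proof (rule ccontr)
  assume ne: "c x \<noteq> c y"
  have "\<forall>z. \<exists>K. closedin SL_topology K \<and> {h\<in>H. c h = z} = H \<inter> K" using closed by blast
  from choice[OF this] obtain K
    where K: "\<forall>z. closedin SL_topology (K z) \<and> {h\<in>H. c h = z} = H \<inter> K z" ..
  have K_iff: "h \<in> K z \<longleftrightarrow> c h = z" if "h \<in> H" for h z
    using K[THEN spec, of z] that by blast
  define K' where "K' = (\<Union>z\<in>c ` H - {c x}. K z)"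
  have "closedin SL_topology K'"
    unfolding K'_def by (rule closedin_Union) (use fin K in auto)
  moreover have "H \<subseteq> K (c x) \<union> K'"
  proof
    fix h assume "h \<in> H"
    then show "h \<in> K (c x) \<union> K'" by (cases "c h = c x") (auto simp: K'_def K_iff)
  qed
  moreover have "K (c x) \<inter> K' \<inter> H = {}" by (auto simp: K'_def K_iff)
  moreover have "x \<in> K (c x) \<inter> H" "y \<in> K' \<inter> H" using xy ne by (auto simp: K'_def K_iff)
  moreover have "closedin SL_topology (K (c x))" using K by blast
  ultimately show False using H unfolding connectedin_closedin by (metis empty_iff)
qed

lemma closedin_SL_vanishing:
  fixes \<phi> :: "complex^'n^'n \<Rightarrow> complex^'m"
  assumes "\<And>i. (\<lambda>A. \<phi> A $ i) \<in> poly_funs mat_coords"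
  shows "closedin SL_topology {A \<in> carrier SL. \<phi> A = 0}"
  unfolding closedin_def openin_SL_topology
proof (intro conjI ballI)
  fix x assume "x \<in> topspace SL_topology - {A \<in> carrier SL. \<phi> A = 0}"
  then obtain i where "\<phi> x $ i \<noteq> 0" by (auto simp: vec_eq_iff)
  then show "\<exists>f\<in>poly_funs mat_coords. f x \<noteq> 0 \<and>
      {y \<in> carrier SL. f y \<noteq> 0} \<subseteq> topspace SL_topology - {A \<in> carrier SL. \<phi> A = 0}"
    by (intro bexI[OF _ assms[of i]]) auto
qed auto

text \<open>A commutator is joined to the identity by the connected set of all
  \<open>h k h\<inverse> k\<inverse>\<close> with \<open>k\<close> fixed. The inverse of a
  commutator is a commutator, and for a product \<open>x y\<close> a connected set from 1 to
  \<open>x\<close> is continued by the translate by \<open>x\<close> of one from 1 to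
  \<open>y\<close>.\<close>

lemma connectedin_derived:
  fixes H :: "(complex^'n^'n) set"
  assumes H: "subgroup H SL" "connectedin SL_topology H"
  shows "connectedin SL_topology (derived SL H)"
proof -
  interpret H: subgroup H SL by (rule H(1))
  have sub: "subgroup (derived SL H) SL" by (rule SL.derived_is_subgroup[OF H.subset])
  have detH: "det h = 1" if "h \<in> H" for h using H.mem_carrier[OF that] by simp
  define good where
    "good x \<longleftrightarrow> (\<exists>K. connectedin SL_topology K \<and> mat 1 \<in> K \<and> x \<in> K \<and> K \<subseteq> derived SL H)" for x
  have comm: "good (h ** k ** inv\<^bsub>SL\<^esub> h ** inv\<^bsub>SL\<^esub> k)" if hk: "h \<in> H" "k \<in> H" for h k
  proof -
    let ?f = "\<lambda>h. h ** k ** inv\<^bsub>SL\<^esub> h ** inv\<^bsub>SL\<^esub> k"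
    have "connectedin SL_topology (?f ` H)"
      by (rule connectedin_continuous_map_image[OF continuous_map_SL_commutator H(2)]) (rule detH[OF hk(2)])
    moreover have "?f (mat 1) = mat 1"
    proof -
      have "inv\<^bsub>SL\<^esub> (mat 1 :: complex^'n^'n) = mat 1" by (rule SL_inv_eqI) simp_all
      then show ?thesis using SL_inv(1)[OF detH[OF hk(2)]] by simp
    qed
    from this[symmetric] have "mat 1 \<in> ?f ` H" by (rule image_eqI) (use H.one_closed in simp)
    moreover have "?f ` H \<subseteq> derived SL H"
      using hk(2) unfolding derived_def by (auto intro!: generate.incl)
    ultimately show ?thesis unfolding good_def using hk(1) by blast
  qed
  have "good x" if "x \<in> generate SL (derived_set SL H)" for x
    using that
  proof induction
    case one
    have "connectedin SL_topology {mat 1 :: complex^'n^'n}" by (simp add: connectedin_sing)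
    then show ?case using subgroup.one_closed[OF sub] unfolding good_def
      by (intro exI[of _ "{mat 1}"]) simp
  next
    case (incl h)
    then show ?case using comm by auto
  next
    case (inv h)
    then obtain a b where ab: "a \<in> H" "b \<in> H" "h = a ** b ** inv\<^bsub>SL\<^esub> a ** inv\<^bsub>SL\<^esub> b" by auto
    then have "inv\<^bsub>SL\<^esub> h = b ** a ** inv\<^bsub>SL\<^esub> b ** inv\<^bsub>SL\<^esub> a"
      using detH by (intro SL_inv_eqI) (auto simp: det_mul SL_inv matrix_mul_rassoc SL_cancel)
    then show ?case using comm ab by simp
  next
    case (eng x y)
    from eng.IH(1) obtain K where K: "connectedin SL_topology K" "mat 1 \<in> K" "x \<in> K" "K \<subseteq> derived SL H"
      unfolding good_def by blast
    from eng.IH(2) obtain L where L: "connectedin SL_topology L" "mat 1 \<in> L" "y \<in> L" "L \<subseteq> derived SL H"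
      unfolding good_def by blast
    have dx: "det x = 1" using K(3,4) subgroup.subset[OF sub] by auto
    have "connectedin SL_topology ((\<lambda>A. x ** A ** mat 1) ` L)"
      by (rule connectedin_continuous_map_image[OF continuous_map_SL_sandwich L(1)]) (use dx in auto)
    then have cL: "connectedin SL_topology ((\<lambda>A. x ** A) ` L)" by simp
    have xL: "x \<in> (\<lambda>A. x ** A) ` L" using L(2) by (intro image_eqI[of _ _ "mat 1"]) auto
    have "connectedin SL_topology (K \<union> (\<lambda>A. x ** A) ` L)"
      using connectedin_Un[OF K(1) cL] K(3) xL by blast
    moreover have "(\<lambda>A. x ** A) ` L \<subseteq> derived SL H"
      using K(3,4) L(4) subgroup.m_closed[OF sub] by auto
    ultimately show ?case
      unfolding good_def using K L
      by (intro exI[of _ "K \<union> (\<lambda>A. x ** A) ` L"]) auto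
  qed
  then have "\<forall>x\<in>derived SL H. \<exists>K. connectedin SL_topology K \<and> mat 1 \<in> K \<and> x \<in> K \<and> K \<subseteq> derived SL H"
    unfolding good_def derived_def[symmetric] by blast
  from bchoice[OF this] obtain K where K: "\<And>x. x \<in> derived SL H \<Longrightarrow>
      connectedin SL_topology (K x) \<and> mat 1 \<in> K x \<and> x \<in> K x \<and> K x \<subseteq> derived SL H"
    by blast
  have "derived SL H = \<Union> (K ` derived SL H)" using K by blast
  moreover have "connectedin SL_topology (\<Union> (K ` derived SL H))"
    by (rule connectedin_Union) (use K in auto)
  ultimately show ?thesis by simp
qed

text \<open>Two functions of \<open>h \<in> H\<close> have finitely many values and closed fibres, hence are constant: the
  eigenvalue of \<open>h\<inverse> n h\<close> at \<open>v0\<close> modulo \<open>U\<close>, and the scalar \<open>c\<close> with \<open>h k = c k h\<close> modulo \<open>U\<close> on the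
  resulting weight space. The first makes that space \<open>H\<close>-stable, the second makes \<open>H\<close> commute on it.\<close>

lemma Lie_Kolchin_step:
  fixes H :: "(complex^'n^'n) set"
  assumes H: "subgroup H SL" "connectedin SL_topology H"
    and U: "vec.subspace U" "\<And>h u. h \<in> H \<Longrightarrow> u \<in> U \<Longrightarrow> h *v u \<in> U"
    and v0: "v0 \<notin> U" "\<And>n. n \<in> derived SL H \<Longrightarrow> \<exists>c. n *v v0 - c *s v0 \<in> U"
  shows "\<exists>v. v \<notin> U \<and> (\<forall>h\<in>H. \<exists>c. h *v v - c *s v \<in> U)"
proof -
  interpret H: subgroup H SL by (rule H(1))
  have detH: "det h = 1" if "h \<in> H" for h using H.mem_carrier[OF that] by simp
  have invH: "inv\<^bsub>SL\<^esub> h \<in> H" if "h \<in> H" for h using that by (rule H.m_inv_closed)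
  have mulH: "h ** k \<in> H" if "h \<in> H" "k \<in> H" for h k using H.m_closed[OF that] by simp
  have U_iff: "h *v u \<in> U \<longleftrightarrow> u \<in> U" if "h \<in> H" for h u
    using U(2)[OF that, of u] U(2)[OF invH[OF that], of "h *v u"] by (auto simp: SL_cancel detH[OF that])
  obtain F :: "complex^'n^'n" where F: "\<And>v. v \<in> U \<longleftrightarrow> F *v v = 0"
    using subspace_eq_kernel[OF U(1)] by blast
  define D where "D = derived SL H"
  have DH: "D \<subseteq> H" unfolding D_def by (rule SL.derived_incl[OF _ H(1)]) simp
  have conjD: "inv\<^bsub>SL\<^esub> h ** n ** h \<in> D" if "h \<in> H" "n \<in> D" for h n
  proof -
    interpret N: normal D "SL\<lparr>carrier := H\<rparr>"
      unfolding D_def by (rule SL.derived_subgroup_is_normal[OF H(1)])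
    show ?thesis
      using N.inv_op_closed1[of h n] that SL.m_inv_consistent[OF H(1) that(1)] by simp
  qed
  have uniq: "c = c'" if "v \<notin> U" "x - c *s v \<in> U" "x - c' *s v \<in> U" for x v c c'
  proof (rule ccontr)
    assume ne: "c \<noteq> c'"
    have "(x - c' *s v) - (x - c *s v) \<in> U" by (rule vec.subspace_diff[OF U(1) that(3) that(2)])
    then have "(c - c') *s v \<in> U" by (simp add: vec.scale_left_diff_distrib)
    then have "inverse (c - c') *s ((c - c') *s v) \<in> U" by (rule vec.subspace_scale[OF U(1)])
    then show False using ne that(1) by simp
  qed
  define ch where "ch n = (SOME c. n *v v0 - c *s v0 \<in> U)" for n
  have ch: "n *v v0 - ch n *s v0 \<in> U" if "n \<in> D" for n
    unfolding ch_def by (rule someI_ex) (use v0(2) that in \<open>simp add: D_def\<close>)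
  \<comment> \<open>The weight space of \<open>D\<close> modulo \<open>U\<close> for the weight
    \<open>ch\<close> of \<open>v0\<close>.\<close>
  define E where "E = {v. \<forall>n\<in>D. n *v v - ch n *s v \<in> U}"
  have subE: "vec.subspace E"
    unfolding vec.subspace_def
  proof (intro conjI ballI allI)
    show "0 \<in> E" using vec.subspace_0[OF U(1)] by (simp add: E_def)
    fix x assume x: "x \<in> E"
    show "x + y \<in> E" if y: "y \<in> E" for y
    proof -
      have "n *v (x + y) - ch n *s (x + y) = (n *v x - ch n *s x) + (n *v y - ch n *s y)" for n
        by (simp add: matrix_vector_right_distrib vec.scale_right_distrib)
      then show ?thesis using x y vec.subspace_add[OF U(1)] by (simp add: E_def)
    qed
    show "c *s x \<in> E" for c
    proof -
      have "n *v (c *s x) - ch n *s (c *s x) = c *s (n *v x - ch n *s x)" for n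
        by (simp add: vec.scale vec.scale_right_diff_distrib mult.commute)
      then show ?thesis using x vec.subspace_scale[OF U(1)] by (simp add: E_def)
    qed
  qed
  have v0E: "v0 \<in> E" using ch by (simp add: E_def)
  have ch_conj: "ch (inv\<^bsub>SL\<^esub> h ** n ** h) = ch n" if n: "n \<in> D" and h: "h \<in> H" for n h
  proof -
    define c where "c h = ch (inv\<^bsub>SL\<^esub> h ** n ** h)" for h
    have c: "n *v (h *v v0) - c h *s (h *v v0) \<in> U" if "h \<in> H" for h
    proof -
      have "h *v ((inv\<^bsub>SL\<^esub> h ** n ** h) *v v0 - c h *s v0) \<in> U"
        using ch[OF conjD[OF that n]] U(2)[OF that] by (simp add: c_def)
      then show ?thesis
        by (simp add: matrix_vector_mult_diff_distrib vec.scale SL_cancel detH[OF that]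
            flip: matrix_vector_mul_assoc)
    qed
    have hv0: "h *v v0 \<notin> U" if "h \<in> H" for h using U_iff[OF that] v0(1) by simp
    have "c h = c (mat 1)"
    proof (rule connectedin_finite_valued_constant[OF H(2)])
      have "c ` H \<subseteq> {c. det (n - mat c) = 0}"
      proof safe
        fix h' assume h': "h' \<in> H"
        have "n \<in> H" using n DH by blast
        then show "det (n - mat (c h')) = 0"
          using U(2) by (intro eigenvalue_mod_in_spectrum[OF U(1) _ hv0[OF h'] c[OF h']])
      qed
      then show "finite (c ` H)" using finite_spectrum finite_subset by blast
    next
      fix z
      define K where "K = {A \<in> carrier SL. F *v (n *v (A *v v0) - z *s (A *v v0)) = 0}"
      have eq: "F *v (n *v (A *v v0) - z *s (A *v v0)) = (F ** (n - mat z) ** A) *v v0" for A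
        by (simp add: matrix_vector_mult_diff_rdistrib mat_mult_vec flip: matrix_vector_mul_assoc)
      have "closedin SL_topology K" unfolding K_def
        by (rule closedin_SL_vanishing, unfold eq)
           (intro poly_funs_matrix_vector_mult poly_funs_matrix_mult poly_funs.const poly_funs_mat_coord)
      moreover have "{h\<in>H. c h = z} = H \<inter> K"
      proof -
        have "c h = z \<longleftrightarrow> n *v (h *v v0) - z *s (h *v v0) \<in> U" if "h \<in> H" for h
          using c[OF that] uniq[OF hv0[OF that], of "n *v (h *v v0)"] by blast
        then show ?thesis using detH by (auto simp: K_def F)
      qed
      ultimately show "\<exists>K. closedin SL_topology K \<and> {h\<in>H. c h = z} = H \<inter> K" by blast
    qed (use h H.one_closed in auto)
    moreover have "inv\<^bsub>SL\<^esub> (mat 1 :: complex^'n^'n) = mat 1" by (rule SL_inv_eqI) simp_all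
    ultimately show ?thesis by (simp add: c_def)
  qed
  have EH: "h *v v \<in> E" if v: "v \<in> E" and h: "h \<in> H" for h v
    unfolding E_def
  proof (intro CollectI ballI)
    fix n assume n: "n \<in> D"
    have "(inv\<^bsub>SL\<^esub> h ** n ** h) *v v - ch n *s v \<in> U"
      using v conjD[OF h n] ch_conj[OF n h] unfolding E_def by fastforce
    then have "h *v ((inv\<^bsub>SL\<^esub> h ** n ** h) *v v - ch n *s v) \<in> U" by (rule U(2)[OF h])
    then show "n *v (h *v v) - ch n *s (h *v v) \<in> U"
      by (simp add: matrix_vector_mult_diff_distrib vec.scale SL_cancel detH[OF h]
          flip: matrix_vector_mul_assoc)
  qed
  have comm: "h *v (k *v v) - k *v (h *v v) \<in> U" if v: "v \<in> E" and h: "h \<in> H" and k: "k \<in> H" for h k v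
  proof -
    define c where "c h = ch (h ** k ** inv\<^bsub>SL\<^esub> h ** inv\<^bsub>SL\<^esub> k)" for h
    have c: "h *v (k *v v) - c h *s (k *v (h *v v)) \<in> U" if "v \<in> E" "h \<in> H" for h v
    proof -
      have "h ** k ** inv\<^bsub>SL\<^esub> h ** inv\<^bsub>SL\<^esub> k \<in> D"
        unfolding D_def derived_def using that k by (auto intro!: generate.incl)
      moreover have "k *v (h *v v) \<in> E" using EH that k by simp
      ultimately have "(h ** k ** inv\<^bsub>SL\<^esub> h ** inv\<^bsub>SL\<^esub> k) *v (k *v (h *v v)) - c h *s (k *v (h *v v)) \<in> U"
        unfolding E_def c_def by blast
      then show ?thesis
        by (simp add: SL_cancel detH[OF k] detH[OF that(2)] flip: matrix_vector_mul_assoc)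
    qed
    \<comment> \<open>One eigenvector of \<open>k\<close> bounds the values of \<open>c\<close>:
      \<open>h w\<close> is again an eigenvector of \<open>k\<close> modulo \<open>U\<close>, with
      eigenvalue \<open>l / c h\<close>, and the spectrum of \<open>k\<close> is finite.\<close>
    obtain w l where w: "w \<in> E" "w \<notin> U" "k *v w - l *s w \<in> U"
      using eigenvector_mod[OF U(1) subE, of k v0] EH k v0E v0(1) by blast
    have l: "l \<noteq> 0"
    proof
      assume "l = 0"
      then show False using w U_iff[OF k, of w] by simp
    qed
    have khv: "k *v (h *v v0) \<notin> U" if "h \<in> H" for h
      using U_iff[OF k] U_iff[OF that] v0(1) by simp
    have "c h = c (mat 1)"
    proof (rule connectedin_finite_valued_constant[OF H(2)])
      have "c h \<in> (\<lambda>m. l / m) ` {c. det (k - mat c) = 0}" if h: "h \<in> H" for h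
      proof -
        have 1: "h *v (k *v w) - l *s (h *v w) \<in> U"
          using U(2)[OF h w(3)] by (simp add: matrix_vector_mult_diff_distrib vec.scale)
        have 2: "l *s (h *v w) - c h *s (k *v (h *v w)) \<in> U"
          using vec.subspace_diff[OF U(1) c[OF w(1) h] 1] by simp
        have hw: "h *v w \<notin> U" using U_iff[OF h] w(2) by simp
        have "c h \<noteq> 0"
        proof
          assume "c h = 0"
          then have "l *s (h *v w) \<in> U" using 2 by simp
          then have "inverse l *s (l *s (h *v w)) \<in> U" by (rule vec.subspace_scale[OF U(1)])
          then show False using l hw by simp
        qed
        have "- inverse (c h) *s (l *s (h *v w) - c h *s (k *v (h *v w))) \<in> U"
          by (rule vec.subspace_scale[OF U(1) 2])
        then have "k *v (h *v w) - (l / c h) *s (h *v w) \<in> U"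
          using \<open>c h \<noteq> 0\<close> by (simp add: vec.scale_right_diff_distrib vec.scale_minus_left field_simps)
        then have "det (k - mat (l / c h)) = 0"
          using U(2)[OF k] by (intro eigenvalue_mod_in_spectrum[OF U(1) _ hw])
        moreover have "c h = l / (l / c h)" using l by simp
        ultimately show ?thesis by blast
      qed
      then have "c ` H \<subseteq> (\<lambda>m. l / m) ` {c. det (k - mat c) = 0}" by blast
      then show "finite (c ` H)" using finite_spectrum finite_subset by blast
    next
      fix z
      define K where "K = {A \<in> carrier SL. F *v (A *v (k *v v0) - z *s (k *v (A *v v0))) = 0}"
      have eq: "F *v (A *v (k *v v0) - z *s (k *v (A *v v0)))
          = (F ** A ** k) *v v0 - (F ** mat z ** k ** A) *v v0" for A
        by (simp add: matrix_vector_mult_diff_distrib mat_mult_vec flip: matrix_vector_mul_assoc)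
      have "closedin SL_topology K" unfolding K_def
        by (rule closedin_SL_vanishing, unfold eq vector_minus_component)
           (intro poly_funs_diff poly_funs_matrix_vector_mult poly_funs_matrix_mult poly_funs.const poly_funs_mat_coord)
      moreover have "{h\<in>H. c h = z} = H \<inter> K"
      proof -
        have "c h = z \<longleftrightarrow> h *v (k *v v0) - z *s (k *v (h *v v0)) \<in> U" if "h \<in> H" for h
          using c[OF v0E that] uniq[OF khv[OF that], of "h *v (k *v v0)"] by blast
        then show ?thesis using detH by (auto simp: K_def F)
      qed
      ultimately show "\<exists>K. closedin SL_topology K \<and> {h\<in>H. c h = z} = H \<inter> K" by blast
    qed (use h H.one_closed in auto)
    moreover have "c (mat 1) = 1"
      using c[OF v0E, of "mat 1"] H.one_closed uniq[OF khv[of "mat 1"], of "k *v v0" "c (mat 1)" 1]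
        vec.subspace_0[OF U(1)] by simp
    ultimately show ?thesis using c[OF v h] by simp
  qed
  \<comment> \<open>Since \<open>H\<close> commutes on \<open>E\<close> modulo \<open>U\<close>, the
    eigenspace of one element of \<open>H\<close> is stable under all of \<open>H\<close>. A
    smallest stable space strictly above \<open>U\<close> therefore coincides with an eigenspace of
    each \<open>h\<close>, and all its vectors are common eigenvectors modulo
    \<open>U\<close>.\<close>
  define Inv where "Inv E' \<longleftrightarrow> vec.subspace E' \<and> U \<subset> E' \<and> E' \<subseteq> E \<and> (\<forall>h\<in>H. \<forall>v\<in>E'. h *v v \<in> E')" for E'
  have "U \<subseteq> E" using U DH by (auto simp: E_def vec.subspace_diff vec.subspace_scale)
  then have "Inv E" using subE EH v0E v0(1) by (auto simp: Inv_def)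
  then obtain E' where E': "Inv E'" "\<And>E''. Inv E'' \<Longrightarrow> vec.dim E' \<le> vec.dim E''"
    using ex_has_least_nat[of Inv E vec.dim] by blast
  have E'': "vec.subspace E'" "U \<subset> E'" "E' \<subseteq> E" "\<And>h v. h \<in> H \<Longrightarrow> v \<in> E' \<Longrightarrow> h *v v \<in> E'"
    using E'(1) by (auto simp: Inv_def)
  obtain v where v: "v \<in> E'" "v \<notin> U" using E''(2) by blast
  have "\<exists>c. h *v v - c *s v \<in> U" if h: "h \<in> H" for h
  proof -
    obtain w l where w: "w \<in> E'" "w \<notin> U" "h *v w - l *s w \<in> U"
      using eigenvector_mod[OF U(1) E''(1), of h v] E''(4)[OF h] v by blast
    define X where "X = {x\<in>E'. h *v x - l *s x \<in> U}"
    have "Inv X" unfolding Inv_def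
    proof (intro conjI ballI)
      show "vec.subspace X" unfolding vec.subspace_def
      proof (intro conjI ballI allI)
        show "0 \<in> X" using vec.subspace_0[OF U(1)] vec.subspace_0[OF E''(1)] by (simp add: X_def)
        fix x assume x: "x \<in> X"
        show "x + y \<in> X" if y: "y \<in> X" for y
        proof -
          have "h *v (x + y) - l *s (x + y) = (h *v x - l *s x) + (h *v y - l *s y)"
            by (simp add: matrix_vector_right_distrib vec.scale_right_distrib)
          then show ?thesis using x y vec.subspace_add[OF U(1)] vec.subspace_add[OF E''(1)] by (simp add: X_def)
        qed
        show "c *s x \<in> X" for c
        proof -
          have "h *v (c *s x) - l *s (c *s x) = c *s (h *v x - l *s x)"
            by (simp add: vec.scale vec.scale_right_diff_distrib mult.commute)
          then show ?thesis using x vec.subspace_scale[OF U(1)] vec.subspace_scale[OF E''(1)] by (simp add: X_def)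
        qed
      qed
      show "U \<subset> X" using U(2)[OF h] U(1) E''(2) w by (auto simp: X_def vec.subspace_diff vec.subspace_scale)
      show "X \<subseteq> E" using E''(3) by (auto simp: X_def)
      fix k x assume k: "k \<in> H" and x: "x \<in> X"
      have "k *v (h *v x - l *s x) \<in> U" using x U(2)[OF k] by (simp add: X_def)
      moreover have "h *v (k *v x) - k *v (h *v x) \<in> U" using comm[OF _ h k] x E''(3) by (auto simp: X_def)
      ultimately have "k *v (h *v x - l *s x) + (h *v (k *v x) - k *v (h *v x)) \<in> U"
        by (rule vec.subspace_add[OF U(1)])
      then show "k *v x \<in> X" using E''(4)[OF k] x
        by (simp add: X_def matrix_vector_mult_diff_distrib vec.scale)
    qed
    then have "vec.dim E' \<le> vec.dim X" "vec.subspace X" using E'(2) by (auto simp: Inv_def)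
    then have "X = E'" using vec.subspace_dim_equal[of X E'] E''(1) by (auto simp: X_def)
    then show ?thesis using v(1) by (auto simp: X_def)
  qed
  then show ?thesis using v(2) by blast
qed

text \<open>Induction on the derived length: the derived subgroup is again connected, and its common
  eigenvector modulo \<open>U\<close> is the \<open>v0\<close> of \<open>Lie_Kolchin_step\<close>.
  For the trivial group any vector outside \<open>U\<close> will do.\<close>

lemma Lie_Kolchin_vector:
  fixes H :: "(complex^'n^'n) set"
  assumes "subgroup H SL" "connectedin SL_topology H" "(derived SL ^^ m) H = {mat 1}"
    and "vec.subspace U" "\<And>h u. h \<in> H \<Longrightarrow> u \<in> U \<Longrightarrow> h *v u \<in> U" "U \<noteq> UNIV"
  shows "\<exists>v. v \<notin> U \<and> (\<forall>h\<in>H. \<exists>c. h *v v - c *s v \<in> U)"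
  using assms
proof (induction m arbitrary: H)
  case 0
  obtain v where "v \<notin> U" using 0 by blast
  moreover have "h *v v - 1 *s v \<in> U" if "h \<in> H" for h
    using 0 that vec.subspace_0[of U] by simp
  ultimately show ?case by blast
next
  case (Suc m)
  have DH: "derived SL H \<subseteq> H" by (rule SL.derived_incl[OF _ Suc.prems(1)]) simp
  have "subgroup (derived SL H) SL"
    using Suc.prems(1) by (intro SL.derived_is_subgroup subgroup.subset)
  moreover have "(derived SL ^^ m) (derived SL H) = {mat 1}"
    using Suc.prems(3) by (simp add: funpow_swap1)
  ultimately obtain v0 where "v0 \<notin> U" "\<And>n. n \<in> derived SL H \<Longrightarrow> \<exists>c. n *v v0 - c *s v0 \<in> U"
    using Suc.IH[of "derived SL H"] connectedin_derived[OF Suc.prems(1,2)] Suc.prems(4-6) DH by blast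
  then show ?case using Lie_Kolchin_step[OF Suc.prems(1,2,4,5)] by blast
qed

text \<open>A stable flag is built from the bottom: the span of the vectors found so far plays the
  role of \<open>U\<close> for the next one.\<close>

lemma Lie_Kolchin:
  fixes H :: "(complex^'n^'n) set"
  assumes "conn_solv_subgroup H"
  shows "\<exists>W. det W = 1 \<and> H \<subseteq> borel_of W"
proof -
  have H: "subgroup H SL" "connectedin SL_topology H" "solvable (SL\<lparr>carrier := H\<rparr>)"
    using assms by (auto simp: conn_solv_subgroup_def)
  obtain m where m: "(derived SL ^^ m) H = {mat 1}" using H by (auto simp: solvable_subgroup_iff)
  define ext where "ext w k \<longleftrightarrow> (\<forall>j<k. w j \<notin> vec.span (w ` {..<j}) \<and> (\<forall>h\<in>H. h *v w j \<in> vec.span (w ` {..<Suc j})))"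
    for w :: "nat \<Rightarrow> complex^'n" and k
  have inv: "h *v u \<in> vec.span (w ` {..<k})" if "ext w k" "h \<in> H" "u \<in> vec.span (w ` {..<k})" for w k h u
  proof -
    have "(*v) h ` (w ` {..<k}) \<subseteq> vec.span (w ` {..<k})"
    proof safe
      fix j assume "j < k"
      then have "h *v w j \<in> vec.span (w ` {..<Suc j})" using that by (auto simp: ext_def)
      moreover have "vec.span (w ` {..<Suc j}) \<subseteq> vec.span (w ` {..<k})"
        using \<open>j < k\<close> by (intro vec.span_mono image_mono) auto
      ultimately show "h *v w j \<in> vec.span (w ` {..<k})" by blast
    qed
    then have "vec.span ((*v) h ` (w ` {..<k})) \<subseteq> vec.span (w ` {..<k})"
      by (rule vec.span_minimal) simp
    then show ?thesis using that(3) vec.span_image[of h "w ` {..<k}"] by blast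
  qed
  have dim: "vec.dim (w ` {..<k}) = k" if "ext w k" for w k
    using that
  proof (induction k)
    case (Suc k)
    then have "ext w k" "w k \<notin> vec.span (w ` {..<k})" by (auto simp: ext_def)
    then show ?case using Suc.IH by (simp add: lessThan_Suc vec.dim_insert)
  qed simp
  have "\<exists>w. ext w k" if "k \<le> CARD('n)" for k
    using that
  proof (induction k)
    case 0
    show ?case by (simp add: ext_def)
  next
    case (Suc k)
    then obtain w where w: "ext w k" by auto
    let ?U = "vec.span (w ` {..<k})"
    have "vec.dim ?U \<noteq> vec.dim (UNIV :: (complex^'n) set)" using dim[OF w] Suc.prems by (simp add: vec_dim_card card_cart_basis)
    then have "?U \<noteq> UNIV" by metis
    then obtain v where v: "v \<notin> ?U" "\<forall>h\<in>H. \<exists>c. h *v v - c *s v \<in> ?U"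
      using Lie_Kolchin_vector[OF H(1,2) m, of ?U] inv[OF w] by auto
    define w' where "w' = w(k := v)"
    have same: "w' ` {..<j} = w ` {..<j}" if "j \<le> k" for j using that by (auto simp: w'_def)
    have "h *v v \<in> vec.span (w' ` {..<Suc k})" if h: "h \<in> H" for h
    proof -
      obtain c where c: "h *v v - c *s v \<in> ?U" using v(2) h by blast
      have "?U \<subseteq> vec.span (w' ` {..<Suc k})" 
        unfolding same[OF order_refl, symmetric] by (intro vec.span_mono image_mono) auto
      moreover have "v \<in> vec.span (w' ` {..<Suc k})" by (rule vec.span_base) (auto simp: w'_def)
      ultimately have "(h *v v - c *s v) + c *s v \<in> vec.span (w' ` {..<Suc k})"
        using vec.span_add[OF subsetD[OF _ c] vec.span_scale] by blast
      then show ?thesis by simp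
    qed
    note hv = this
    have "ext w' (Suc k)" unfolding ext_def
    proof (intro allI impI)
      fix j assume "j < Suc k"
      then consider "j = k" | "j < k" by linarith
      then show "w' j \<notin> vec.span (w' ` {..<j}) \<and> (\<forall>h\<in>H. h *v w' j \<in> vec.span (w' ` {..<Suc j}))"
      proof cases
        case 1
        then have "w' j = v" by (simp add: w'_def)
        then show ?thesis using 1 v(1) hv same[of k] by simp
      next
        case 2
        then have "w' j = w j" by (simp add: w'_def)
        then show ?thesis using 2 w same[of j] same[of "Suc j"] unfolding ext_def by fastforce
      qed
    qed
    then show ?case by blast
  qed
  then obtain w where w: "ext w CARD('n)" by blast
  define W :: "complex^'n^'n" where "W = (\<chi> i j. w (idx j) $ i)"
  have W_axis: "W *v axis j 1 = w (idx j)" for j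
    by (simp add: vec_eq_iff matrix_vector_mult_axis W_def)
  have span_le: "vec.span (w ` {..<k}) \<subseteq> (*v) W ` std k" if k: "k \<le> CARD('n)" for k
  proof (rule vec.span_minimal)
    show "w ` {..<k} \<subseteq> (*v) W ` std k"
    proof safe
      fix m assume "m < k"
      then obtain j :: 'n where j: "idx j = m" using idx_surj[where 'n='n, of m] k by auto
      show "w m \<in> (*v) W ` std k"
        by (rule image_eqI[of _ _ "axis j 1"]) (use \<open>m < k\<close> j in \<open>auto simp: W_axis axis_in_std\<close>)
    qed
    show "vec.subspace ((*v) W ` std k)" by (rule matrix_image_subspace) simp
  qed
  have "vec.dim (vec.span (w ` {..<CARD('n)})) = vec.dim (UNIV :: (complex^'n) set)"
    using dim[OF w] by (simp add: vec_dim_card card_cart_basis)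
  then have "vec.span (w ` {..<CARD('n)}) = UNIV"
    using vec.subspace_dim_equal[OF vec.subspace_span vec.subspace_UNIV, of "w ` {..<CARD('n)}"] by simp
  then have "surj ((*v) W)" using span_le[of "CARD('n)"] by auto
  then have detW: "det W \<noteq> 0"
    by (metis invertible_det_nz invertible_right_inverse matrix_right_invertible_surjective)
  have span_eq: "(*v) W ` std k = vec.span (w ` {..<k})" if k: "k \<le> CARD('n)" for k
  proof -
    have "ext w k" using w k by (auto simp: ext_def)
    then have "vec.dim (vec.span (w ` {..<k})) = vec.dim ((*v) W ` std k)"
      using dim dim_matrix_image[OF detW, of "std k"] dim_std[OF k] by simp
    then show ?thesis
      using vec.subspace_dim_equal[OF vec.subspace_span matrix_image_subspace[OF subspace_std] span_le[OF k]] by simp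
  qed
  obtain i0 :: 'n where True by simp
  \<comment> \<open>The determinant is corrected in one column, that is, by a diagonal factor
    \<open>Dg\<close> on the right, which preserves every standard step.\<close>
  define W' where "W' = (\<chi> i j. if j = i0 then inverse (det W) * W $ i $ j else W $ i $ j)"
  define Dg :: "complex^'n^'n" where "Dg = (\<chi> i j. if i = j then (if j = i0 then inverse (det W) else 1) else 0)"
  have W'_mult: "W' = W ** Dg"
    by (simp add: W'_def Dg_def vec_eq_iff matrix_matrix_mult_def if_distrib[of "\<lambda>c. _ * c"] cong: if_cong)
  have detW': "det W' = 1" using detW by (simp add: W'_def det_scale_column)
  have "upper Dg" by (auto simp: upper_def Dg_def)
  moreover have "det Dg \<noteq> 0" using detW' det_mul[of W Dg] by (auto simp: W'_mult)
  ultimately have Dg: "(*v) Dg ` std k = std k" for k by (rule upper_image_std)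
  have W'_std: "(*v) W' ` std k = (*v) W ` std k" for k
    using Dg[of k] by (simp add: W'_mult image_image flip: matrix_vector_mul_assoc)
       (metis image_image)
  have "h \<in> borel_of W'" if h: "h \<in> H" for h
  proof -
    have "(inv\<^bsub>SL\<^esub> W' ** h ** W') *v v \<in> std k" if v: "v \<in> std k" for k v
    proof (cases "k \<le> CARD('n)")
      case True
      have "ext w k" using w True by (auto simp: ext_def)
      have "W' *v v \<in> vec.span (w ` {..<k})" using v W'_std[of k] span_eq[OF True] by blast
      then have "h *v (W' *v v) \<in> (*v) W' ` std k"
        using inv[OF \<open>ext w k\<close> h] W'_std[of k] span_eq[OF True] by simp
      then obtain u where "u \<in> std k" "h *v (W' *v v) = W' *v u" by auto
      then show ?thesis by (simp add: SL_cancel detW' flip: matrix_vector_mul_assoc)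
    qed simp
    moreover have "det h = 1" using subgroup.mem_carrier[OF H(1) h] by simp
    ultimately show ?thesis by (simp add: borel_of_def upper_iff_std)
  qed
  then show ?thesis using detW' by blast
qed

text \<open>Lie--Kolchin places \<open>B\<close> inside some \<open>borel_of W\<close>, which is
  itself closed, connected and solvable; maximality gives equality.\<close>

theorem borel_subgroup_eq_borel_of:
  fixes B :: "(complex^'n^'n) set"
  assumes "borel_subgroup B"
  obtains W where "det W = 1" "B = borel_of W"
proof -
  obtain W where W: "det W = 1" "B \<subseteq> borel_of W"
    using Lie_Kolchin[of B] assms by (auto simp: borel_subgroup_def)
  then have "borel_of W = B" using assms conn_solv_borel_of[OF W(1)] by (auto simp: borel_subgroup_def)
  then show ?thesis using that W(1) by blast
qed

section \<open>The Bruhat decomposition\<close>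

text \<open>Nonzero scalars are allowed because a permutation matrix may have determinant
  -1.\<close>

definition monomial :: "('n \<Rightarrow> 'n) \<Rightarrow> complex^'n^'n \<Rightarrow> bool" where
  "monomial \<tau> A \<longleftrightarrow> (\<forall>j. \<exists>c. c \<noteq> 0 \<and> A *v axis j 1 = axis (\<tau> j) c)"

lemma axis_nth_if: "axis k x $ i = (if i = k then x else 0)"
  by (simp add: axis_def)

lemma axis_scale: "axis i (c * d) = c *s (axis i d :: complex^'n)"
  by (simp add: vec_eq_iff axis_def)

lemma axis_scale1: "axis i c = c *s (axis i 1 :: complex^'n)"
  by (simp add: vec_eq_iff axis_def)

lemma matrix_axis_scale: "A *v axis j c = c *s (A *v (axis j 1 :: complex^'n))"
  by (subst axis_scale1) (simp add: vec.scale)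

lemma matrix_eq_axisI:
  fixes A B :: "complex^'n^'n"
  assumes "\<And>j. A *v axis j 1 = B *v axis j 1"
  shows "A = B"
proof -
  have "A $ i $ j = B $ i $ j" for i j
    using arg_cong[OF assms[of j], of "\<lambda>v. v $ i"] by (simp add: matrix_vector_mult_axis)
  then show ?thesis by (simp add: vec_eq_iff)
qed

lemma monomial_mult:
  fixes A B :: "complex^'n^'n"
  assumes "monomial \<sigma> A" "monomial \<tau> B"
  shows "monomial (\<sigma> \<circ> \<tau>) (A ** B)"
  unfolding monomial_def
proof
  fix j
  obtain c where c: "c \<noteq> 0" "B *v axis j 1 = axis (\<tau> j) c" using assms(2) by (auto simp: monomial_def)
  obtain d where d: "d \<noteq> 0" "A *v axis (\<tau> j) 1 = axis (\<sigma> (\<tau> j)) d" using assms(1) by (auto simp: monomial_def)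
  have "(A ** B) *v axis j 1 = axis (\<sigma> (\<tau> j)) (c * d)"
    by (simp add: c d matrix_axis_scale[of A "\<tau> j" c] axis_scale flip: matrix_vector_mul_assoc)
  then show "\<exists>c. c \<noteq> 0 \<and> (A ** B) *v axis j 1 = axis ((\<sigma> \<circ> \<tau>) j) c"
    using c d by (intro exI[of _ "c * d"]) simp
qed

lemma monomial_inv:
  fixes A :: "complex^'n^'n"
  assumes "monomial \<sigma> A" "bij \<sigma>" "det A = 1"
  shows "monomial (inv_into UNIV \<sigma>) (inv\<^bsub>SL\<^esub> A)"
  unfolding monomial_def
proof
  fix j
  define i where "i = inv_into UNIV \<sigma> j"
  have j: "\<sigma> i = j" using assms(2) by (simp add: i_def bij_is_surj surj_f_inv_f)
  obtain c where c: "c \<noteq> 0" "A *v axis i 1 = axis j c" using assms(1) j by (auto simp: monomial_def)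
  have "inv\<^bsub>SL\<^esub> A *v (A *v axis i (1 / c)) = inv\<^bsub>SL\<^esub> A *v axis j 1"
    using c by (simp add: matrix_axis_scale[of A i "1 / c"] flip: axis_scale)
  then have "inv\<^bsub>SL\<^esub> A *v axis j 1 = axis i (1 / c)" by (simp add: SL_cancel assms(3))
  then show "\<exists>c. c \<noteq> 0 \<and> inv\<^bsub>SL\<^esub> A *v axis j 1 = axis (inv_into UNIV \<sigma> j) c"
    using c by (intro exI[of _ "1 / c"]) (simp add: i_def)
qed

lemma monomial_exists:
  fixes \<sigma> :: "'n::finite \<Rightarrow> 'n"
  assumes "bij \<sigma>"
  shows "\<exists>m. det m = 1 \<and> monomial \<sigma> m"
proof -
  define p :: "complex^'n^'n" where "p = (\<chi> i j. if i = \<sigma> j then 1 else 0)"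
  have "(p *v v) $ \<sigma> j = v $ j" for v j
  proof -
    have "(\<Sum>k\<in>UNIV. (if \<sigma> j = \<sigma> k then 1 else 0) * v $ k) = (\<Sum>k\<in>UNIV. if k = j then v $ j else 0)"
      using bij_is_inj[OF assms] by (intro sum.cong) (auto dest: injD)
    then show ?thesis by (simp add: p_def matrix_vector_mult_def)
  qed
  then have "v = 0" if "p *v v = 0" for v using that by (simp add: vec_eq_iff) (metis zero_index)
  then have det: "det p \<noteq> 0" using det_eq_0_iff_kernel by blast
  obtain i0 :: 'n where True by simp
  define m where "m = (\<chi> i j. if j = i0 then inverse (det p) * p $ i $ j else p $ i $ j)"
  have "det m = 1" unfolding m_def det_scale_column using det by simp
  moreover have "m *v axis j 1 = axis (\<sigma> j) (if j = i0 then inverse (det p) else 1)" for j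
    by (simp add: vec_eq_iff matrix_vector_mult_axis m_def axis_nth_if) (simp add: p_def)
  then have "monomial \<sigma> m" unfolding monomial_def using det by (metis inverse_nonzero_iff_nonzero zero_neq_one)
  ultimately show ?thesis by blast
qed

section \<open>Leading indices of a subspace and the Bruhat decomposition\<close>

lemma in_std_Suc_idx:
  fixes v :: "complex^'n" and i :: 'n
  assumes "v \<in> std (Suc (idx i))"
  shows "v \<in> std (idx i) \<longleftrightarrow> v $ i = 0"
proof
  assume "v $ i = 0"
  show "v \<in> std (idx i)" unfolding std_def
  proof (intro CollectI allI impI)
    fix r :: 'n assume "idx i \<le> idx r"
    then consider "r = i" | "Suc (idx i) \<le> idx r" by (metis idx_eq_iff le_eq_less_or_eq Suc_leI)
    then show "v $ r = 0" by cases (use \<open>v $ i = 0\<close> assms in \<open>auto simp: std_def\<close>)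
  qed
qed (simp add: std_def)

text \<open>The leading index of a vector is the largest index of a nonzero entry; the indices
  singled out here are the pivots of \<open>E\<close> in echelon form.\<close>

definition leads :: "(complex^'n) set \<Rightarrow> 'n \<Rightarrow> bool" where
  "leads E i \<longleftrightarrow> (\<exists>v\<in>E. v \<in> std (Suc (idx i)) \<and> v $ i \<noteq> 0)"

text \<open>From \<open>std k\<close> to the next step the dimension of the intersection grows by
  one exactly if the new index is a pivot, since two vectors with the same pivot are proportional up
  to an element of the smaller step.\<close>

lemma dim_eq_card_leads:
  fixes E :: "(complex^'n) set"
  assumes E: "vec.subspace E" and "k \<le> CARD('n)"
  shows "vec.dim (E \<inter> std k) = card {i. idx i < k \<and> leads E i}"
  using assms(2)
proof (induction k)
  case 0
  have "E \<inter> std 0 = {0}" using vec.subspace_0[OF E] by auto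
  then show ?case by (simp add: vec.dim_eq_0)
next
  case (Suc k)
  obtain i :: 'n where i: "idx i = k" using idx_surj[where 'n='n, of k] Suc.prems by auto
  have sub: "vec.subspace (E \<inter> std l)" for l using E by (simp add: vec.subspace_inter)
  have lt: "idx r < Suc k \<longleftrightarrow> r = i \<or> idx r < k" for r :: 'n using i by (metis idx_eq_iff less_Suc_eq)
  have ni: "i \<notin> {r. idx r < k \<and> leads E r}" using i by simp
  show ?case
  proof (cases "leads E i")
    case True
    then obtain v where v: "v \<in> E" "v \<in> std (Suc k)" "v $ i \<noteq> 0" by (auto simp: leads_def i)
    have "E \<inter> std (Suc k) \<subseteq> vec.span (insert v (E \<inter> std k))"
    proof
      fix u assume u: "u \<in> E \<inter> std (Suc k)"
      define c where "c = u $ i / v $ i"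
      have "u - c *s v \<in> E \<inter> std (Suc k)"
        using u v(1,2) by (intro vec.subspace_diff[OF sub] vec.subspace_scale[OF sub]) auto
      moreover have "(u - c *s v) $ i = 0" using v(3) by (simp add: c_def)
      ultimately have "u - c *s v \<in> E \<inter> std k" using in_std_Suc_idx[of _ i] i by auto
      then have "(u - c *s v) + c *s v \<in> vec.span (insert v (E \<inter> std k))"
        by (intro vec.span_add vec.span_scale vec.span_base) auto
      then show "u \<in> vec.span (insert v (E \<inter> std k))" by simp
    qed
    moreover have "vec.span (insert v (E \<inter> std k)) \<subseteq> E \<inter> std (Suc k)"
      using v(1,2) std_mono[of k "Suc k", where 'a='n] by (intro vec.span_minimal sub) auto
    ultimately have "vec.dim (E \<inter> std (Suc k)) = vec.dim (insert v (E \<inter> std k))"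
      by (metis subset_antisym vec.dim_span)
    also have "v \<notin> E \<inter> std k" using v(3) i by (auto simp: std_def)
    then have "vec.dim (insert v (E \<inter> std k)) = vec.dim (E \<inter> std k) + 1"
      using sub[of k] by (simp add: vec.dim_insert vec.span_eq_iff[THEN iffD2])
    finally have "vec.dim (E \<inter> std (Suc k)) = card {r. idx r < k \<and> leads E r} + 1"
      using Suc by simp
    moreover have "{r. idx r < Suc k \<and> leads E r} = insert i {r. idx r < k \<and> leads E r}"
      using lt True by auto
    ultimately show ?thesis using ni by simp
  next
    case False
    have "v \<in> std k" if "v \<in> E" "v \<in> std (Suc k)" for v
    proof -
      have "v $ i = 0" using False that by (auto simp: leads_def i)
      then show ?thesis using in_std_Suc_idx[of v i] that(2) i by simp
    qed
    then have "E \<inter> std (Suc k) = E \<inter> std k" using std_mono[of k "Suc k", where 'a='n] by auto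
    moreover have "{r. idx r < Suc k \<and> leads E r} = {r. idx r < k \<and> leads E r}"
      using lt False by auto
    ultimately show ?thesis using Suc by simp
  qed
qed

lemma card_leads:
  fixes E :: "(complex^'n) set"
  assumes "vec.subspace E"
  shows "card {i. leads E i} = vec.dim E"
  using dim_eq_card_leads[OF assms order_refl] by simp

text \<open>If a value were taken twice, the count just above it would be too large; so
  \<open>s\<close> takes each value below \<open>CARD('n)\<close> once.\<close>

lemma bij_of_card_less:
  fixes s :: "'n::finite \<Rightarrow> nat"
  assumes "\<And>j. j \<le> CARD('n) \<Longrightarrow> card {i. s i < j} = j"
  obtains \<sigma> :: "'n \<Rightarrow> 'n" where "bij \<sigma>" "\<And>i. idx (\<sigma> i) = s i"
proof -
  have "inj s"
  proof (rule injI, rule ccontr)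
    fix a b assume ab: "s a = s b" "a \<noteq> b"
    have "{i. s i < CARD('n)} = UNIV" using assms[of "CARD('n)"] by (intro card_eq_UNIV_imp_eq_UNIV) auto
    then have lt: "s a < CARD('n)" by auto
    have "card ({a, b} \<union> {i. s i < s a}) \<le> card {i. s i < Suc (s a)}"
      using ab by (intro card_mono) auto
    moreover have "card ({a, b} \<union> {i. s i < s a}) = 2 + s a"
      using ab assms[of "s a"] lt by (subst card_Un_disjoint) auto
    ultimately show False using assms[of "Suc (s a)"] lt by simp
  qed
  have "{i. s i < CARD('n)} = UNIV" using assms[of "CARD('n)"] by (intro card_eq_UNIV_imp_eq_UNIV) auto
  then have lt: "s i < CARD('n)" for i by auto
  define \<sigma> :: "'n \<Rightarrow> 'n" where "\<sigma> i = inv_into UNIV idx (s i)" for i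
  have idx: "idx (\<sigma> i) = s i" for i
  proof -
    have "s i \<in> range (idx :: 'n \<Rightarrow> nat)" using bij_idx[where 'n='n] lt[of i] by (simp add: bij_betw_def)
    then show ?thesis unfolding \<sigma>_def by (rule f_inv_into_f)
  qed
  have "inj \<sigma>" by (rule injI) (metis idx \<open>inj s\<close> injD)
  then have "bij \<sigma>" by (simp add: finite_UNIV_inj_surj bij_def)
  then show ?thesis using idx that by blast
qed

text \<open>The permutation sends \<open>i\<close> to the first step of the flag \<open>g std\<close> that contains a vector with
  leading index \<open>i\<close>; such vectors form a basis adapted to both flags.\<close>

theorem Bruhat_decomposition:
  fixes g :: "complex^'n^'n"
  assumes g: "det g = 1"
  obtains b m b' \<tau> where "b \<in> borel_std" "b' \<in> borel_std" "det m = 1" "bij \<tau>" "monomial \<tau> m" "g = b ** m ** b'"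
proof -
  define E where "E j = (*v) g ` std j" for j
  have subE: "vec.subspace (E j)" for j unfolding E_def by (rule matrix_image_subspace) simp
  have dimE: "vec.dim (E j) = j" if "j \<le> CARD('n)" for j
    using dim_matrix_image[of g "std j"] dim_std[OF that] g by (simp add: E_def)
  have monoE: "E j \<subseteq> E l" if "j \<le> l" for j l unfolding E_def using std_mono[OF that] by (rule image_mono)
  have EUNIV: "E CARD('n) = UNIV"
    using vec.subspace_dim_equal[OF subE vec.subspace_UNIV, of "CARD('n)"] dimE[of "CARD('n)"]
    by (simp add: card_cart_basis vec_dim_card)
  have lead_top: "leads (E CARD('n)) i" for i :: 'n
    unfolding EUNIV leads_def by (rule bexI[of _ "axis i 1"]) (auto simp: axis_in_std)
  define s where "s i = (LEAST j. leads (E (Suc j)) i)" for i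
  have ex: "leads (E (Suc (CARD('n) - 1))) i" for i using lead_top[of i] by simp
  have s: "leads (E (Suc (s i))) i" for i unfolding s_def by (rule LeastI[of _ "CARD('n) - 1"]) (rule ex)
  have lead0: "\<not> leads (E 0) i" for i by (auto simp: leads_def E_def)
  have s_less: "s i < j \<longleftrightarrow> leads (E j) i" for i j
  proof
    assume "s i < j"
    then show "leads (E j) i" using s[of i] monoE[of "Suc (s i)" j] by (auto simp: leads_def)
  next
    assume l: "leads (E j) i"
    then obtain j' where j': "j = Suc j'" using lead0 by (cases j) auto
    then have "s i \<le> j'" unfolding s_def using l by (intro Least_le) simp
    then show "s i < j" using j' by simp
  qed
  have "card {i. s i < j} = j" if "j \<le> CARD('n)" for j
    using card_leads[OF subE[of j]] dimE[OF that] by (simp add: s_less)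
  then obtain \<sigma> :: "'n \<Rightarrow> 'n" where \<sigma>: "bij \<sigma>" "\<And>i. idx (\<sigma> i) = s i" using bij_of_card_less by blast
  have "\<forall>i. \<exists>v. v \<in> E (Suc (s i)) \<and> v \<in> std (Suc (idx i)) \<and> v $ i \<noteq> 0" using s by (auto simp: leads_def)
  from choice[OF this] obtain v where
    v: "\<forall>i. v i \<in> E (Suc (s i)) \<and> v i \<in> std (Suc (idx i)) \<and> v i $ i \<noteq> 0" ..
  define b0 :: "complex^'n^'n" where "b0 = (\<chi> r i. v i $ r)"
  have up0: "upper b0" using v by (auto simp: upper_def b0_def std_def)
  have "det b0 \<noteq> 0" unfolding det_upper[OF up0] using v by (simp add: b0_def)
  obtain i0 :: 'n where True by simp
  define b where "b = (\<chi> r i. if i = i0 then inverse (det b0) * b0 $ r $ i else b0 $ r $ i)"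
  have detb: "det b = 1" unfolding b_def det_scale_column using \<open>det b0 \<noteq> 0\<close> by simp
  have upb: "upper b" using up0 by (auto simp: upper_def b_def)
  have bE: "b *v axis i 1 \<in> E (Suc (s i))" for i
  proof -
    have "b *v axis i 1 = (if i = i0 then inverse (det b0) else 1) *s v i"
      by (simp add: vec_eq_iff matrix_vector_mult_axis b_def b0_def)
    then show ?thesis using v vec.subspace_scale[OF subE] by simp
  qed
  obtain m where m: "det m = 1" "monomial \<sigma> m" using monomial_exists[OF \<sigma>(1)] by blast
  \<comment> \<open>\<open>c\<close> is upper triangular: \<open>m\<close> sends
    \<open>axis i 1\<close> to a multiple of the axis vector in position \<open>s i\<close>, while
    \<open>b\<close> sends it into the image of \<open>std (Suc (s i))\<close> under
    \<open>g\<close>.\<close>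
  define c where "c = inv\<^bsub>SL\<^esub> g ** b ** inv\<^bsub>SL\<^esub> m"
  have detc: "det c = 1" by (simp add: c_def det_mul SL_inv g m detb)
  have "c *v axis j 1 \<in> std (Suc (idx j))" for j
  proof -
    obtain i where i: "j = \<sigma> i" using \<sigma>(1) by (metis bij_pointE)
    obtain d where d: "d \<noteq> 0" "m *v axis i 1 = axis j d" using m(2) i by (auto simp: monomial_def)
    have "c *v (m *v axis i 1) = inv\<^bsub>SL\<^esub> g *v (b *v axis i 1)"
      by (simp add: c_def SL_cancel m flip: matrix_vector_mul_assoc)
    moreover have "inv\<^bsub>SL\<^esub> g *v (b *v axis i 1) \<in> std (Suc (s i))"
      using bE[of i] by (auto simp: E_def SL_cancel g)
    ultimately have "d *s (c *v axis j 1) \<in> std (Suc (idx j))"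
      using d i \<sigma>(2) matrix_axis_scale[of c j d] by simp
    then have "inverse d *s (d *s (c *v axis j 1)) \<in> std (Suc (idx j))"
      by (rule vec.subspace_scale[OF subspace_std])
    then show ?thesis using d(1) by simp
  qed
  then have upc: "upper c" by (auto simp: upper_def std_def matrix_vector_mult_axis)
  have "g = b ** inv\<^bsub>SL\<^esub> m ** inv\<^bsub>SL\<^esub> c"
  proof -
    have "g ** c = b ** inv\<^bsub>SL\<^esub> m" by (simp add: c_def matrix_mul_rassoc SL_cancel g)
    then have "g ** c ** inv\<^bsub>SL\<^esub> c = b ** inv\<^bsub>SL\<^esub> m ** inv\<^bsub>SL\<^esub> c" by simp
    then show ?thesis by (simp add: matrix_mul_rassoc SL_inv detc)
  qed
  moreover have "bij (inv_into UNIV \<sigma>)" using \<sigma>(1) by (rule bij_imp_bij_inv)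
  ultimately show ?thesis
    using that[of b "inv\<^bsub>SL\<^esub> c" "inv\<^bsub>SL\<^esub> m" "inv_into UNIV \<sigma>"] monomial_inv[OF m(2) \<sigma>(1) m(1)]
      upb detb upper_inv[OF upc detc] SL_inv[OF detc] SL_inv[OF m(1)] by (simp add: borel_std_def)
qed

section \<open>Parabolic subgroups are stabilizers of flags\<close>

definition elem :: "'n \<Rightarrow> 'n \<Rightarrow> complex \<Rightarrow> complex^'n^'n" where
  "elem i j t = (\<chi> r s. (if r = s then 1 else 0) + (if r = i \<and> s = j then t else 0))"

lemma elem_mult_vec: "elem i j t *v v = v + axis i (t * v $ j)"
proof -
  have "(\<Sum>s\<in>UNIV. ((if r = s then 1 else 0) + (if r = i \<and> s = j then t else 0)) * v $ s)
      = (\<Sum>s\<in>UNIV. if s = r then v $ r else 0) + (\<Sum>s\<in>UNIV. if s = j then (if r = i then t * v $ j else 0) else 0)" for r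
    unfolding sum.distrib[symmetric] by (rule sum.cong) (auto simp: algebra_simps)
  then show ?thesis by (simp add: vec_eq_iff elem_def matrix_vector_mult_def axis_nth_if)
qed

lemma det_elem:
  assumes "i \<noteq> j"
  shows "det (elem i j t) = 1"
proof -
  \<comment> \<open>For an entry below the diagonal the order of the indices is reversed, so that
    the matrix is triangular in either case.\<close>
  define e where "e k = (if idx i < idx j then idx k else CARD('a) - idx k)" for k :: 'a
  have "inj e"
  proof (rule injI)
    fix a b assume eq: "e a = e b"
    have "idx a = idx b"
    proof (cases "idx i < idx j")
      case False
      then have "CARD('a) - idx a = CARD('a) - idx b" using eq by (simp add: e_def)
      then show ?thesis using idx_less[of a] idx_less[of b] by linarith
    qed (use eq in \<open>simp add: e_def\<close>)
    then show "a = b" by simp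
  qed
  moreover have "elem i j t $ r $ s = 0" if "e s < e r" for r s
  proof -
    have "r \<noteq> s" using that by auto
    moreover have "\<not> (r = i \<and> s = j)"
    proof
      assume "r = i \<and> s = j"
      then show False using that assms idx_less[of i] idx_less[of j] idx_eq_iff[of i j]
        by (simp add: e_def split: if_splits)
    qed
    ultimately show ?thesis by (auto simp: elem_def)
  qed
  ultimately have "det (elem i j t) = (\<Prod>k\<in>UNIV. elem i j t $ k $ k)" by (rule det_triangular)
  also have "\<dots> = 1" using assms by (intro prod.neutral) (auto simp: elem_def)
  finally show ?thesis .
qed

lemma upper_elem: "idx i < idx j \<Longrightarrow> upper (elem i j t)"
  by (auto simp: upper_def elem_def)

text \<open>Summing over all \<open>i\<close> gives equality, because \<open>\<tau>\<close> only
  permutes the terms.\<close>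

lemma permutation_monotone_eq:
  fixes \<tau> :: "'n::finite \<Rightarrow> 'n" and f :: "'n \<Rightarrow> nat"
  assumes "bij \<tau>" "\<And>i. f i \<le> f (\<tau> i)"
  shows "f (\<tau> i) = f i"
proof (rule ccontr)
  assume "f (\<tau> i) \<noteq> f i"
  then have "f i < f (\<tau> i)" using assms(2)[of i] by linarith
  then have "(\<Sum>i\<in>UNIV. f i) < (\<Sum>i\<in>UNIV. f (\<tau> i))"
    using assms(2) by (intro sum_strict_mono_ex1) auto
  moreover have "(\<Sum>i\<in>UNIV. f (\<tau> i)) = (\<Sum>i\<in>UNIV. f i)"
    using sum.reindex_bij_betw[OF assms(1), of f] by simp
  ultimately show False by simp
qed

lemma monomial_std:
  fixes m :: "complex^'n^'n"
  assumes "monomial \<tau> m" "(*v) m ` std k \<subseteq> std k" "idx i < k"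
  shows "idx (\<tau> i) < k"
proof -
  obtain c where c: "c \<noteq> 0" "m *v axis i 1 = axis (\<tau> i) c" using assms(1) by (auto simp: monomial_def)
  have "m *v axis i 1 \<in> std k" using assms(2,3) by (auto simp: axis_in_std)
  then show ?thesis using c by (simp add: axis_in_std)
qed

lemma monomial_preserves_std:
  fixes m :: "complex^'n^'n"
  assumes m: "monomial \<tau> m" and \<tau>: "\<And>i. idx i < k \<Longrightarrow> idx (\<tau> i) < k" and v: "v \<in> std k"
  shows "m *v v \<in> std k"
proof -
  have "m $ r $ i * v $ i = 0" if r: "k \<le> idx r" for r i
  proof (cases "idx i < k")
    case True
    obtain c where "m *v axis i 1 = axis (\<tau> i) c" using m by (auto simp: monomial_def)
    then have "m $ r $ i = axis (\<tau> i) c $ r" by (metis matrix_vector_mult_axis mult.right_neutral)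
    moreover have "r \<noteq> \<tau> i" using \<tau>[OF True] r by auto
    ultimately show ?thesis by (simp add: axis_nth_if)
  next
    case False
    then show ?thesis using v by (simp add: std_def)
  qed
  then show ?thesis by (auto simp: std_def matrix_vector_mult_def intro!: sum.neutral)
qed

lemma monomial_id_upper:
  fixes m :: "complex^'n^'n"
  assumes "monomial id m"
  shows "upper m"
  unfolding upper_iff_std using monomial_preserves_std[OF assms] by auto

lemma stabilizes_mult:
  fixes A B :: "complex^'n^'n"
  assumes "(*v) A ` S = S" "(*v) B ` S = S"
  shows "(*v) (A ** B) ` S = S"
proof -
  have "(*v) (A ** B) ` S = (*v) A ` ((*v) B ` S)"
    by (simp add: image_image flip: matrix_vector_mul_assoc)
  then show ?thesis by (simp add: assms)
qed

text \<open>The elementary matrices in \<open>P\<close> define a total preorder on the indices; a monomial matrix of \<open>P\<close>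
  acts by automorphisms of this preorder and hence preserves its classes.\<close>

lemma stabilizer_subset_of_borel_std_subset:
  fixes P :: "(complex^'n^'n) set"
  assumes P: "subgroup P SL" "borel_std \<subseteq> P"
    and g: "det g = 1"
      "\<And>k. k \<le> CARD('n) \<Longrightarrow> (\<forall>h\<in>P. (*v) h ` std k = (std k :: (complex^'n) set)) \<Longrightarrow> (*v) g ` std k = std k"
  shows "g \<in> P"
proof -
  interpret P: subgroup P SL by (rule P(1))
  have mulP: "a ** b \<in> P" if "a \<in> P" "b \<in> P" for a b using P.m_closed[OF that] by simp
  have invP: "inv\<^bsub>SL\<^esub> a \<in> P" if "a \<in> P" for a using that by (rule P.m_inv_closed)
  have detP: "det a = 1" if "a \<in> P" for a using P.mem_carrier[OF that] by simp
  define R where "R i j \<longleftrightarrow> i = j \<or> (\<forall>t. elem i j t \<in> P)" for i j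
  have R_idx: "R i j" if "idx i \<le> idx j" for i j
  proof (cases "i = j")
    case False
    then have "idx i < idx j" using that idx_eq_iff[of i j] by linarith
    then have "elem i j t \<in> borel_std" for t
      using upper_elem det_elem[OF False] by (auto simp: borel_std_def)
    then show ?thesis using P(2) by (auto simp: R_def)
  qed (simp add: R_def)
  have R_trans: "R i k" if "R i j" "R j k" for i j k
  proof (cases "i = j \<or> j = k \<or> i = k")
    case False
    then have ne: "i \<noteq> j" "j \<noteq> k" "i \<noteq> k" by auto
    then have e: "elem i j s \<in> P" "elem j k s \<in> P" for s using that by (auto simp: R_def)
    \<comment> \<open>The commutator relation of elementary matrices gives transitivity.\<close>
    have "elem i j 1 ** elem j k t ** elem i j (-1) ** elem j k (-t) = elem i k t" for t
      by (rule matrix_eq_axisI)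
         (use ne in \<open>simp add: elem_mult_vec axis_nth_if vec_eq_iff flip: matrix_vector_mul_assoc\<close>)
    then have "elem i k t \<in> P" for t using mulP e by metis
    then show ?thesis by (simp add: R_def)
  qed (use that in \<open>auto simp: R_def\<close>)
  have R_monomial: "R (\<tau> i) (\<tau> j)" if "R i j" and m: "m \<in> P" "monomial \<tau> m" "bij \<tau>" for i j \<tau> m
  proof (cases "i = j")
    case False
    obtain c where c: "\<And>i. c i \<noteq> 0" "\<And>i. m *v axis i 1 = axis (\<tau> i) (c i)"
      using m(2) choice[of "\<lambda>j c. c \<noteq> 0 \<and> m *v axis j 1 = axis (\<tau> j) c"] unfolding monomial_def by blast
    have mc: "m *v axis i d = axis (\<tau> i) (d * c i)" for i d
      by (simp add: matrix_axis_scale[of m i d] c axis_scale)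
    have inj: "\<tau> a = \<tau> b \<longleftrightarrow> a = b" for a b using m(3) by (auto dest: bij_is_inj injD)
    have "elem (\<tau> i) (\<tau> j) t \<in> P" for t
    proof -
      define t' where "t' = t * c j / c i"
      have "m ** elem i j t' = elem (\<tau> i) (\<tau> j) t ** m"
        by (rule matrix_eq_axisI)
           (auto simp: elem_mult_vec mc axis_nth_if inj matrix_vector_right_distrib t'_def c(1)
             vec_eq_iff simp flip: matrix_vector_mul_assoc)
      then have "elem (\<tau> i) (\<tau> j) t = m ** elem i j t' ** inv\<^bsub>SL\<^esub> m"
        by (simp add: matrix_mul_rassoc SL_inv detP[OF m(1)])
      moreover have "elem i j t' \<in> P" using that(1) False by (simp add: R_def)
      ultimately show ?thesis using mulP invP m(1) by simp
    qed
    then show ?thesis by (simp add: R_def)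
  qed (simp add: R_def)
  \<comment> \<open>\<open>lev\<close> is at once a rank function for the preorder and the dimension
    of the standard step in which the class of \<open>i\<close> ends.\<close>
  define lev where "lev i = card {k. R k i}" for i
  have lev_mono: "lev i \<le> lev j" if "R i j" for i j
    unfolding lev_def using R_trans that by (intro card_mono) auto
  have R_iff: "R i j \<longleftrightarrow> lev i \<le> lev j" for i j
  proof
    assume le: "lev i \<le> lev j"
    show "R i j"
    proof (cases "idx i \<le> idx j")
      case False
      then have "R j i" by (intro R_idx) simp
      then have "{k. R k j} \<subseteq> {k. R k i}" using R_trans by blast
      then have "{k. R k j} = {k. R k i}" using le unfolding lev_def by (intro card_seteq) auto
      then show ?thesis using R_idx[of i i] by blast
    qed (rule R_idx)
  qed (rule lev_mono)
  have lev_idx: "lev i \<le> lev j" if "idx i \<le> idx j" for i j using R_idx[OF that] by (rule lev_mono)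
  have lev_monomial: "lev (\<tau> i) = lev i" if "m \<in> P" "monomial \<tau> m" "bij \<tau>" for m \<tau> i
  proof (rule permutation_monotone_eq[OF that(3)])
    fix i
    have "card {k. R k i} = card (\<tau> ` {k. R k i})"
      using that(3) by (metis bij_is_inj card_image inj_on_subset subset_UNIV)
    also have "\<dots> \<le> card {k. R k (\<tau> i)}" using R_monomial[OF _ that] by (intro card_mono) auto
    finally show "lev i \<le> lev (\<tau> i)" by (simp add: lev_def)
  qed
  have seg: "{j. lev j \<le> lev i} = {j. idx j < lev i}" for i
  proof -
    have down: "b \<in> {k. R k i}" if "a \<in> {k. R k i}" "idx b \<le> idx a" for a b
      using that R_idx R_trans by blast
    let ?S = "idx ` {k. R k i}"
    have card: "card ?S = lev i" unfolding lev_def by (rule card_image) (rule inj_on_subset[OF inj_idx subset_UNIV])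
    have "?S = {..<lev i}"
    proof (rule card_subset_eq[symmetric, THEN sym])
      show "finite {..<lev i}" by simp
      show "?S \<subseteq> {..<lev i}"
      proof
        fix x assume "x \<in> ?S"
        then obtain a where a: "R a i" "x = idx a" by auto
        have "{..x} \<subseteq> ?S"
        proof
          fix y assume "y \<in> {..x}"
          then have "y < CARD('n)" using a order.strict_trans1[OF _ idx_less[of a], of y] by simp
          then obtain b :: 'n where "idx b = y" using idx_surj[where 'n='n] by blast
          then show "y \<in> ?S" using down[of a b] a \<open>y \<in> {..x}\<close> by auto
        qed
        then have "card {..x} \<le> card ?S" by (intro card_mono) auto
        then show "x \<in> {..<lev i}" using card by simp
      qed
      show "card ?S = card {..<lev i}" using card by simp
    qed
    then have "R j i \<longleftrightarrow> idx j < lev i" for j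
      using inj_image_mem_iff[OF inj_idx, of j "{k. R k i}"] by auto
    then show ?thesis using R_iff by auto
  qed
  have seg_iff: "idx j < lev i \<longleftrightarrow> lev j \<le> lev i" for i j using seg[of i] by auto
  \<comment> \<open>By the Bruhat decomposition it suffices to test monomial elements of
    \<open>P\<close>, and these preserve \<open>lev\<close>.\<close>
  have cut: "(*v) h ` std (lev i) = std (lev i)" if h: "h \<in> P" for h i
  proof -
    obtain b m b' \<tau> where b: "b \<in> borel_std" "b' \<in> borel_std" "det m = 1" "bij \<tau>" "monomial \<tau> m" "h = b ** m ** b'"
      by (rule Bruhat_decomposition[OF detP[OF h]])
    have "m = inv\<^bsub>SL\<^esub> b ** h ** inv\<^bsub>SL\<^esub> b'"
      using b by (simp add: b(6) matrix_mul_rassoc SL_cancel SL_inv borel_std_def)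
    also have "\<dots> \<in> P" using b P(2) h by (intro mulP invP) auto
    finally have "m \<in> P" .
    from lev_monomial[OF this b(5,4)] have "idx (\<tau> j) < lev i" if "idx j < lev i" for j
      using that by (simp add: seg_iff)
    then have "(*v) m ` std (lev i) \<subseteq> std (lev i)" using monomial_preserves_std[OF b(5)] by auto
    then have "(*v) m ` std (lev i) = std (lev i)"
      by (subst matrix_image_eq_iff_subset) (use b(3) in auto)
    moreover have "(*v) b ` std (lev i) = std (lev i)" "(*v) b' ` std (lev i) = std (lev i)"
      using b by (auto simp: borel_std_def intro!: upper_image_std)
    ultimately show ?thesis unfolding b(6) by (intro stabilizes_mult)
  qed
  have lev_le: "lev i \<le> CARD('n)" for i unfolding lev_def by (rule card_mono) auto
  \<comment> \<open>Conversely, a permutation that preserves levels is a product of transpositions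
    within classes. Each is realised in \<open>P\<close> by elementary matrices, and multiplying by
    it lets one more index become fixed.\<close>
  have monomial_in_P: "m \<in> P" if "det m = 1" "monomial \<tau> m" "bij \<tau>" "\<And>i. lev (\<tau> i) = lev i" for m \<tau>
    using that
  proof (induction "card {i. \<tau> i \<noteq> i}" arbitrary: m \<tau> rule: less_induct)
    case less
    show ?case
    proof (cases "\<exists>i. \<tau> i \<noteq> i")
      case False
      then have "\<tau> = id" by auto
      then have "upper m" using less.prems monomial_id_upper by blast
      then show ?thesis using less.prems P(2) by (auto simp: borel_std_def)
    next
      case True
      then obtain i where i: "\<tau> i \<noteq> i" by blast
      define j where "j = \<tau> i"
      have ij: "i \<noteq> j" using i by (simp add: j_def)
      have "lev i = lev j" using less.prems(4)[of i] by (simp add: j_def)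
      then have e: "elem i j t \<in> P" "elem j i t \<in> P" for t using R_iff[of i j] R_iff[of j i] ij by (auto simp: R_def)
      \<comment> \<open>The usual representative of a transposition in the group generated by two
        opposite root subgroups: \<open>axis i 1\<close> goes to \<open>axis j (-1)\<close> and
        \<open>axis j 1\<close> to \<open>axis i 1\<close>.\<close>
      define s where "s = elem i j 1 ** elem j i (-1) ** elem i j 1"
      have sP: "s \<in> P" unfolding s_def using e mulP by simp
      have "s *v axis k 1 = axis (Transposition.transpose i j k) (if k = i then -1 else 1)" for k
        using ij by (simp add: s_def elem_mult_vec vec_eq_iff axis_nth_if Transposition.transpose_def flip: matrix_vector_mul_assoc) (use ij in blast)
      then have s: "monomial (Transposition.transpose i j) s"
        unfolding monomial_def by (metis neg_equal_0_iff_equal zero_neq_one)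
      define \<tau>' where "\<tau>' = Transposition.transpose i j \<circ> \<tau>"
      have "{k. \<tau>' k \<noteq> k} \<subset> {k. \<tau> k \<noteq> k}"
      proof
        have "k \<noteq> i \<and> k \<noteq> j" if "\<tau> k = k" for k
          using that i injD[OF bij_is_inj[OF less.prems(3)], of k i] by (auto simp: j_def)
        then have "\<tau>' k = k" if "\<tau> k = k" for k
          using that by (simp add: \<tau>'_def Transposition.transpose_def)
        then show "{k. \<tau>' k \<noteq> k} \<subseteq> {k. \<tau> k \<noteq> k}" by blast
        have "\<tau>' i = i" by (simp add: \<tau>'_def j_def)
        then show "{k. \<tau>' k \<noteq> k} \<noteq> {k. \<tau> k \<noteq> k}" using i by blast
      qed
      then have "card {k. \<tau>' k \<noteq> k} < card {k. \<tau> k \<noteq> k}" by (intro psubset_card_mono) auto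
      moreover have "det (s ** m) = 1" using detP[OF sP] less.prems(1) by (simp add: det_mul)
      moreover have "monomial \<tau>' (s ** m)" unfolding \<tau>'_def by (rule monomial_mult[OF s less.prems(2)])
      moreover have "bij \<tau>'" unfolding \<tau>'_def using less.prems(3) by (simp add: bij_comp)
      moreover have "lev (\<tau>' k) = lev k" for k
      proof -
        have "lev (Transposition.transpose i j l) = lev l" for l using \<open>lev i = lev j\<close> by (simp add: Transposition.transpose_def)
        then show ?thesis using less.prems(4) by (simp add: \<tau>'_def)
      qed
      ultimately have "s ** m \<in> P" by (rule less.hyps)
      then have "inv\<^bsub>SL\<^esub> s ** (s ** m) \<in> P" using mulP invP sP by blast
      then show ?thesis by (simp add: SL_cancel detP[OF sP])
    qed
  qed
  obtain b m b' \<tau> where b: "b \<in> borel_std" "b' \<in> borel_std" "det m = 1" "bij \<tau>" "monomial \<tau> m" "g = b ** m ** b'"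
    by (rule Bruhat_decomposition[OF g(1)])
  have m: "m = inv\<^bsub>SL\<^esub> b ** g ** inv\<^bsub>SL\<^esub> b'"
    using b by (simp add: b(6) matrix_mul_rassoc SL_cancel SL_inv borel_std_def)
  have "(*v) m ` std (lev i) = std (lev i)" for i
  proof -
    have "(*v) g ` std (lev i) = std (lev i)" using g(2)[OF lev_le] cut by blast
    moreover have "(*v) (inv\<^bsub>SL\<^esub> b) ` std (lev i) = std (lev i)" "(*v) (inv\<^bsub>SL\<^esub> b') ` std (lev i) = std (lev i)"
      using b by (auto simp: borel_std_def intro!: upper_image_std upper_inv simp: SL_inv)
    ultimately show ?thesis unfolding m by (intro stabilizes_mult)
  qed
  then have "idx (\<tau> j) < lev i" if "idx j < lev i" for i j
    using monomial_std[OF b(5), of "lev i" j] that by blast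
  \<comment> \<open>Stability of the steps gives only one inequality, but a permutation cannot lower
    \<open>lev\<close> somewhere without raising it elsewhere.\<close>
  then have le: "lev (\<tau> i) \<le> lev i" for i using seg_iff[of i i] seg_iff[of "\<tau> i" i] by simp
  have eq: "CARD('n) - lev (\<tau> i) = CARD('n) - lev i" for i
    using permutation_monotone_eq[OF b(4), of "\<lambda>i. CARD('n) - lev i" i] diff_le_mono2[OF le] by blast
  have "lev (\<tau> i) = lev i" for i using eq[of i] lev_le[of i] lev_le[of "\<tau> i"] by linarith
  then have "m \<in> P" by (rule monomial_in_P[OF b(3,5,4)])
  moreover have "b \<in> P" "b' \<in> P" using b P(2) by auto
  ultimately show ?thesis unfolding b(6) by (intro mulP)
qed

text \<open>The elements of \<open>J\<close> are the dimensions of the steps of a partial flag; for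
  empty \<open>J\<close> this is all of \<open>SL\<close>.\<close>

definition flag_stabilizer :: "complex^'n^'n \<Rightarrow> nat set \<Rightarrow> (complex^'n^'n) set" where
  "flag_stabilizer W J = {g. det g = 1 \<and> (\<forall>k\<in>J. (*v) (g ** W) ` std k = (*v) W ` std k)}"

theorem parabolic_eq_flag_stabilizer:
  fixes P :: "(complex^'n^'n) set"
  assumes "parabolic_subgroup P"
  obtains W J where "det W = 1" "J \<subseteq> {0<..<CARD('n)}" "P = flag_stabilizer W J"
proof -
  obtain B where B: "borel_subgroup B" "B \<subseteq> P" and P: "subgroup P SL"
    using assms by (auto simp: parabolic_subgroup_def)
  obtain W where W: "det W = 1" "B = borel_of W" using borel_subgroup_eq_borel_of[OF B(1)] by blast
  define P' where "P' = (\<lambda>A. inv\<^bsub>SL\<^esub> W ** A ** W) ` P"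
  have inv_inv: "inv\<^bsub>SL\<^esub> (inv\<^bsub>SL\<^esub> W) = W" by (rule SL_inv_eqI) (simp_all add: SL_inv W)
  interpret h: group_hom SL SL "\<lambda>A. inv\<^bsub>SL\<^esub> W ** A ** W"
    using conj_group_hom[of "inv\<^bsub>SL\<^esub> W"] by (simp add: inv_inv SL_inv W)
  have P': "subgroup P' SL" unfolding P'_def by (rule h.subgroup_img_is_subgroup[OF P])
  have mem: "A \<in> P \<longleftrightarrow> inv\<^bsub>SL\<^esub> W ** A ** W \<in> P'" for A
  proof
    assume "inv\<^bsub>SL\<^esub> W ** A ** W \<in> P'"
    then obtain A' where A': "A' \<in> P" "inv\<^bsub>SL\<^esub> W ** A ** W = inv\<^bsub>SL\<^esub> W ** A' ** W" by (auto simp: P'_def)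
    then have "W ** (inv\<^bsub>SL\<^esub> W ** A ** W) ** inv\<^bsub>SL\<^esub> W = W ** (inv\<^bsub>SL\<^esub> W ** A' ** W) ** inv\<^bsub>SL\<^esub> W" by simp
    then have "A = A'" by (simp add: matrix_mul_rassoc SL_cancel SL_inv W)
    then show "A \<in> P" using A' by simp
  qed (simp add: P'_def)
  have sub: "borel_std \<subseteq> P'"
  proof
    fix A :: "complex^'n^'n" assume "A \<in> borel_std"
    then have "W ** A ** inv\<^bsub>SL\<^esub> W \<in> P" using B(2) borel_of_eq_image[OF W(1)] W(2) by blast
    then have "inv\<^bsub>SL\<^esub> W ** (W ** A ** inv\<^bsub>SL\<^esub> W) ** W \<in> P'" using mem by blast
    then show "A \<in> P'" by (simp add: matrix_mul_rassoc SL_cancel SL_inv W)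
  qed
  have stab: "(*v) (inv\<^bsub>SL\<^esub> W ** A ** W) ` S = S \<longleftrightarrow> (*v) (A ** W) ` S = (*v) W ` S" for A S
  proof -
    have 1: "(*v) (inv\<^bsub>SL\<^esub> W ** A ** W) ` S = (*v) (inv\<^bsub>SL\<^esub> W) ` ((*v) (A ** W) ` S)"
      by (simp add: image_image flip: matrix_vector_mul_assoc)
    have 2: "(*v) W ` ((*v) (inv\<^bsub>SL\<^esub> W ** A ** W) ` S) = (*v) (A ** W) ` S"
      by (simp add: image_image SL_cancel W flip: matrix_vector_mul_assoc)
    have 3: "(*v) (inv\<^bsub>SL\<^esub> W) ` ((*v) W ` S) = S" by (simp add: image_image SL_cancel W)
    show ?thesis using 1 2 3 by metis
  qed
  \<comment> \<open>All proper standard steps preserved by the conjugate \<open>P'\<close>. The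
    steps 0 and \<open>CARD('n)\<close> are preserved by every element and are left out.\<close>
  define J where "J = {k. 0 < k \<and> k < CARD('n) \<and> (\<forall>h\<in>P'. (*v) h ` std k = (std k :: (complex^'n) set))}"
  have "P = flag_stabilizer W J"
  proof (intro Set.set_eqI iffI)
    fix A assume A: "A \<in> P"
    then have "det A = 1" using subgroup.mem_carrier[OF P] by simp
    moreover have "(*v) (A ** W) ` std k = (*v) W ` std k" if k: "k \<in> J" for k
    proof -
      have "inv\<^bsub>SL\<^esub> W ** A ** W \<in> P'" using A mem by simp
      moreover have "\<forall>h\<in>P'. (*v) h ` std k = (std k :: (complex^'n) set)" using k by (simp add: J_def)
      ultimately have "(*v) (inv\<^bsub>SL\<^esub> W ** A ** W) ` std k = std k" by (rule bspec[rotated])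
      then show ?thesis by (simp only: stab)
    qed
    ultimately show "A \<in> flag_stabilizer W J" by (simp add: flag_stabilizer_def)
  next
    fix A assume A: "A \<in> flag_stabilizer W J"
    have "inv\<^bsub>SL\<^esub> W ** A ** W \<in> P'"
    proof (rule stabilizer_subset_of_borel_std_subset[OF P' sub])
      show dA: "det (inv\<^bsub>SL\<^esub> W ** A ** W) = 1" using A by (simp add: flag_stabilizer_def det_mul SL_inv W)
      fix k assume k: "k \<le> CARD('n)" "\<forall>h\<in>P'. (*v) h ` std k = (std k :: (complex^'n) set)"
      consider "k = 0" | "k = CARD('n)" | "k \<in> J"
        using k unfolding J_def mem_Collect_eq by linarith
      then show "(*v) (inv\<^bsub>SL\<^esub> W ** A ** W) ` std k = std k"
      proof cases
        case 2
        then show ?thesis by (subst matrix_image_eq_iff_subset) (use dA in auto)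
      next
        case 3
        then show ?thesis using A stab by (simp add: flag_stabilizer_def)
      qed simp
    qed
    then show "A \<in> P" by (simp add: mem)
  qed
  moreover have "J \<subseteq> {0<..<CARD('n)}" by (auto simp: J_def)
  ultimately show ?thesis using that W(1) by blast
qed

section \<open>Pairs of a subspace and a flag\<close>

definition coord_space :: "'n set \<Rightarrow> (complex^'n) set" where
  "coord_space I = {v. \<forall>i. i \<notin> I \<longrightarrow> v $ i = 0}"

text \<open>The dimension of \<open>coord_space I \<inter> std j\<close> as a step function of
  \<open>j\<close>; it encodes the relative position of a subspace and a full flag.\<close>

definition count_below :: "'n::finite set \<Rightarrow> nat \<Rightarrow> nat" where
  "count_below I j = card {i\<in>I. idx i < j}"

lemma std_eq_coord_space: "std k = coord_space {i. idx i < k}"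
  by (auto simp: std_def coord_space_def not_less)

lemma dim_coord_space: "vec.dim (coord_space I :: (complex^'n) set) = card I"
  unfolding coord_space_def by (rule dim_substandard_cart)

lemma subspace_coord_space [simp]: "vec.subspace (coord_space I)"
  by (auto simp: coord_space_def vec.subspace_def)

lemma axis_in_coord_space: "i \<in> I \<Longrightarrow> axis i c \<in> coord_space I"
  by (auto simp: coord_space_def axis_nth_if)

lemma coord_space_Int_std: "coord_space I \<inter> std j = coord_space {i\<in>I. idx i < j}"
  by (auto simp: std_def coord_space_def not_less)

lemma monomial_image_coord_space:
  fixes m :: "complex^'n^'n"
  assumes "monomial \<tau> m" "bij \<tau>" "det m \<noteq> 0"
  shows "(*v) m ` coord_space I = coord_space (\<tau> ` I)"
proof (subst matrix_image_eq_iff_subset)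
  show "vec.dim (coord_space I :: (complex^'n) set) = vec.dim (coord_space (\<tau> ` I) :: (complex^'n) set)"
    using assms(2) by (simp add: dim_coord_space) (metis bij_is_inj card_image inj_on_subset subset_UNIV)
  show "(*v) m ` coord_space I \<subseteq> coord_space (\<tau> ` I)"
  proof (rule image_subsetI)
    fix v :: "complex^'n" assume v: "v \<in> coord_space I"
    have "m $ r $ i * v $ i = 0" if r: "r \<notin> \<tau> ` I" for r i
    proof (cases "i \<in> I")
      case True
      obtain c where "m *v axis i 1 = axis (\<tau> i) c" using assms(1) by (auto simp: monomial_def)
      from arg_cong[OF this, of "\<lambda>w. w $ r"] have "m $ r $ i = axis (\<tau> i) c $ r"
        by (simp add: matrix_vector_mult_axis)
      then show ?thesis using r True by (auto simp: axis_nth_if)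
    next
      case False
      then show ?thesis using v by (simp add: coord_space_def)
    qed
    then show "m *v v \<in> coord_space (\<tau> ` I)"
      unfolding coord_space_def matrix_vector_mult_def by (auto intro!: sum.neutral)
  qed
qed (use assms in auto)

lemma image_mult: "(*v) (A ** B) ` S = (*v) A ` ((*v) B ` S)" for A B :: "complex^'n^'n"
  by (simp add: image_image flip: matrix_vector_mul_assoc)

text \<open>Writing \<open>Y\<inverse> X\<close> as \<open>b m b'\<close> by Bruhat makes the
  columns of \<open>Z = Y b\<close> a basis adapted to both flags, in which the first flag consists
  of coordinate spaces.\<close>

lemma flag_pair_normal_form:
  fixes X Y :: "complex^'n^'n"
  assumes X: "det X = 1" and Y: "det Y = 1"
  obtains Z and \<tau> :: "'n \<Rightarrow> 'n" where "det Z = 1" "bij \<tau>" "\<And>j. (*v) Z ` std j = (*v) Y ` std j"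
    "\<And>a. (*v) X ` std a = (*v) Z ` coord_space (\<tau> ` {i. idx i < a})"
proof -
  have "det (inv\<^bsub>SL\<^esub> Y ** X) = 1" by (simp add: det_mul SL_inv X Y)
  then obtain b m b' \<tau> where b: "b \<in> borel_std" "b' \<in> borel_std" "det m = 1" "bij \<tau>" "monomial \<tau> m"
    "inv\<^bsub>SL\<^esub> Y ** X = b ** m ** b'" by (rule Bruhat_decomposition)
  have b_std: "(*v) b ` std j = std j" "(*v) b' ` std j = std j" for j
    using b by (auto simp: borel_std_def intro!: upper_image_std)
  define Z where "Z = Y ** b"
  have "X = Y ** (inv\<^bsub>SL\<^esub> Y ** X)" by (simp add: SL_cancel Y)
  then have X_eq: "X = Y ** (b ** (m ** b'))" unfolding b(6) by (simp add: matrix_mul_rassoc)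
  have "(*v) X ` std a = (*v) Z ` coord_space (\<tau> ` {i. idx i < a})" for a
    unfolding X_eq Z_def image_mult b_std
    by (simp add: std_eq_coord_space[of a] monomial_image_coord_space[OF b(5,4)] b(3))
  moreover have "(*v) Z ` std j = (*v) Y ` std j" for j unfolding Z_def image_mult b_std ..
  moreover have "det Z = 1" using b(1) Y by (simp add: Z_def det_mul borel_std_def)
  ultimately show ?thesis using that[of Z \<tau>] b(4) by simp
qed

lemma card_bij_image_idx_less:
  assumes "bij (\<tau> :: 'n::finite \<Rightarrow> 'n)" "a \<le> CARD('n)"
  shows "card (\<tau> ` {i. idx i < a}) = a"
proof -
  have "inj_on \<tau> {i. idx i < a}" by (rule inj_on_subset[OF bij_is_inj[OF assms(1)] subset_UNIV])
  then show ?thesis using card_idx_less[OF assms(2)] by (simp add: card_image)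
qed

lemma pair_normal_form:
  fixes X Y :: "complex^'n^'n"
  assumes "det X = 1" "det Y = 1" and a: "a \<le> CARD('n)"
  obtains Z I where "det Z = 1" "card I = a" "\<And>j. (*v) Z ` std j = (*v) Y ` std j"
    "(*v) X ` std a = (*v) Z ` coord_space I"
proof -
  obtain Z and \<tau> :: "'n \<Rightarrow> 'n" where Z: "det Z = 1" "bij \<tau>" "\<And>j. (*v) Z ` std j = (*v) Y ` std j"
    "\<And>a. (*v) X ` std a = (*v) Z ` coord_space (\<tau> ` {i. idx i < a})"
    by (rule flag_pair_normal_form[OF assms(1,2)]) (blast intro: that)
  show ?thesis by (rule that[OF Z(1) card_bij_image_idx_less[OF Z(2) a] Z(3,4)])
qed

lemma matrix_image_Int:
  fixes Z :: "complex^'n^'n"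
  assumes "det Z \<noteq> 0"
  shows "(*v) Z ` S \<inter> (*v) Z ` T = (*v) Z ` (S \<inter> T)"
  using inj_matrix_of_det[OF assms] by (simp add: image_Int)

lemma dim_normal_form:
  fixes X Y Z :: "complex^'n^'n"
  assumes "det Z = 1" "\<And>j. (*v) Z ` std j = (*v) Y ` std j"
    "(*v) X ` std a = (*v) Z ` coord_space I"
  shows "vec.dim ((*v) X ` std a \<inter> (*v) Y ` std j) = count_below I j"
  unfolding assms(3) assms(2)[symmetric] using assms(1)
  by (simp add: matrix_image_Int dim_matrix_image coord_space_Int_std dim_coord_space count_below_def)

section \<open>Index sets as step functions\<close>

lemma count_below_Suc:
  fixes i :: "'n::finite"
  shows "count_below I (Suc (idx i)) = count_below I (idx i) + (if i \<in> I then 1 else 0)"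
proof -
  have "{l\<in>I. idx l < Suc (idx i)} = {l\<in>I. idx l < idx i} \<union> (if i \<in> I then {i} else {})"
    using less_Suc_eq[of _ "idx i"] by auto
  then show ?thesis by (auto simp: count_below_def card_insert_if)
qed

lemma count_below_card:
  fixes I :: "'n::finite set"
  shows "count_below I CARD('n) = card I"
  by (simp add: count_below_def)

text \<open>\<open>K\<close> collects the places where \<open>r\<close> jumps.\<close>

lemma count_below_of_step_function:
  fixes r :: "nat \<Rightarrow> nat"
  assumes r0: "r 0 = 0" and step: "\<And>j. j < CARD('n::finite) \<Longrightarrow> r (Suc j) = r j \<or> r (Suc j) = Suc (r j)"
  obtains K :: "'n::finite set" where "\<And>j. j \<le> CARD('n::finite) \<Longrightarrow> count_below K j = r j"
proof -
  define K :: "'n set" where "K = {i. r (Suc (idx i)) = Suc (r (idx i))}"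
  have "count_below K j = r j" if "j \<le> CARD('n)" for j
    using that
  proof (induction j)
    case 0
    show ?case by (simp add: count_below_def r0)
  next
    case (Suc j)
    then obtain i :: 'n where i: "idx i = j" using idx_surj[where 'n='n, of j] by auto
    show ?case using count_below_Suc[of K i] Suc step[of j] by (auto simp: K_def i)
  qed
  then show ?thesis by (rule that)
qed

lemma count_below_step:
  assumes "j < CARD('n::finite)"
  shows "count_below (I::'n::finite set) (Suc j) = count_below I j \<or> count_below I (Suc j) = Suc (count_below I j)"
proof -
  obtain i :: 'n where "idx i = j" using idx_surj[OF assms] by blast
  then show ?thesis using count_below_Suc[of I i] by auto
qed

text \<open>Increments in \<open>{0, 1}\<close> pass to the minimum. The resulting index set serves
  both for joins of orbit closures and for degenerations.\<close>

lemma count_below_min: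
  fixes I I' :: "'n::finite set"
  obtains K :: "'n set" where "\<And>j. j \<le> CARD('n) \<Longrightarrow> count_below K j = min (count_below I j) (count_below I' j)"
proof (rule count_below_of_step_function[of "\<lambda>j. min (count_below I j) (count_below I' j)"])
  fix j assume "j < CARD('n)"
  then show "min (count_below I (Suc j)) (count_below I' (Suc j)) = min (count_below I j) (count_below I' j) \<or>
      min (count_below I (Suc j)) (count_below I' (Suc j)) = Suc (min (count_below I j) (count_below I' j))"
    using count_below_step[of j I] count_below_step[of j I'] by linarith
next
  show "min (count_below I 0) (count_below I' 0) = 0" by (simp add: count_below_def)
next
  fix K :: "'n set"
  assume "\<And>j. j \<le> CARD('n) \<Longrightarrow> count_below K j = min (count_below I j) (count_below I' j)"
  then show thesis by (rule that)
qed

lemma count_below_max: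
  fixes I I' :: "'n::finite set"
  obtains K :: "'n set" where "\<And>j. j \<le> CARD('n) \<Longrightarrow> count_below K j = max (count_below I j) (count_below I' j)"
proof (rule count_below_of_step_function[of "\<lambda>j. max (count_below I j) (count_below I' j)"])
  fix j assume "j < CARD('n)"
  then show "max (count_below I (Suc j)) (count_below I' (Suc j)) = max (count_below I j) (count_below I' j) \<or>
      max (count_below I (Suc j)) (count_below I' (Suc j)) = Suc (max (count_below I j) (count_below I' j))"
    using count_below_step[of j I] count_below_step[of j I'] by linarith
next
  show "max (count_below I 0) (count_below I' 0) = 0" by (simp add: count_below_def)
next
  fix K :: "'n set"
  assume "\<And>j. j \<le> CARD('n) \<Longrightarrow> count_below K j = max (count_below I j) (count_below I' j)"
  then show thesis by (rule that)
qed

text \<open>The equivalence expresses that \<open>e\<close> is increasing, in a form that compares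
  positions in two index sets through their counts alone.\<close>

lemma increasing_enumeration:
  fixes I :: "'n::finite set"
  obtains e :: "nat \<Rightarrow> 'n" where "bij_betw e {..<card I} I"
    "\<And>k j. k < card I \<Longrightarrow> idx (e k) < j \<longleftrightarrow> k < count_below I j"
proof -
  let ?M = "idx ` I"
  have cM: "card ?M = card I" by (rule card_image) (rule inj_on_subset[OF inj_idx subset_UNIV])
  obtain h where h: "bij_betw h {..<card I} ?M" "strict_mono_on {..<card I} h"
    using ex_bij_betw_strict_mono_card[of ?M] cM by auto
  define e where "e k = inv_into I idx (h k)" for k
  have inj: "inj_on idx I" by (rule inj_on_subset[OF inj_idx subset_UNIV])
  have bij_e: "bij_betw e {..<card I} I"
  proof -
    have "bij_betw (inv_into I idx) ?M I" by (rule bij_betw_inv_into) (simp add: bij_betw_def inj)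
    from bij_betw_trans[OF h(1) this] show ?thesis by (simp add: e_def[abs_def] comp_def)
  qed
  have idx_e: "idx (e k) = h k" if "k < card I" for k
    unfolding e_def using that h(1) by (intro f_inv_into_f) (auto simp: bij_betw_def)
  have count: "count_below I j = card {k. k < card I \<and> h k < j}" for j
  proof -
    have "e k \<in> {i\<in>I. idx i < j}" if "k < card I" "h k < j" for k
      using that idx_e bij_betwE[OF bij_e] by simp
    moreover have "i \<in> e ` {k. k < card I \<and> h k < j}" if "i \<in> I" "idx i < j" for i
    proof -
      have "i \<in> e ` {..<card I}" using bij_e \<open>i \<in> I\<close> by (simp add: bij_betw_def)
      then show ?thesis using idx_e \<open>idx i < j\<close> by auto
    qed
    ultimately have "e ` {k. k < card I \<and> h k < j} = {i\<in>I. idx i < j}" by blast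
    then have "bij_betw e {k. k < card I \<and> h k < j} {i\<in>I. idx i < j}"
      by (intro bij_betw_subset[OF bij_e]) auto
    then show ?thesis unfolding count_below_def by (simp add: bij_betw_same_card)
  qed
  have "idx (e k) < j \<longleftrightarrow> k < count_below I j" if k: "k < card I" for k j
  proof
    assume "idx (e k) < j"
    then have "h k < j" using idx_e[OF k] by simp
    have "h k' < j" if "k' \<le> k" for k'
    proof (cases "k' = k")
      case False
      then have "h k' < h k" using strict_mono_onD[OF h(2), of k' k] that k by simp
      then show ?thesis using \<open>h k < j\<close> by simp
    qed (use \<open>h k < j\<close> in simp)
    then have "{..k} \<subseteq> {k. k < card I \<and> h k < j}" using k by auto
    then have "card {..k} \<le> card {k. k < card I \<and> h k < j}" by (intro card_mono) auto
    then show "k < count_below I j" by (simp add: count)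
  next
    assume *: "k < count_below I j"
    show "idx (e k) < j"
    proof (rule ccontr)
      assume "\<not> idx (e k) < j"
      then have "j \<le> h k" using idx_e[OF k] by simp
      have "k' < k" if "k' < card I" "h k' < j" for k'
      proof (rule ccontr)
        assume "\<not> k' < k"
        then have "h k \<le> h k'" using h(2) k that(1) by (cases "k = k'") (auto simp: strict_mono_on_def less_imp_le)
        then show False using that(2) \<open>j \<le> h k\<close> by simp
      qed
      then have "{k. k < card I \<and> h k < j} \<subseteq> {..<k}" by auto
      then have "card {k. k < card I \<and> h k < j} \<le> card {..<k}" by (intro card_mono) auto
      then show False using * by (simp add: count)
    qed
  qed
  then show ?thesis using that bij_e by blast
qed

text \<open>The \<open>k\<close>-th index of \<open>I\<close> is matched with the
  \<open>k\<close>-th index of \<open>I'\<close>; where the counts agree, both lie on the same side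
  of \<open>j\<close>.\<close>

lemma matching_bijection:
  fixes I I' :: "'n::finite set"
  assumes c: "card I = card I'"
  obtains f where "bij_betw f I I'"
    "\<And>i j. i \<in> I \<Longrightarrow> count_below I j = count_below I' j \<Longrightarrow> idx (f i) < j \<longleftrightarrow> idx i < j"
proof -
  obtain e where e: "bij_betw e {..<card I} I" "\<And>k j. k < card I \<Longrightarrow> idx (e k) < j \<longleftrightarrow> k < count_below I j"
    by (rule increasing_enumeration[of I]) (blast intro: that)
  obtain e' where e': "bij_betw e' {..<card I'} I'" "\<And>k j. k < card I' \<Longrightarrow> idx (e' k) < j \<longleftrightarrow> k < count_below I' j"
    by (rule increasing_enumeration[of I']) (blast intro: that)
  define f where "f = e' \<circ> inv_into {..<card I} e"
  have "bij_betw f I I'"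
    unfolding f_def by (rule bij_betw_trans[OF bij_betw_inv_into[OF e(1)]]) (simp add: c e'(1))
  moreover have "idx (f i) < j \<longleftrightarrow> idx i < j" if i: "i \<in> I" and eq: "count_below I j = count_below I' j" for i j
  proof -
    obtain k where k: "k < card I" "e k = i" using e(1) i by (force simp: bij_betw_def)
    then have "inv_into {..<card I} e i = k" using e(1) by (metis bij_betw_def inv_into_f_f lessThan_iff)
    then have "f i = e' k" by (simp add: f_def)
    then show ?thesis using e(2)[OF k(1), of j] e'(2)[of k j] k c eq by simp
  qed
  ultimately show ?thesis using that by blast
qed

lemma count_below_Compl:
  assumes "j \<le> CARD('n::finite)"
  shows "count_below (- I :: 'n::finite set) j = j - count_below I j"
proof -
  have "{i\<in>- I. idx i < j} = {i. idx i < j} - {i\<in>I. idx i < j}" by auto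
  then have "count_below (- I) j = card {i::'n. idx i < j} - card {i\<in>I. idx i < j}"
    unfolding count_below_def by (simp only:) (rule card_Diff_subset, auto)
  then show ?thesis using card_idx_less[OF assms] by (simp add: count_below_def)
qed

text \<open>\<open>I\<close> and its complement are matched separately; the counts of the
  complements agree on \<open>J\<close> as well.\<close>

lemma block_preserving_bijection:
  fixes I I' :: "'n::finite set"
  assumes c: "card I = card I'" and J: "J \<subseteq> {..CARD('n)}" "\<And>j. j \<in> J \<Longrightarrow> count_below I j = count_below I' j"
  obtains \<pi> where "bij \<pi>" "\<pi> ` I = I'" "\<And>i j. j \<in> J \<Longrightarrow> idx (\<pi> i) < j \<longleftrightarrow> idx i < j"
proof -
  obtain f where f: "bij_betw f I I'"
    "\<And>i j. i \<in> I \<Longrightarrow> count_below I j = count_below I' j \<Longrightarrow> idx (f i) < j \<longleftrightarrow> idx i < j"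
    using matching_bijection[OF c] by blast
  have c': "card (- I) = card (- I')" by (simp add: Compl_eq_Diff_UNIV card_Diff_subset c)
  obtain f' where f': "bij_betw f' (- I) (- I')"
    "\<And>i j. i \<in> - I \<Longrightarrow> count_below (- I) j = count_below (- I') j \<Longrightarrow> idx (f' i) < j \<longleftrightarrow> idx i < j"
    using matching_bijection[OF c'] by blast
  define \<pi> where "\<pi> i = (if i \<in> I then f i else f' i)" for i
  have "bij_betw \<pi> (I \<union> - I) (I' \<union> - I')"
    unfolding \<pi>_def by (rule bij_betw_disjoint_Un) (use f(1) f'(1) in auto)
  then have "bij \<pi>" by (simp add: Compl_partition)
  moreover have "\<pi> ` I = I'" using f(1) by (auto simp: \<pi>_def bij_betw_def)
  moreover have "idx (\<pi> i) < j \<longleftrightarrow> idx i < j" if "j \<in> J" for i j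
    using f(2)[of i j] f'(2)[of i j] J that count_below_Compl[of j I] count_below_Compl[of j I']
    by (auto simp: \<pi>_def)
  ultimately show ?thesis using that by blast
qed

text \<open>In adapted bases both pairs consist of coordinate spaces, and the monomial matrix of a
  permutation that carries \<open>I\<close> to \<open>I'\<close> within the blocks cut out by
  \<open>J\<close> moves one pair to the other.\<close>

lemma pair_orbit_of_equal_dims:
  fixes X Y X' Y' :: "complex^'n^'n"
  assumes det: "det X = 1" "det Y = 1" "det X' = 1" "det Y' = 1"
    and a: "a \<le> CARD('n)" and J: "J \<subseteq> {..CARD('n)}"
    and eq: "\<And>j. j \<in> J \<Longrightarrow> vec.dim ((*v) X ` std a \<inter> (*v) Y ` std j) = vec.dim ((*v) X' ` std a \<inter> (*v) Y' ` std j)"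
  obtains h where "det h = 1" "(*v) (h ** X) ` std a = (*v) X' ` std a"
    "\<And>j. j \<in> J \<Longrightarrow> (*v) (h ** Y) ` std j = (*v) Y' ` std j"
proof -
  obtain Z I where Z: "det Z = 1" "card I = a" "\<And>j. (*v) Z ` std j = (*v) Y ` std j"
    "(*v) X ` std a = (*v) Z ` coord_space I" by (rule pair_normal_form[OF det(1,2) a]) (blast intro: that)
  obtain Z' I' where Z': "det Z' = 1" "card I' = a" "\<And>j. (*v) Z' ` std j = (*v) Y' ` std j"
    "(*v) X' ` std a = (*v) Z' ` coord_space I'" by (rule pair_normal_form[OF det(3,4) a]) (blast intro: that)
  have "count_below I j = count_below I' j" if "j \<in> J" for j
    using eq[OF that] dim_normal_form[OF Z(1,3,4)] dim_normal_form[OF Z'(1,3,4)] by simp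
  then obtain \<pi> where \<pi>: "bij \<pi>" "\<pi> ` I = I'" "\<And>i j. j \<in> J \<Longrightarrow> idx (\<pi> i) < j \<longleftrightarrow> idx i < j"
    by (rule block_preserving_bijection[OF trans[OF Z(2) Z'(2)[symmetric]] J]) (blast intro: that)+
  obtain p where p: "det p = 1" "monomial \<pi> p" using monomial_exists[OF \<pi>(1)] by blast
  define h where "h = Z' ** p ** inv\<^bsub>SL\<^esub> Z"
  have hZ: "(*v) h ` ((*v) Z ` S) = (*v) Z' ` ((*v) p ` S)" for S
    by (simp add: h_def image_image SL_cancel Z(1) flip: matrix_vector_mul_assoc)
  have "det h = 1" by (simp add: h_def det_mul SL_inv p Z(1) Z'(1))
  moreover have "(*v) (h ** X) ` std a = (*v) X' ` std a"
    unfolding image_mult Z(4) Z'(4) hZ using monomial_image_coord_space[OF p(2) \<pi>(1)] p(1) \<pi>(2) by simp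
  moreover have "(*v) (h ** Y) ` std j = (*v) Y' ` std j" if j: "j \<in> J" for j
  proof -
    have "(*v) p ` std j \<subseteq> std j" using monomial_preserves_std[OF p(2)] \<pi>(3)[OF j] by blast
    then have "(*v) p ` std j = std j" by (subst matrix_image_eq_iff_subset) (use p(1) in auto)
    then show ?thesis unfolding image_mult Z(3)[symmetric] Z'(3)[symmetric] hZ by simp
  qed
  ultimately show ?thesis by (rule that)
qed

text \<open>For \<open>s\<close> in \<open>I\<close> the vector \<open>axis s 1\<close> moves
  towards \<open>axis (f s) 1\<close> with speed \<open>t\<close>. Fixed points of \<open>f\<close>
  are excluded so that the diagonal stays 1.\<close>

definition shear :: "'n set \<Rightarrow> ('n \<Rightarrow> 'n) \<Rightarrow> complex \<Rightarrow> complex^'n^'n" where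
  "shear I f t = (\<chi> r s. (if r = s then 1 else 0) + (if s \<in> I \<and> r = f s \<and> r \<noteq> s then t else 0))"

lemma shear_axis:
  assumes "s \<in> I"
  shows "shear I f t *v axis s 1 = (if f s = s then axis s 1 else axis s 1 + axis (f s) t)"
  using assms by (simp add: vec_eq_iff matrix_vector_mult_axis shear_def axis_nth_if)

lemma det_shear:
  fixes I :: "'n::finite set"
  assumes "\<And>s. s \<in> I \<Longrightarrow> idx s \<le> idx (f s)"
  shows "det (shear I f t) = 1"
proof -
  define e where "e k = CARD('n) - idx k" for k :: 'n
  have "inj e"
  proof (rule injI)
    fix a b assume "e a = e b"
    then have "idx a = idx b" using idx_less[of a] idx_less[of b] unfolding e_def by linarith
    then show "a = b" by simp
  qed
  moreover have "shear I f t $ r $ s = 0" if "e s < e r" for r s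
  proof -
    have "r \<noteq> s" "\<not> (s \<in> I \<and> r = f s)"
      using that assms[of s] by (auto simp: e_def)
    then show ?thesis by (auto simp: shear_def)
  qed
  ultimately have "det (shear I f t) = (\<Prod>k\<in>UNIV. shear I f t $ k $ k)" by (rule det_triangular)
  also have "\<dots> = 1" by (intro prod.neutral) (auto simp: shear_def)
  finally show ?thesis .
qed

text \<open>As soon as \<open>t\<close> is nonzero, the leading index of the image of
  \<open>axis s 1\<close> is \<open>f s\<close> instead of \<open>s\<close>. This gives all of
  \<open>K\<close>, and the dimension allows no further pivots.\<close>

lemma leads_shear:
  fixes I K :: "'n::finite set"
  assumes f: "bij_betw f I K" "\<And>s. s \<in> I \<Longrightarrow> idx s \<le> idx (f s)" and t: "t \<noteq> 0"
  shows "{i. leads ((*v) (shear I f t) ` coord_space I) i} = K"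
proof -
  let ?E = "(*v) (shear I f t) ` coord_space I"
  have "leads ?E k" if k: "k \<in> K" for k
  proof -
    obtain s where s: "s \<in> I" "k = f s" using f(1) k by (auto simp: bij_betw_def)
    have le: "idx s \<le> idx k" using f(2)[OF s(1)] s(2) by simp
    have "shear I f t *v axis s 1 \<in> ?E" using s(1) by (intro imageI axis_in_coord_space)
    moreover have "shear I f t *v axis s 1 \<in> std (Suc (idx k))"
      unfolding shear_axis[OF s(1)] using le s(2) by (auto intro!: std_add simp: axis_in_std)
    moreover have "(shear I f t *v axis s 1) $ k \<noteq> 0"
      unfolding shear_axis[OF s(1)] using t s(2) by (auto simp: axis_nth_if)
    ultimately show ?thesis unfolding leads_def by blast
  qed
  then have "K \<subseteq> {i. leads ?E i}" by auto
  moreover have "card {i. leads ?E i} = card K"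
  proof -
    have "card {i. leads ?E i} = vec.dim ?E" by (rule card_leads) (simp add: matrix_image_subspace)
    also have "\<dots> = card I" using det_shear[OF f(2)] by (simp add: dim_matrix_image dim_coord_space)
    finally show ?thesis using bij_betw_same_card[OF f(1)] by simp
  qed
  ultimately show ?thesis by (intro card_subset_eq[symmetric]) auto
qed

text \<open>Replacing the index set \<open>I\<close> of the first pair by the pointwise minimum \<open>K\<close> of the two step
  functions does not change the dimensions at \<open>J\<close>, and the increasing bijection from \<open>I'\<close> to \<open>K\<close> only
  moves indices up, so that a unipotent shear moves the second pair into the orbit of the first.\<close>

lemma pair_degeneration:
  fixes X Y X' Y' :: "complex^'n^'n"
  assumes det: "det X = 1" "det Y = 1" "det X' = 1" "det Y' = 1"
    and a: "a \<le> CARD('n)" and J: "J \<subseteq> {..CARD('n)}"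
    and le: "\<And>j. j \<in> J \<Longrightarrow> vec.dim ((*v) X ` std a \<inter> (*v) Y ` std j) \<le> vec.dim ((*v) X' ` std a \<inter> (*v) Y' ` std j)"
  obtains g where "g 0 = mat 1" "\<And>i j. \<exists>p. \<forall>t. g t $ i $ j = poly p t" "\<And>t. det (g t) = 1"
    "\<And>t. t \<noteq> 0 \<Longrightarrow> \<exists>h. det h = 1 \<and> (*v) (h ** X) ` std a = (*v) (g t ** X') ` std a \<and>
       (\<forall>j\<in>J. (*v) (h ** Y) ` std j = (*v) Y' ` std j)"
proof -
  obtain Z I where Z: "det Z = 1" "card I = a" "\<And>j. (*v) Z ` std j = (*v) Y ` std j"
    "(*v) X ` std a = (*v) Z ` coord_space I" by (rule pair_normal_form[OF det(1,2) a]) (blast intro: that)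
  obtain Z' I' where Z': "det Z' = 1" "card I' = a" "\<And>j. (*v) Z' ` std j = (*v) Y' ` std j"
    "(*v) X' ` std a = (*v) Z' ` coord_space I'" by (rule pair_normal_form[OF det(3,4) a]) (blast intro: that)
  obtain K :: "'n set" where K: "\<And>j. j \<le> CARD('n) \<Longrightarrow> count_below K j = min (count_below I j) (count_below I' j)"
    by (rule count_below_min[of I I']) (blast intro: that)
  have cK: "card K = a" using K[of "CARD('n)"] Z(2) Z'(2) by (simp add: count_below_card)
  have KJ: "count_below K j = count_below I j" if "j \<in> J" for j
  proof -
    have "count_below I j \<le> count_below I' j"
      using le[OF that] dim_normal_form[OF Z(1,3,4)] dim_normal_form[OF Z'(1,3,4)] by simp
    then show ?thesis using K[of j] J that by auto
  qed
  obtain e where e: "bij_betw e {..<card I'} I'" "\<And>k j. k < card I' \<Longrightarrow> idx (e k) < j \<longleftrightarrow> k < count_below I' j"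
    by (rule increasing_enumeration[of I']) (blast intro: that)
  obtain e' where e': "bij_betw e' {..<card K} K" "\<And>k j. k < card K \<Longrightarrow> idx (e' k) < j \<longleftrightarrow> k < count_below K j"
    by (rule increasing_enumeration[of K]) (blast intro: that)
  define f where "f = e' \<circ> inv_into {..<card I'} e"
  have f: "bij_betw f I' K"
    unfolding f_def by (rule bij_betw_trans[OF bij_betw_inv_into[OF e(1)]]) (simp add: cK Z'(2) e'(1)[unfolded cK])
  have f_le: "idx s \<le> idx (f s)" if s: "s \<in> I'" for s
  proof -
    obtain k where k: "k < card I'" "e k = s" using e(1) s by (force simp: bij_betw_def)
    then have "inv_into {..<card I'} e s = k" using e(1) by (metis bij_betw_def inv_into_f_f lessThan_iff)
    then have fs: "f s = e' k" by (simp add: f_def)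
    have "k < card K" using k cK Z'(2) by simp
    then have "k < count_below K (Suc (idx (f s)))" using e'(2)[of k "Suc (idx (f s))"] fs by simp
    \<comment> \<open>\<open>K\<close> has no more indices below any bound than \<open>I'\<close>,
      so its \<open>k\<close>-th index comes no earlier than that of \<open>I'\<close>.\<close>
    then have "k < count_below I' (Suc (idx (f s)))" using K[of "Suc (idx (f s))"] by (simp add: Suc_leI)
    then show ?thesis using e(2)[OF k(1), of "Suc (idx (f s))"] k(2) by simp
  qed
  define g where "g t = Z' ** shear I' f t ** inv\<^bsub>SL\<^esub> Z'" for t
  have det_g: "det (g t) = 1" for t by (simp add: g_def det_mul SL_inv Z'(1) det_shear[OF f_le])
  have gX: "(*v) (g t ** X') ` std a = (*v) Z' ` ((*v) (shear I' f t) ` coord_space I')" for t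
    unfolding image_mult Z'(4) by (simp add: g_def image_image SL_cancel Z'(1) flip: matrix_vector_mul_assoc)
  show ?thesis
  proof (rule that[of g])
    have "shear I' f 0 = mat 1" by (simp add: shear_def mat_def vec_eq_iff)
    then show "g 0 = mat 1" by (simp add: g_def SL_inv Z'(1))
  next
    fix i j
    have "(\<lambda>A. (Z' ** A ** inv\<^bsub>SL\<^esub> Z') $ i $ j) \<in> poly_funs mat_coords"
      by (intro poly_funs_matrix_mult poly_funs.const poly_funs_mat_coord)
    then have "\<exists>p. \<forall>t. (Z' ** shear I' f t ** inv\<^bsub>SL\<^esub> Z') $ i $ j = poly p t"
    proof (rule poly_funs_poly_curve)
      fix c assume "c \<in> (mat_coords :: (complex^'n^'n \<Rightarrow> complex) set)"
      then obtain r s where "c = (\<lambda>A. A $ r $ s)" by (auto simp: mat_coords_def)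
      then have "c (shear I' f t) = poly [:if r = s then 1 else 0, if s \<in> I' \<and> r = f s \<and> r \<noteq> s then 1 else 0:] t" for t
        by (auto simp: shear_def)
      then show "\<exists>p. \<forall>t. c (shear I' f t) = poly p t" by blast
    qed
    then show "\<exists>p. \<forall>t. g t $ i $ j = poly p t" by (simp add: g_def)
  next
    fix t :: complex assume t: "t \<noteq> 0"
    have gdim: "vec.dim ((*v) (g t ** X') ` std a \<inter> (*v) Y' ` std j) = count_below K j" if j: "j \<le> CARD('n)" for j
    proof -
      let ?E = "(*v) (shear I' f t) ` coord_space I'"
      have "vec.dim ((*v) (g t ** X') ` std a \<inter> (*v) Y' ` std j) = vec.dim (?E \<inter> std j)"
        unfolding gX Z'(3)[symmetric] using Z'(1) by (simp add: matrix_image_Int dim_matrix_image)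
      also have "\<dots> = card {i. idx i < j \<and> leads ?E i}"
        by (rule dim_eq_card_leads[OF matrix_image_subspace j]) simp
      also have "{i. idx i < j \<and> leads ?E i} = {i\<in>K. idx i < j}"
        using leads_shear[OF f f_le t] by auto
      finally show ?thesis by (simp add: count_below_def)
    qed
    have "det (g t ** X') = 1" by (simp add: det_mul det_g det)
    moreover have "vec.dim ((*v) X ` std a \<inter> (*v) Y ` std j) = vec.dim ((*v) (g t ** X') ` std a \<inter> (*v) Y' ` std j)"
      if "j \<in> J" for j
      using gdim[of j] dim_normal_form[OF Z(1,3,4)] KJ[OF that] J that by auto
    ultimately obtain h where "det h = 1" "(*v) (h ** X) ` std a = (*v) (g t ** X') ` std a"
      "\<And>j. j \<in> J \<Longrightarrow> (*v) (h ** Y) ` std j = (*v) Y' ` std j"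
      using pair_orbit_of_equal_dims[OF det(1,2) _ det(4) a J, of "g t ** X'"] by blast
    then show "\<exists>h. det h = 1 \<and> (*v) (h ** X) ` std a = (*v) (g t ** X') ` std a \<and>
       (\<forall>j\<in>J. (*v) (h ** Y) ` std j = (*v) Y' ` std j)" by blast
  qed (rule det_g)
qed

text \<open>Realises by actual pairs the step functions that arise as minimum and maximum.\<close>

lemma pair_with_counts:
  fixes I :: "'n::finite set"
  assumes "card I = a"
  obtains X :: "complex^'n^'n" where "det X = 1"
    "\<And>j. vec.dim ((*v) X ` std a \<inter> std j) = count_below I j"
proof -
  have a: "a \<le> CARD('n)" using assms card_mono[of UNIV I] by auto
  obtain \<pi> where \<pi>: "bij \<pi>" "\<pi> ` {i::'n. idx i < a} = I"
    using block_preserving_bijection[of "{i::'n. idx i < a}" I "{}"] card_idx_less[OF a] assms by auto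
  obtain p where p: "det p = 1" "monomial \<pi> p" using monomial_exists[OF \<pi>(1)] by blast
  have "(*v) p ` std a = coord_space I"
    using monomial_image_coord_space[OF p(2) \<pi>(1)] p(1) \<pi>(2) by (simp add: std_eq_coord_space)
  then have "vec.dim ((*v) p ` std a \<inter> std j) = count_below I j" for j
    by (simp add: coord_space_Int_std dim_coord_space count_below_def)
  then show ?thesis using that p(1) by blast
qed

section \<open>Orbit closures in the double flag variety\<close>

abbreviation SL_pairs :: "((complex^'n^'n) \<times> (complex^'n^'n)) topology" where
  "SL_pairs \<equiv> subtopology (zariski mat_pair_coords) (carrier SL \<times> carrier SL)"

definition proj :: "(complex^'n^'n) set \<Rightarrow> (complex^'n^'n) set \<Rightarrow> complex^'n^'n \<Rightarrow> complex^'n^'n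
    \<Rightarrow> (complex^'n^'n) set \<times> (complex^'n^'n) set" where
  "proj P Q x y = (l_coset SL x P, l_coset SL y Q)"

lemma openin_double_flag:
  "openin (double_flag_topology P Q) U \<longleftrightarrow>
     U \<subseteq> double_flag P Q \<and> openin SL_pairs {z \<in> carrier SL \<times> carrier SL. proj P Q (fst z) (snd z) \<in> U}"
proof -
  have "(\<lambda>(x, y). (l_coset SL x P, l_coset SL y Q)) = (\<lambda>z. proj P Q (fst z) (snd z))"
    by (auto simp: proj_def)
  then show ?thesis
    using topspace_double_flag_topology[of P Q]
    by (simp add: double_flag_topology_def openin_quotient_topology)
qed

lemma double_flag_iff: "w \<in> double_flag P Q \<longleftrightarrow> (\<exists>x y. det x = 1 \<and> det y = 1 \<and> w = proj P Q x y)"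
  by (auto simp: double_flag_def LCOSETS_def proj_def) blast

lemma orbit_proj:
  "orbit (SL\<lparr>carrier := H\<rparr>) diag_act (proj P Q x y) = {proj P Q (g ** x) (g ** y) | g. g \<in> H}"
  by (simp add: orbit_def proj_def diag_act_cosets)

lemma orbit_SL_proj:
  "orbit SL diag_act (proj P Q x y) = {proj P Q (g ** x) (g ** y) | g. det g = 1}"
  by (simp add: orbit_def proj_def diag_act_cosets)

section \<open>Cosets as flags, and the lattice of orbit closures from a rank function\<close>

lemma l_coset_eq_iff:
  fixes P :: "(complex^'n^'n) set"
  assumes P: "subgroup P SL" and "det x = 1" "det x' = 1"
  shows "l_coset SL x P = l_coset SL x' P \<longleftrightarrow> inv\<^bsub>SL\<^esub> x ** x' \<in> P"
proof
  assume eq: "l_coset SL x P = l_coset SL x' P"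
  have "x' \<in> l_coset SL x' P"
    unfolding l_coset_def using subgroup.one_closed[OF P] by (auto intro!: bexI[of _ "mat 1"])
  then have "x' \<in> l_coset SL x P" by (simp add: eq)
  then obtain p where "p \<in> P" "x' = x ** p" by (auto simp: l_coset_def)
  then show "inv\<^bsub>SL\<^esub> x ** x' \<in> P" using assms by (simp add: SL_cancel)
next
  assume p: "inv\<^bsub>SL\<^esub> x ** x' \<in> P"
  define p where "p = inv\<^bsub>SL\<^esub> x ** x'"
  have x': "x' = x ** p" using assms by (simp add: p_def SL_cancel)
  have "p \<in> P" using p by (simp add: p_def)
  have dp: "det p = 1" using subgroup.mem_carrier[OF P \<open>p \<in> P\<close>] by simp
  show "l_coset SL x P = l_coset SL x' P"
  proof (intro subset_antisym subsetI)
    fix w assume "w \<in> l_coset SL x P"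
    then obtain q where q: "q \<in> P" "w = x ** q" by (auto simp: l_coset_def)
    have "w = x' ** (inv\<^bsub>SL\<^esub> p ** q)" using q dp by (simp add: x' matrix_mul_rassoc SL_cancel)
    moreover have "inv\<^bsub>SL\<^esub> p ** q \<in> P"
      using subgroup.m_closed[OF P subgroup.m_inv_closed[OF P \<open>p \<in> P\<close>] q(1)] by simp
    ultimately show "w \<in> l_coset SL x' P" by (auto simp: l_coset_def)
  next
    fix w assume "w \<in> l_coset SL x' P"
    then obtain q where q: "q \<in> P" "w = x' ** q" by (auto simp: l_coset_def)
    have "w = x ** (p ** q)" using q by (simp add: x' matrix_mul_rassoc)
    moreover have "p ** q \<in> P" using subgroup.m_closed[OF P \<open>p \<in> P\<close> q(1)] by simp
    ultimately show "w \<in> l_coset SL x P" by (auto simp: l_coset_def)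
  qed
qed

text \<open>Identifies the coset of \<open>x\<close> with the partial flag whose steps are the
  images of \<open>std k\<close> under \<open>x W\<close>.\<close>

lemma l_coset_flag_stabilizer:
  fixes W :: "complex^'n^'n"
  assumes "subgroup (flag_stabilizer W J) SL" and x: "det x = 1" "det x' = 1"
  shows "l_coset SL x (flag_stabilizer W J) = l_coset SL x' (flag_stabilizer W J) \<longleftrightarrow>
    (\<forall>k\<in>J. (*v) (x ** W) ` std k = (*v) (x' ** W) ` std k)"
proof -
  have "(*v) (inv\<^bsub>SL\<^esub> x ** x' ** W) ` std k = (*v) W ` std k \<longleftrightarrow> (*v) (x' ** W) ` std k = (*v) (x ** W) ` std k" for k
  proof
    assume "(*v) (inv\<^bsub>SL\<^esub> x ** x' ** W) ` std k = (*v) W ` std k"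
    then have "(*v) x ` ((*v) (inv\<^bsub>SL\<^esub> x ** x' ** W) ` std k) = (*v) x ` ((*v) W ` std k)" by simp
    then show "(*v) (x' ** W) ` std k = (*v) (x ** W) ` std k"
      by (simp add: image_image SL_cancel x flip: matrix_vector_mul_assoc)
  next
    assume "(*v) (x' ** W) ` std k = (*v) (x ** W) ` std k"
    then have "(*v) (inv\<^bsub>SL\<^esub> x) ` ((*v) (x' ** W) ` std k) = (*v) (inv\<^bsub>SL\<^esub> x) ` ((*v) (x ** W) ` std k)" by simp
    then show "(*v) (inv\<^bsub>SL\<^esub> x ** x' ** W) ` std k = (*v) W ` std k"
      by (simp add: image_image SL_cancel x flip: matrix_vector_mul_assoc)
  qed
  then show ?thesis
    unfolding l_coset_eq_iff[OF assms]
    using x by (simp add: flag_stabilizer_def det_mul SL_inv eq_commute[of "(*v) (x' ** W) ` _"])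
qed

text \<open>Stated for an abstract rank function so as to serve both factors. Openness of the
  sublevel sets bounds the closure of an orbit, degeneration along curves fills it, and so inclusion
  of closures is the reversed pointwise order of ranks.\<close>

lemma lattice_of_rank_function:
  fixes r :: "complex^'n^'n \<Rightarrow> complex^'n^'n \<Rightarrow> nat \<Rightarrow> nat"
  assumes inv: "\<And>x y x' y' g j. det x = 1 \<Longrightarrow> det y = 1 \<Longrightarrow> det x' = 1 \<Longrightarrow> det y' = 1 \<Longrightarrow> det g = 1 \<Longrightarrow> j \<in> J
      \<Longrightarrow> proj P Q x' y' = proj P Q (g ** x) (g ** y) \<Longrightarrow> r x' y' j = r x y j"
    and op: "\<And>j c. j \<in> J \<Longrightarrow> openin SL_pairs {z \<in> carrier SL \<times> carrier SL. r (fst z) (snd z) j \<le> c}"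
    and degen: "\<And>x y x' y'. det x = 1 \<Longrightarrow> det y = 1 \<Longrightarrow> det x' = 1 \<Longrightarrow> det y' = 1 \<Longrightarrow> (\<forall>j\<in>J. r x y j \<le> r x' y' j)
      \<Longrightarrow> \<exists>\<phi>. \<phi> 0 = (x', y') \<and> (\<forall>i j. \<exists>p. \<forall>t. fst (\<phi> t) $ i $ j = poly p t)
        \<and> (\<forall>i j. \<exists>p. \<forall>t. snd (\<phi> t) $ i $ j = poly p t) \<and> (\<forall>t. det (fst (\<phi> t)) = 1 \<and> det (snd (\<phi> t)) = 1)
        \<and> (\<forall>t. t \<noteq> 0 \<longrightarrow> (\<exists>g. det g = 1 \<and> proj P Q (fst (\<phi> t)) (snd (\<phi> t)) = proj P Q (g ** x) (g ** y)))"
    and mn: "\<And>x y x' y'. det x = 1 \<Longrightarrow> det y = 1 \<Longrightarrow> det x' = 1 \<Longrightarrow> det y' = 1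
      \<Longrightarrow> \<exists>u v. det u = 1 \<and> det v = 1 \<and> (\<forall>j\<in>J. r u v j = min (r x y j) (r x' y' j))"
    and mx: "\<And>x y x' y'. det x = 1 \<Longrightarrow> det y = 1 \<Longrightarrow> det x' = 1 \<Longrightarrow> det y' = 1
      \<Longrightarrow> \<exists>u v. det u = 1 \<and> det v = 1 \<and> (\<forall>j\<in>J. r u v j = max (r x y j) (r x' y' j))"
  shows "lattice \<lparr>carrier = orbit_closures P Q, eq = (=), le = (\<subseteq>)\<rparr>"
proof -
  let ?T = "double_flag_topology P Q"
  let ?L = "\<lparr>carrier = orbit_closures P Q, eq = (=), le = (\<subseteq>)\<rparr>"
  define Cl where "Cl x y = ?T closure_of (orbit SL diag_act (proj P Q x y))" for x y
  have mem: "proj P Q x' y' \<in> Cl x y \<longleftrightarrow> (\<forall>j\<in>J. r x y j \<le> r x' y' j)"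
    if det: "det x = 1" "det y = 1" "det x' = 1" "det y' = 1" for x y x' y'
  proof
    assume cl: "proj P Q x' y' \<in> Cl x y"
    show "\<forall>j\<in>J. r x y j \<le> r x' y' j"
    proof (rule ballI, rule ccontr)
      fix j assume j: "j \<in> J" and "\<not> r x y j \<le> r x' y' j"
      then have lt: "r x' y' j < r x y j" by simp
      define V where "V = {z \<in> carrier SL \<times> carrier SL. r (fst z) (snd z) j \<le> r x' y' j}"
      \<comment> \<open>Openness in the quotient concerns the full preimage; invariance of the rank
        shows that the preimage of \<open>U\<close> is again \<open>V\<close>.\<close>
      define U where "U = (\<lambda>z. proj P Q (fst z) (snd z)) ` V"
      have satur: "z \<in> V" if z: "z \<in> carrier SL \<times> carrier SL" "proj P Q (fst z) (snd z) \<in> U" for z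
      proof -
        obtain z' where z': "z' \<in> V" "proj P Q (fst z) (snd z) = proj P Q (fst z') (snd z')"
          using z(2) by (auto simp: U_def)
        then have "r (fst z) (snd z) j = r (fst z') (snd z') j"
          using inv[of "fst z'" "snd z'" "fst z" "snd z" "mat 1" j] z(1) j by (auto simp: V_def)
        then show ?thesis using z(1) z'(1) by (simp add: V_def)
      qed
      then have "{z \<in> carrier SL \<times> carrier SL. proj P Q (fst z) (snd z) \<in> U} = V"
        by (auto simp: U_def V_def)
      moreover have "U \<subseteq> double_flag P Q"
        unfolding U_def V_def by (rule image_subsetI, unfold double_flag_iff) force
      ultimately have "openin ?T U"
        unfolding openin_double_flag using op[OF j, of "r x' y' j"] by (simp add: V_def)
      moreover have "proj P Q x' y' \<in> U" unfolding U_def V_def using det by (force intro!: image_eqI[of _ _ "(x', y')"])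
      ultimately obtain w where w: "w \<in> orbit SL diag_act (proj P Q x y)" "w \<in> U"
        using cl unfolding Cl_def in_closure_of by blast
      then obtain g where g: "det g = 1" "w = proj P Q (g ** x) (g ** y)" unfolding orbit_SL_proj by blast
      then have "(g ** x, g ** y) \<in> V" using satur[of "(g ** x, g ** y)"] w(2) det by (simp add: det_mul)
      then have "r (g ** x) (g ** y) j \<le> r x' y' j" by (simp add: V_def)
      moreover have "r (g ** x) (g ** y) j = r x y j" using inv[of x y "g ** x" "g ** y" g j] det g j by (simp add: det_mul)
      ultimately show False using lt by simp
    qed
  next
    assume le: "\<forall>j\<in>J. r x y j \<le> r x' y' j"
    obtain \<phi> where \<phi>: "\<phi> 0 = (x', y')" "\<forall>i j. \<exists>p. \<forall>t. fst (\<phi> t) $ i $ j = poly p t"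
        "\<forall>i j. \<exists>p. \<forall>t. snd (\<phi> t) $ i $ j = poly p t" "\<forall>t. det (fst (\<phi> t)) = 1 \<and> det (snd (\<phi> t)) = 1"
        "\<forall>t. t \<noteq> 0 \<longrightarrow> (\<exists>g. det g = 1 \<and> proj P Q (fst (\<phi> t)) (snd (\<phi> t)) = proj P Q (g ** x) (g ** y))"
      using degen[OF det le] by blast
    show "proj P Q x' y' \<in> Cl x y"
      unfolding Cl_def in_closure_of topspace_double_flag_topology
    proof (intro conjI allI impI)
      show "proj P Q x' y' \<in> double_flag P Q" using det by (auto simp: double_flag_iff)
      fix U assume U: "proj P Q x' y' \<in> U \<and> openin ?T U"
      have "(x', y') \<in> {z \<in> carrier SL \<times> carrier SL. proj P Q (fst z) (snd z) \<in> U}" using U det by simp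
      then obtain f where f: "f \<in> poly_funs mat_pair_coords" "f (x', y') \<noteq> 0"
        "{z \<in> carrier SL \<times> carrier SL. f z \<noteq> 0} \<subseteq> {z \<in> carrier SL \<times> carrier SL. proj P Q (fst z) (snd z) \<in> U}"
        using U unfolding openin_double_flag openin_subtopology_zariski by blast
      have "\<exists>p. \<forall>t. f (\<phi> t) = poly p t"
      proof (rule poly_funs_poly_curve[OF f(1)])
        fix c assume "c \<in> (mat_pair_coords :: ((complex^'n^'n) \<times> (complex^'n^'n) \<Rightarrow> complex) set)"
        then consider i j where "c = (\<lambda>z. fst z $ i $ j)" | i j where "c = (\<lambda>z. snd z $ i $ j)"
          by (auto simp: mat_pair_coords_def mat_coords_def comp_def)
        then show "\<exists>p. \<forall>t. c (\<phi> t) = poly p t" by cases (use \<phi>(2,3) in auto)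
      qed
      then obtain p where p: "\<And>t. f (\<phi> t) = poly p t" by blast
      have "poly p 0 \<noteq> 0" using p[of 0] \<phi>(1) f(2) by simp
      then have "p \<noteq> 0" by auto
      then have "finite (insert 0 {t. poly p t = 0})" by (simp add: poly_roots_finite)
      \<comment> \<open>At a nonzero parameter where \<open>f\<close> does not vanish, the curve is
        already in the orbit of \<open>(x, y)\<close> and still in \<open>U\<close>.\<close>
      then obtain t where t: "t \<notin> insert 0 {t. poly p t = 0}"
        using ex_new_if_finite[OF infinite_UNIV_char_0] by blast
      then have "\<phi> t \<in> {z \<in> carrier SL \<times> carrier SL. f z \<noteq> 0}"
        using \<phi>(4) p by (simp add: mem_Times_iff)
      from subsetD[OF f(3) this] have "proj P Q (fst (\<phi> t)) (snd (\<phi> t)) \<in> U" by simp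
      moreover have "t \<noteq> 0" using t by simp
      with \<phi>(5) obtain g where "det g = 1" "proj P Q (fst (\<phi> t)) (snd (\<phi> t)) = proj P Q (g ** x) (g ** y)"
        by blast
      ultimately show "\<exists>w. w \<in> orbit SL diag_act (proj P Q x y) \<and> w \<in> U"
        unfolding orbit_SL_proj
        by (intro exI[of _ "proj P Q (g ** x) (g ** y)"] conjI CollectI exI[of _ g]) simp_all
    qed
  qed
  have sub_iff: "Cl x' y' \<subseteq> Cl x y \<longleftrightarrow> (\<forall>j\<in>J. r x y j \<le> r x' y' j)"
    if det: "det x = 1" "det y = 1" "det x' = 1" "det y' = 1" for x y x' y'
  proof
    assume "Cl x' y' \<subseteq> Cl x y"
    then show "\<forall>j\<in>J. r x y j \<le> r x' y' j" using mem[OF det(3,4,3,4)] mem[OF det] by blast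
  next
    assume le: "\<forall>j\<in>J. r x y j \<le> r x' y' j"
    show "Cl x' y' \<subseteq> Cl x y"
    proof
      fix w assume w: "w \<in> Cl x' y'"
      then have "w \<in> double_flag P Q"
        using subsetD[OF closure_of_subset_topspace, of w ?T] unfolding Cl_def topspace_double_flag_topology
        by simp
      then obtain u v where uv: "det u = 1" "det v = 1" "w = proj P Q u v" by (auto simp: double_flag_iff)
      then have "\<forall>j\<in>J. r x' y' j \<le> r u v j" using w mem[OF det(3,4) uv(1,2)] by simp
      then have "\<forall>j\<in>J. r x y j \<le> r u v j" using le order_trans by blast
      then show "w \<in> Cl x y" using mem[OF det(1,2) uv(1,2)] uv(3) by simp
    qed
  qed
  have car: "A \<in> orbit_closures P Q \<longleftrightarrow> (\<exists>x y. det x = 1 \<and> det y = 1 \<and> A = Cl x y)" for A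
  proof
    assume "A \<in> orbit_closures P Q"
    then obtain w where w: "w \<in> double_flag P Q" "A = ?T closure_of (orbit SL diag_act w)"
      unfolding orbit_closures_def orbits_def by blast
    then obtain x y where "det x = 1" "det y = 1" "w = proj P Q x y" by (auto simp: double_flag_iff)
    then show "\<exists>x y. det x = 1 \<and> det y = 1 \<and> A = Cl x y" using w(2) by (auto simp: Cl_def)
  next
    assume "\<exists>x y. det x = 1 \<and> det y = 1 \<and> A = Cl x y"
    then obtain x y where xy: "det x = 1" "det y = 1" "A = Cl x y" by blast
    then have "proj P Q x y \<in> double_flag P Q" by (auto simp: double_flag_iff)
    then have "orbit SL diag_act (proj P Q x y) \<in> orbits SL (double_flag P Q) diag_act"
      unfolding orbits_def by blast
    then show "A \<in> orbit_closures P Q" unfolding orbit_closures_def xy(3) Cl_def by (rule imageI)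
  qed
  show ?thesis
  proof unfold_locales
    fix A B assume "A \<in> carrier ?L" "B \<in> carrier ?L"
    then have AB: "A \<in> orbit_closures P Q" "B \<in> orbit_closures P Q" by simp_all
    obtain x y where A: "det x = 1" "det y = 1" "A = Cl x y" using AB(1) unfolding car by blast
    obtain x' y' where B: "det x' = 1" "det y' = 1" "B = Cl x' y'" using AB(2) unfolding car by blast
    show "\<exists>s. least ?L s (Upper ?L {A, B})"
    proof -
      \<comment> \<open>Small ranks have large closures, so the pointwise minimum is the join and,
        below, the pointwise maximum the meet.\<close>
      obtain u v where uv: "det u = 1" "det v = 1" "\<forall>j\<in>J. r u v j = min (r x y j) (r x' y' j)"
        using mn[OF A(1,2) B(1,2)] by blast
      have C: "Cl u v \<in> orbit_closures P Q" using uv(1,2) car by blast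
      have ub: "A \<subseteq> Cl u v" "B \<subseteq> Cl u v"
        unfolding A(3) B(3) using uv A(1,2) B(1,2) by (simp_all add: sub_iff)
      have "Cl u v \<subseteq> D" if D: "D \<in> orbit_closures P Q" "A \<subseteq> D" "B \<subseteq> D" for D
      proof -
        obtain p q where pq: "det p = 1" "det q = 1" "D = Cl p q" using D(1) unfolding car by blast
        then show ?thesis using D(2,3) uv A B by (simp add: sub_iff)
      qed
      then have "least ?L (Cl u v) (Upper ?L {A, B})"
        unfolding least_def Upper_def using C ub AB by simp
      then show ?thesis by (rule exI)
    qed
    show "\<exists>s. greatest ?L s (Lower ?L {A, B})"
    proof -
      obtain u v where uv: "det u = 1" "det v = 1" "\<forall>j\<in>J. r u v j = max (r x y j) (r x' y' j)"
        using mx[OF A(1,2) B(1,2)] by blast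
      have C: "Cl u v \<in> orbit_closures P Q" using uv(1,2) car by blast
      have lb: "Cl u v \<subseteq> A" "Cl u v \<subseteq> B"
        unfolding A(3) B(3) using uv A(1,2) B(1,2) by (simp_all add: sub_iff)
      have "D \<subseteq> Cl u v" if D: "D \<in> orbit_closures P Q" "D \<subseteq> A" "D \<subseteq> B" for D
      proof -
        obtain p q where pq: "det p = 1" "det q = 1" "D = Cl p q" using D(1) unfolding car by blast
        then show ?thesis using D(2,3) uv A B by (simp add: sub_iff)
      qed
      then have "greatest ?L (Cl u v) (Lower ?L {A, B})"
        unfolding greatest_def Lower_def using C lb AB by simp
      then show ?thesis by (rule exI)
    qed
  qed auto
qed

text \<open>A basis of the sum of the two subspaces stays independent wherever one determinant is
  nonzero. So the dimension of the sum does not drop near a given point, and that of the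
  intersection does not grow.\<close>

lemma open_dim_Int_le:
  fixes W W' :: "complex^'n^'n"
  assumes W: "det W = 1" "det W' = 1" and ak: "a \<le> CARD('n)" "k \<le> CARD('n)"
  shows "openin SL_pairs {z \<in> carrier SL \<times> carrier SL.
    vec.dim ((*v) (fst z ** W) ` std a \<inter> (*v) (snd z ** W') ` std k) \<le> c}"
  unfolding openin_subtopology_zariski
proof (intro conjI ballI)
  fix z0 assume z0: "z0 \<in> {z \<in> carrier SL \<times> carrier SL.
    vec.dim ((*v) (fst z ** W) ` std a \<inter> (*v) (snd z ** W') ` std k) \<le> c}"
  define u0 v0 where "u0 = fst z0" and "v0 = snd z0"
  have det0: "det u0 = 1" "det v0 = 1" using z0 by (auto simp: u0_def v0_def)
  have dets: "det (u0 ** W) = 1" "det (v0 ** W') = 1" by (simp_all add: det_mul det0 W)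
  obtain Z I where Z: "det Z = 1" "card I = a" "\<And>j. (*v) Z ` std j = (*v) (v0 ** W') ` std j"
    "(*v) (u0 ** W) ` std a = (*v) Z ` coord_space I" by (rule pair_normal_form[OF dets ak(1)]) (blast intro: that)
  have count: "count_below I k \<le> c" using z0 dim_normal_form[OF Z(1,3,4), of k] by (simp add: u0_def v0_def)
  \<comment> \<open>At \<open>z0\<close> this is the adapted basis \<open>Z\<close>. The columns in
    \<open>I\<close> follow the first subspace, the others with index below \<open>k\<close> the
    second, and the rest only completes the basis.\<close>
  define M where "M z = (\<chi> r i. if i \<in> I then (fst z ** (inv\<^bsub>SL\<^esub> u0 ** Z)) $ r $ i
    else if idx i < k then (snd z ** (inv\<^bsub>SL\<^esub> v0 ** Z)) $ r $ i else Z $ r $ i)" for z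
  define f where "f z = det (M z)" for z
  have "f \<in> poly_funs mat_pair_coords"
    unfolding f_def
  proof (rule poly_funs_det)
    fix r i
    have 1: "(\<lambda>z. (fst z ** (inv\<^bsub>SL\<^esub> u0 ** Z)) $ r $ i) \<in> poly_funs mat_pair_coords"
      by (rule poly_funs_matrix_mult) (auto intro: poly_funs_fst_coord poly_funs.const)
    have 2: "(\<lambda>z. (snd z ** (inv\<^bsub>SL\<^esub> v0 ** Z)) $ r $ i) \<in> poly_funs mat_pair_coords"
      by (rule poly_funs_matrix_mult) (auto intro: poly_funs_snd_coord poly_funs.const)
    show "(\<lambda>z. M z $ r $ i) \<in> poly_funs mat_pair_coords"
      using 1 2 by (cases "i \<in> I"; cases "idx i < k") (simp_all add: M_def poly_funs.const)
  qed
  moreover have "M z0 = Z"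
    by (simp add: M_def vec_eq_iff u0_def[symmetric] v0_def[symmetric] SL_cancel det0)
  then have "f z0 \<noteq> 0" by (simp add: f_def Z(1))
  moreover have "vec.dim ((*v) (fst z ** W) ` std a \<inter> (*v) (snd z ** W') ` std k) \<le> c"
    if z: "z \<in> carrier SL \<times> carrier SL" and fz: "f z \<noteq> 0" for z
  proof -
    define A where "A = (*v) (fst z ** W) ` std a"
    define C where "C = (*v) (snd z ** W') ` std k"
    define K where "K = {i::'n. idx i < k}"
    have det: "det (fst z) = 1" "det (snd z) = 1" using z by auto
    have subs: "vec.subspace A" "vec.subspace C" unfolding A_def C_def by (simp_all add: matrix_image_subspace)
    have dims: "vec.dim A = a" "vec.dim C = k"
      unfolding A_def C_def using ak by (simp_all add: dim_matrix_image dim_std det_mul det W)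
    have A_eq: "A = (*v) (fst z ** (inv\<^bsub>SL\<^esub> u0 ** Z)) ` coord_space I"
    proof -
      have "(*v) (fst z ** (inv\<^bsub>SL\<^esub> u0 ** Z)) ` coord_space I = (*v) (fst z) ` ((*v) (inv\<^bsub>SL\<^esub> u0) ` ((*v) Z ` coord_space I))"
        by (simp only: image_mult)
      then show ?thesis unfolding Z(4)[symmetric]
        by (simp add: A_def image_image SL_cancel det0 flip: matrix_vector_mul_assoc)
    qed
    have C_eq: "C = (*v) (snd z ** (inv\<^bsub>SL\<^esub> v0 ** Z)) ` coord_space K"
    proof -
      have "(*v) (snd z ** (inv\<^bsub>SL\<^esub> v0 ** Z)) ` coord_space K = (*v) (snd z) ` ((*v) (inv\<^bsub>SL\<^esub> v0) ` ((*v) Z ` std k))"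
        by (simp only: image_mult K_def std_eq_coord_space)
      then show ?thesis unfolding Z(3)
        by (simp add: C_def image_image SL_cancel det0 flip: matrix_vector_mul_assoc)
    qed
    have "(*v) (M z) ` coord_space (I \<union> K) \<subseteq> {x + y | x y. x \<in> A \<and> y \<in> C}"
    proof (rule image_subsetI)
      fix w :: "complex^'n" assume w: "w \<in> coord_space (I \<union> K)"
      define w1 :: "complex^'n" where "w1 = (\<chi> i. if i \<in> I then w $ i else 0)"
      define w2 :: "complex^'n" where "w2 = (\<chi> i. if i \<in> I then 0 else w $ i)"
      have "w = w1 + w2" by (simp add: w1_def w2_def vec_eq_iff)
      moreover have "M z *v w1 = (fst z ** (inv\<^bsub>SL\<^esub> u0 ** Z)) *v w1"
        unfolding matrix_vector_mult_def by (auto simp: vec_eq_iff M_def w1_def intro!: sum.cong)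
      moreover have "M z *v w2 = (snd z ** (inv\<^bsub>SL\<^esub> v0 ** Z)) *v w2"
        unfolding matrix_vector_mult_def using w
        by (auto simp: vec_eq_iff M_def w2_def coord_space_def K_def intro!: sum.cong)
      moreover have "w1 \<in> coord_space I" "w2 \<in> coord_space K"
        using w by (auto simp: coord_space_def w1_def w2_def)
      ultimately show "M z *v w \<in> {x + y | x y. x \<in> A \<and> y \<in> C}"
        unfolding A_eq C_eq by (auto simp: matrix_vector_right_distrib)
    qed
    then have "vec.dim ((*v) (M z) ` coord_space (I \<union> K)) \<le> vec.dim {x + y | x y. x \<in> A \<and> y \<in> C}"
      by (rule vec.dim_subset)
    then have "card (I \<union> K) \<le> vec.dim {x + y | x y. x \<in> A \<and> y \<in> C}"
      using fz by (simp add: f_def dim_matrix_image dim_coord_space)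
    moreover have "vec.dim {x + y | x y. x \<in> A \<and> y \<in> C} + vec.dim (A \<inter> C) = a + k"
      using vec.dim_sums_Int[OF subs] dims by simp
    moreover have "card (I \<union> K) + card (I \<inter> K) = a + k"
      using card_Un_Int[of I K] Z(2) card_idx_less[OF ak(2)] by (simp add: K_def)
    moreover have "card (I \<inter> K) = count_below I k" by (simp add: count_below_def K_def Int_def)
    ultimately have "vec.dim (A \<inter> C) \<le> c" using count by linarith
    then show ?thesis by (simp add: A_def C_def)
  qed
  ultimately show "\<exists>f\<in>poly_funs mat_pair_coords. f z0 \<noteq> 0 \<and> {y \<in> carrier SL \<times> carrier SL. f y \<noteq> 0}
     \<subseteq> {z \<in> carrier SL \<times> carrier SL. vec.dim ((*v) (fst z ** W) ` std a \<inter> (*v) (snd z ** W') ` std k) \<le> c}"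
    by (intro bexI[of _ f]) auto
qed auto

lemma pair_dims_lattice_op:
  fixes W W' :: "complex^'n^'n"
  assumes W: "det W = 1" "det W' = 1" and a: "a \<le> CARD('n)"
    and det: "det x = 1" "det y = 1" "det x' = 1" "det y' = 1"
    and opr: "opr = min \<or> opr = max"
  shows "\<exists>u v. det u = 1 \<and> det v = 1 \<and> (\<forall>j\<le>CARD('n).
    vec.dim ((*v) (u ** W) ` std a \<inter> (*v) (v ** W') ` std j)
      = (opr :: nat \<Rightarrow> nat \<Rightarrow> nat) (vec.dim ((*v) (x ** W) ` std a \<inter> (*v) (y ** W') ` std j))
          (vec.dim ((*v) (x' ** W) ` std a \<inter> (*v) (y' ** W') ` std j)))"
proof -
  have dets: "det (x ** W) = 1" "det (y ** W') = 1" "det (x' ** W) = 1" "det (y' ** W') = 1"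
    by (simp_all add: det_mul det W)
  obtain Z I where Z: "det Z = 1" "card I = a" "\<And>j. (*v) Z ` std j = (*v) (y ** W') ` std j"
    "(*v) (x ** W) ` std a = (*v) Z ` coord_space I"
    by (rule pair_normal_form[OF dets(1,2) a]) (blast intro: that)
  obtain Z' I' where Z': "det Z' = 1" "card I' = a" "\<And>j. (*v) Z' ` std j = (*v) (y' ** W') ` std j"
    "(*v) (x' ** W) ` std a = (*v) Z' ` coord_space I'"
    by (rule pair_normal_form[OF dets(3,4) a]) (blast intro: that)
  obtain K :: "'n set" where K: "\<And>j. j \<le> CARD('n) \<Longrightarrow> count_below K j = opr (count_below I j) (count_below I' j)"
    using opr
  proof
    assume "opr = min" then show thesis using count_below_min[of I I'] that by blast
  next
    assume "opr = max" then show thesis using count_below_max[of I I'] that by blast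
  qed
  have "card K = opr a a" using K[of "CARD('n)"] Z(2) Z'(2) by (simp add: count_below_card)
  then have "card K = a" using opr by auto
  then obtain X :: "complex^'n^'n" where X: "det X = 1" "\<And>j. vec.dim ((*v) X ` std a \<inter> std j) = count_below K j"
    by (rule pair_with_counts) (blast intro: that)
  have id: "(*v) (mat 1 :: complex^'n^'n) ` S = S" for S by simp
  \<comment> \<open>With these translates the second flag becomes the standard one and the first
    subspace the image of \<open>std a\<close> under \<open>X\<close>.\<close>
  show ?thesis
    by (rule exI[of _ "X ** inv\<^bsub>SL\<^esub> W"], rule exI[of _ "inv\<^bsub>SL\<^esub> W'"])
       (simp add: det_mul SL_inv X W matrix_mul_rassoc id K dim_normal_form[OF Z(1,3,4)] dim_normal_form[OF Z'(1,3,4)])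
qed

section \<open>Two three-step flags are never spherical\<close>

text \<open>Up to sign, the determinant of \<open>minor_mat \<pi> S m\<close> is the minor of \<open>m\<close> with rows \<open>\<pi> ` S\<close> and
  columns \<open>S\<close>.\<close>

definition minor_mat :: "('n \<Rightarrow> 'n) \<Rightarrow> 'n set \<Rightarrow> complex^'n^'n \<Rightarrow> complex^'n^'n" where
  "minor_mat \<pi> S m = (\<chi> r c. if c \<in> S then m $ r $ c else if r = \<pi> c then 1 else 0)"

lemma matrix_mult_nth: "(A ** B) $ r $ c = (\<Sum>k\<in>UNIV. A $ r $ k * B $ k $ c)"
  by (simp add: matrix_matrix_mult_def)

text \<open>The rows of \<open>\<kappa>\<close> in the image of \<open>S\<close> involve only those
  rows of \<open>m\<close>, and \<open>q\<close> mixes the columns in \<open>S\<close> among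
  themselves. Thus the minor acquires the determinant of \<open>q\<close> on \<open>S\<close> and
  the diagonal entries of \<open>\<kappa>\<close> in its rows; the complementary diagonal entries
  stand on the left to avoid a division.\<close>

lemma minor_semi_invariant:
  fixes \<kappa> m q :: "complex^'n^'n"
  assumes \<pi>: "bij \<pi>" and \<kappa>: "upper \<kappa>" "\<And>r s. r \<in> \<pi> ` S \<Longrightarrow> s \<notin> \<pi> ` S \<Longrightarrow> \<kappa> $ r $ s = 0"
    and q: "\<And>r c. r \<notin> S \<Longrightarrow> c \<in> S \<Longrightarrow> q $ r $ c = 0"
  shows "det (minor_mat \<pi> S (\<kappa> ** m ** q)) * (\<Prod>r\<in>UNIV. if r \<in> \<pi> ` S then 1 else \<kappa> $ r $ r)
    = det \<kappa> * det (minor_mat \<pi> S m)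
      * det (\<chi> r c. if c \<in> S then (if r \<in> S then q $ r $ c else 0) else if r = c then 1 else 0)"
proof -
  define D1 :: "complex^'n^'n" where
    "D1 = (\<chi> r c. if c \<in> S then (if r \<in> S then q $ r $ c else 0) else if r = c then 1 else 0)"
  define D2 :: "complex^'n^'n" where
    "D2 = (\<chi> r c. if c \<in> S then (if r = c then 1 else 0) else if r \<in> S then 0 else \<kappa> $ \<pi> r $ \<pi> c)"
  have inj: "\<pi> a = \<pi> b \<longleftrightarrow> a = b" for a b using injD[OF bij_is_inj[OF \<pi>]] by blast
  have mem: "\<pi> a \<in> \<pi> ` S \<longleftrightarrow> a \<in> S" for a by (rule inj_image_mem_iff[OF bij_is_inj[OF \<pi>]])
  have "(minor_mat \<pi> S (\<kappa> ** m ** q) ** D2) $ r $ c = (\<kappa> ** (minor_mat \<pi> S m ** D1)) $ r $ c" for r c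
  proof (cases "c \<in> S")
    case True
    have "(minor_mat \<pi> S (\<kappa> ** m ** q) ** D2) $ r $ c = (\<Sum>k\<in>UNIV. if k = c then (\<kappa> ** m ** q) $ r $ c else 0)"
      unfolding matrix_matrix_mult_def[of "minor_mat \<pi> S (\<kappa> ** m ** q)"]
      by (simp add: D2_def True minor_mat_def if_distrib[of "\<lambda>x. _ * x"] cong: if_cong)
    also have "\<dots> = (\<kappa> ** (m ** q)) $ r $ c" by (simp add: matrix_mul_assoc)
    also have "\<dots> = (\<Sum>k\<in>UNIV. \<kappa> $ r $ k * (m ** q) $ k $ c)" by (simp add: matrix_matrix_mult_def[of \<kappa>])
    also have "\<dots> = (\<Sum>k\<in>UNIV. \<kappa> $ r $ k * (minor_mat \<pi> S m ** D1) $ k $ c)"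
    proof (intro sum.cong refl arg_cong2[of _ _ _ _ "(*)"])
      fix k
      show "(m ** q) $ k $ c = (minor_mat \<pi> S m ** D1) $ k $ c"
        unfolding matrix_matrix_mult_def
        by (simp, intro sum.cong refl) (use True q in \<open>auto simp: minor_mat_def D1_def\<close>)
    qed
    finally show ?thesis by (simp add: matrix_matrix_mult_def[of \<kappa>])
  next
    case False
    have "(minor_mat \<pi> S m ** D1) $ k $ c = (if k = \<pi> c then 1 else 0)" for k
      unfolding matrix_matrix_mult_def
      by (simp add: D1_def False minor_mat_def if_distrib[of "\<lambda>x. _ * x"] cong: if_cong)
    then have "(\<kappa> ** (minor_mat \<pi> S m ** D1)) $ r $ c = \<kappa> $ r $ \<pi> c"
      by (simp add: matrix_matrix_mult_def[of \<kappa>] if_distrib[of "\<lambda>x. _ * x"] cong: if_cong)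
    moreover obtain s where s: "r = \<pi> s" using \<pi> by (metis bij_pointE)
    have "(minor_mat \<pi> S (\<kappa> ** m ** q) ** D2) $ r $ c
        = (\<Sum>k\<in>UNIV. if k = s then (if s \<in> S then 0 else \<kappa> $ \<pi> s $ \<pi> c) else 0)"
      unfolding matrix_mult_nth[of "minor_mat \<pi> S (\<kappa> ** m ** q)"]
      by (intro sum.cong refl) (auto simp: D2_def False minor_mat_def s inj)
    then have "(minor_mat \<pi> S (\<kappa> ** m ** q) ** D2) $ r $ c = (if s \<in> S then 0 else \<kappa> $ r $ \<pi> c)"
      by (simp add: s)
    ultimately show ?thesis using \<kappa>(2)[of r "\<pi> c"] False by (simp add: s mem)
  qed
  then have "minor_mat \<pi> S (\<kappa> ** m ** q) ** D2 = \<kappa> ** (minor_mat \<pi> S m ** D1)" by (simp add: vec_eq_iff)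
  then have "det (minor_mat \<pi> S (\<kappa> ** m ** q)) * det D2 = det \<kappa> * (det (minor_mat \<pi> S m) * det D1)"
    by (metis det_mul)
  moreover have "det D2 = (\<Prod>r\<in>UNIV. if r \<in> \<pi> ` S then 1 else \<kappa> $ r $ r)"
  proof -
    have "inj (idx \<circ> \<pi>)" using inj_idx bij_is_inj[OF \<pi>] by (rule inj_compose)
    then have "det D2 = (\<Prod>c\<in>UNIV. D2 $ c $ c)"
      by (rule det_triangular) (use \<kappa>(1) in \<open>auto simp: D2_def upper_def\<close>)
    also have "\<dots> = (\<Prod>c\<in>UNIV. if \<pi> c \<in> \<pi> ` S then 1 else \<kappa> $ \<pi> c $ \<pi> c)"
      by (intro prod.cong refl) (simp add: D2_def mem)
    also have "\<dots> = (\<Prod>r\<in>UNIV. if r \<in> \<pi> ` S then 1 else \<kappa> $ r $ r)"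
      by (rule prod.reindex_bij_betw[OF \<pi>, of "\<lambda>r. if r \<in> \<pi> ` S then 1 else \<kappa> $ r $ r"])
    finally show ?thesis .
  qed
  ultimately show ?thesis by (simp add: D1_def mult.assoc)
qed

text \<open>Both products use every row equally often, so the diagonal factors cancel, and the
  factors from \<open>q\<close> depend only on \<open>S1\<close> and \<open>S2\<close>.\<close>

lemma minor_ratio_invariant:
  fixes \<kappa> m q :: "complex^'n^'n"
  assumes \<kappa>: "upper \<kappa>" "det \<kappa> \<noteq> 0"
    and bij: "bij \<pi>1" "bij \<pi>2" "bij \<sigma>1" "bij \<sigma>2"
    and stable: "\<And>\<pi> S r s. (\<pi>, S) \<in> {(\<pi>1, S1), (\<pi>2, S2), (\<sigma>1, S1), (\<sigma>2, S2)}
      \<Longrightarrow> r \<in> \<pi> ` S \<Longrightarrow> s \<notin> \<pi> ` S \<Longrightarrow> \<kappa> $ r $ s = 0"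
    and q: "\<And>r c. r \<notin> S1 \<Longrightarrow> c \<in> S1 \<Longrightarrow> q $ r $ c = 0" "\<And>r c. r \<notin> S2 \<Longrightarrow> c \<in> S2 \<Longrightarrow> q $ r $ c = 0"
    and weights: "\<And>r. (of_bool (r \<in> \<pi>1 ` S1) + of_bool (r \<in> \<pi>2 ` S2) :: nat)
      = of_bool (r \<in> \<sigma>1 ` S1) + of_bool (r \<in> \<sigma>2 ` S2)"
  shows "(det (minor_mat \<pi>1 S1 (\<kappa> ** m ** q)) * det (minor_mat \<pi>2 S2 (\<kappa> ** m ** q)))
      * (det (minor_mat \<sigma>1 S1 m) * det (minor_mat \<sigma>2 S2 m))
    = (det (minor_mat \<pi>1 S1 m) * det (minor_mat \<pi>2 S2 m))
      * (det (minor_mat \<sigma>1 S1 (\<kappa> ** m ** q)) * det (minor_mat \<sigma>2 S2 (\<kappa> ** m ** q)))"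
proof -
  define w where "w \<pi> S = (\<Prod>r\<in>UNIV. if r \<in> \<pi> ` S then 1 else \<kappa> $ r $ r)" for \<pi> :: "'n \<Rightarrow> 'n" and S
  define d where "d S = det ((\<chi> r c. if c \<in> S then (if r \<in> S then q $ r $ c else 0) else if r = c then 1 else 0) :: complex^'n^'n)" for S
  define D where "D \<pi> S = det (minor_mat \<pi> S m)" for \<pi> S
  define D' where "D' \<pi> S = det (minor_mat \<pi> S (\<kappa> ** m ** q))" for \<pi> S
  have e: "D' \<pi>1 S1 * w \<pi>1 S1 = det \<kappa> * D \<pi>1 S1 * d S1" "D' \<pi>2 S2 * w \<pi>2 S2 = det \<kappa> * D \<pi>2 S2 * d S2"
    "D' \<sigma>1 S1 * w \<sigma>1 S1 = det \<kappa> * D \<sigma>1 S1 * d S1" "D' \<sigma>2 S2 * w \<sigma>2 S2 = det \<kappa> * D \<sigma>2 S2 * d S2"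
    unfolding D_def D'_def w_def d_def
    by (intro minor_semi_invariant bij \<kappa>(1) q stable; simp)+
  have diag: "\<kappa> $ r $ r \<noteq> 0" for r using \<kappa>(2) by (auto simp: det_upper[OF \<kappa>(1)])
  have "w \<pi>1 S1 * w \<pi>2 S2 = w \<sigma>1 S1 * w \<sigma>2 S2"
    unfolding w_def prod.distrib[symmetric]
  proof (intro prod.cong refl)
    fix r
    show "(if r \<in> \<pi>1 ` S1 then 1 else \<kappa> $ r $ r) * (if r \<in> \<pi>2 ` S2 then 1 else \<kappa> $ r $ r)
      = (if r \<in> \<sigma>1 ` S1 then 1 else \<kappa> $ r $ r) * (if r \<in> \<sigma>2 ` S2 then 1 else \<kappa> $ r $ r)"
      using weights[of r] by (auto simp: of_bool_def split: if_splits)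
  qed
  moreover have "w \<pi>1 S1 * w \<pi>2 S2 \<noteq> 0" using diag by (simp add: w_def)
  moreover have "(D' \<pi>1 S1 * w \<pi>1 S1) * (D' \<pi>2 S2 * w \<pi>2 S2) * (D \<sigma>1 S1 * D \<sigma>2 S2)
      = (D \<pi>1 S1 * D \<pi>2 S2) * ((D' \<sigma>1 S1 * w \<sigma>1 S1) * (D' \<sigma>2 S2 * w \<sigma>2 S2))"
    unfolding e by (simp add: algebra_simps)
  then have "(D' \<pi>1 S1 * D' \<pi>2 S2 * (D \<sigma>1 S1 * D \<sigma>2 S2)) * (w \<pi>1 S1 * w \<pi>2 S2)
      = (D \<pi>1 S1 * D \<pi>2 S2 * (D' \<sigma>1 S1 * D' \<sigma>2 S2)) * (w \<sigma>1 S1 * w \<sigma>2 S2)"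
    by (simp add: algebra_simps)
  ultimately show ?thesis by (simp add: D_def D'_def)
qed

text \<open>A kernel vector vanishes at \<open>c1\<close> by row \<open>\<theta> c1\<close>, which
  the extra entry leaves alone, and then everywhere.\<close>

lemma det_nonzero_perm_plus_entry:
  fixes M :: "complex^'n^'n"
  assumes \<theta>: "bij \<theta>" and \<rho>: "\<rho> \<noteq> \<theta> c1"
    and M: "\<And>r c. M $ r $ c = (if r = \<theta> c then 1 else if r = \<rho> \<and> c = c1 then 1 else 0)"
  shows "det M \<noteq> 0"
proof -
  have inj: "\<theta> a = \<theta> b \<longleftrightarrow> a = b" for a b using injD[OF bij_is_inj[OF \<theta>]] by blast
  have "v = 0" if Mv: "M *v v = 0" for v
  proof -
    have row: "(M *v v) $ (\<theta> k) = v $ k + (if \<theta> k = \<rho> then v $ c1 else 0)" for k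
    proof -
      have "(\<Sum>c\<in>UNIV. M $ \<theta> k $ c * v $ c) = (\<Sum>c\<in>UNIV. (if c = k then v $ k else 0) + (if c = c1 then (if \<theta> k = \<rho> then v $ c1 else 0) else 0))"
        by (intro sum.cong refl) (use \<rho> in \<open>auto simp: M inj\<close>)
      then show ?thesis by (simp add: matrix_vector_mult_def sum.distrib)
    qed
    have "v $ c1 = 0" using row[of c1] \<rho> Mv by simp
    then have "v $ k = 0" for k using row[of k] Mv by (simp split: if_splits)
    then show ?thesis by (simp add: vec_eq_iff)
  qed
  then show ?thesis using det_eq_0_iff_kernel by blast
qed

lemma nested_bijection:
  fixes S1 S2 R1 R2 :: "'n::finite set"
  assumes "S1 \<subseteq> S2" "R1 \<subseteq> R2" "card S1 = card R1" "card S2 = card R2"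
  obtains \<sigma> where "bij \<sigma>" "\<sigma> ` S1 = R1" "\<sigma> ` S2 = R2"
proof -
  obtain f where f: "bij_betw f S1 R1" using finite_same_card_bij[of S1 R1] assms by auto
  have "card (S2 - S1) = card (R2 - R1)" using assms by (simp add: card_Diff_subset)
  then obtain g where g: "bij_betw g (S2 - S1) (R2 - R1)" using finite_same_card_bij[of "S2 - S1" "R2 - R1"] by auto
  have "card (- S2) = card (- R2)" using assms by (simp add: Compl_eq_Diff_UNIV card_Diff_subset)
  then obtain h where h: "bij_betw h (- S2) (- R2)" using finite_same_card_bij[of "- S2" "- R2"] by auto
  define \<sigma> where "\<sigma> c = (if c \<in> S2 then (if c \<in> S1 then f c else g c) else h c)" for c
  have 1: "bij_betw \<sigma> S1 R1" using f assms(1) by (subst bij_betw_cong[of _ _ f]) (auto simp: \<sigma>_def)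
  have 2: "bij_betw \<sigma> (S2 - S1) (R2 - R1)" using g by (subst bij_betw_cong[of _ _ g]) (auto simp: \<sigma>_def)
  have 3: "bij_betw \<sigma> (- S2) (- R2)" using h by (subst bij_betw_cong[of _ _ h]) (auto simp: \<sigma>_def)
  have "bij_betw \<sigma> (S1 \<union> (S2 - S1)) (R1 \<union> (R2 - R1))" by (rule bij_betw_combine[OF 1 2]) auto
  then have 12: "bij_betw \<sigma> S2 R2" using assms(1,2) by (simp add: Un_absorb1)
  have "bij_betw \<sigma> (S2 \<union> - S2) (R2 \<union> - R2)" by (rule bij_betw_combine[OF 12 3]) auto
  then have "bij \<sigma>" by (simp add: Compl_partition)
  then show ?thesis using that 1 12 by (simp add: bij_betw_def)
qed

text \<open>On permutation matrices both products of minors vanish, since \<open>insert \<rho>j N\<close> is not contained in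
  \<open>insert \<rho>i (N \<union> T)\<close>; one additional entry in the row of some \<open>\<tau>0 \<in> T\<close> repairs this.\<close>

lemma separating_matrix:
  fixes N T :: "'n::finite set"
  assumes S: "S1 \<subseteq> S2" "S2 \<noteq> UNIV"
    and dist: "N \<inter> T = {}" "\<rho>i \<notin> N \<union> T" "\<rho>j \<notin> N \<union> T" "\<rho>i \<noteq> \<rho>j" and T: "T \<noteq> {}"
    and card: "card S1 = card N + 1" "card S2 = card N + card T + 1"
    and bij: "bij \<pi>1" "bij \<pi>2" "bij \<sigma>1"
    and img: "\<pi>1 ` S1 = insert \<rho>j N" "\<pi>2 ` S2 = insert \<rho>i (N \<union> T)" "\<sigma>1 ` S1 = insert \<rho>i N"
  obtains m :: "complex^'n^'n" where "det m = 1" "det (minor_mat \<pi>1 S1 m) \<noteq> 0"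
    "det (minor_mat \<pi>2 S2 m) \<noteq> 0" "det (minor_mat \<sigma>1 S1 m) = 0"
proof -
  obtain \<tau>0 where \<tau>0: "\<tau>0 \<in> T" using T by blast
  let ?R1 = "insert \<rho>j N" and ?R2 = "insert \<rho>i (insert \<rho>j (N \<union> (T - {\<tau>0})))"
  have c1: "card ?R1 = card S1" using dist card by simp
  have "card (N \<union> (T - {\<tau>0})) = card N + (card T - 1)"
    using dist(1) \<tau>0 by (subst card_Un_disjoint) auto
  moreover have "card T > 0" using T by (simp add: card_gt_0_iff)
  moreover have "\<rho>j \<notin> N \<union> (T - {\<tau>0})" "\<rho>i \<notin> insert \<rho>j (N \<union> (T - {\<tau>0}))" using dist by auto
  ultimately have c2: "card ?R2 = card S2" using card by simp
  obtain \<sigma> where \<sigma>: "bij \<sigma>" "\<sigma> ` S1 = ?R1" "\<sigma> ` S2 = ?R2"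
    by (rule nested_bijection[of S1 S2 ?R1 ?R2]) (use S c1 c2 in auto)
  have inj: "\<sigma> a = \<sigma> b \<longleftrightarrow> a = b" for a b using injD[OF bij_is_inj[OF \<sigma>(1)]] by blast
  have "\<rho>j \<in> \<sigma> ` S1" by (simp add: \<sigma>(2))
  \<comment> \<open>The extra entry goes into the column of \<open>\<rho>j\<close>: reading
    \<open>\<tau>0\<close> there instead of \<open>\<rho>j\<close> turns the rows of
    \<open>S2\<close> into \<open>insert \<rho>i (N \<union> T)\<close>, as the second minor
    demands.\<close>
  then obtain c1 where c1: "c1 \<in> S1" "\<sigma> c1 = \<rho>j" by auto
  \<comment> \<open>A column outside \<open>S2\<close> enters none of the minors, so the determinant
    can be normalised there.\<close>
  obtain cs where cs: "cs \<notin> S2" using S(2) by blast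
  define m0 :: "complex^'n^'n" where
    "m0 = (\<chi> r c. if r = \<sigma> c then 1 else if r = \<tau>0 \<and> c = c1 then 1 else 0)"
  have \<tau>0\<rho>: "\<tau>0 \<noteq> \<rho>j" "\<tau>0 \<noteq> \<rho>i" "\<tau>0 \<notin> N" using dist \<tau>0 by auto
  have "det m0 \<noteq> 0" by (rule det_nonzero_perm_plus_entry[OF \<sigma>(1), of \<tau>0 c1]) (use c1 \<tau>0\<rho> in \<open>auto simp: m0_def\<close>)
  define m :: "complex^'n^'n" where "m = (\<chi> r c. if c = cs then inverse (det m0) * m0 $ r $ c else m0 $ r $ c)"
  have "det m = 1" unfolding m_def det_scale_column using \<open>det m0 \<noteq> 0\<close> by simp
  have m_S2: "m $ r $ c = (if r = \<sigma> c then 1 else if r = \<tau>0 \<and> c = c1 then 1 else 0)" if "c \<in> S2" for r c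
    using that cs by (auto simp: m_def m0_def)
  have bij_of_parts: "bij (\<lambda>c. if c \<in> S then f c else g c)"
    if "bij_betw f S R" "bij g" "g ` S = R" for f g :: "'n \<Rightarrow> 'n" and S R
  proof -
    have "g ` (- S) = - R" using that(2,3) by (simp add: bij_image_Compl_eq)
    then have "bij_betw g (- S) (- R)" using inj_on_subset[OF bij_is_inj[OF that(2)], of "- S"] by (simp add: bij_betw_def)
    from bij_betw_disjoint_Un[OF that(1) this] have "bij_betw (\<lambda>c. if c \<in> S then f c else g c) (S \<union> - S) (R \<union> - R)" by auto
    then show ?thesis by (simp add: Compl_partition)
  qed
  have "det (minor_mat \<pi>1 S1 m) \<noteq> 0"
  proof (rule det_nonzero_perm_plus_entry)
    have "bij_betw \<sigma> S1 ?R1" using \<sigma> inj_on_subset[OF bij_is_inj[OF \<sigma>(1)], of S1] by (simp add: bij_betw_def)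
    then show "bij (\<lambda>c. if c \<in> S1 then \<sigma> c else \<pi>1 c)" by (rule bij_of_parts[OF _ bij(1) img(1)])
    show "\<tau>0 \<noteq> (if c1 \<in> S1 then \<sigma> c1 else \<pi>1 c1)" using c1 \<tau>0\<rho> by simp
    show "minor_mat \<pi>1 S1 m $ r $ c = (if r = (if c \<in> S1 then \<sigma> c else \<pi>1 c) then 1 else if r = \<tau>0 \<and> c = c1 then 1 else 0)" for r c
    proof (cases "c \<in> S1")
      case True
      then have "c \<in> S2" using S(1) by blast
      then show ?thesis using m_S2[of c r] True by (simp add: minor_mat_def)
    next
      case False
      then have "c \<noteq> c1" using c1(1) by blast
      then show ?thesis using False by (simp add: minor_mat_def)
    qed
  qed
  moreover have "det (minor_mat \<pi>2 S2 m) \<noteq> 0"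
  proof (rule det_nonzero_perm_plus_entry)
    define f where "f c = (if c = c1 then \<tau>0 else \<sigma> c)" for c
    have c1S2: "c1 \<in> S2" using c1 S by blast
    have img_f: "f ` S2 = insert \<rho>i (N \<union> T)"
    proof -
      have "S2 = insert c1 (S2 - {c1})" using c1S2 by blast
      then have "f ` S2 = insert \<tau>0 (\<sigma> ` (S2 - {c1}))" by (subst \<open>S2 = _\<close>) (auto simp: f_def)
      also have "\<sigma> ` (S2 - {c1}) = ?R2 - {\<rho>j}"
        using \<sigma>(3) c1(2) image_set_diff[OF bij_is_inj[OF \<sigma>(1)], of S2 "{c1}"] by simp
      also have "insert \<tau>0 (?R2 - {\<rho>j}) = insert \<rho>i (N \<union> T)" using dist \<tau>0 by auto
      finally show ?thesis .
    qed
    moreover have "card (f ` S2) = card S2"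
      unfolding img_f using dist card by (simp add: card_Un_disjoint)
    ultimately have "bij_betw f S2 (insert \<rho>i (N \<union> T))" by (simp add: bij_betw_def eq_card_imp_inj_on)
    then show "bij (\<lambda>c. if c \<in> S2 then f c else \<pi>2 c)" by (rule bij_of_parts[OF _ bij(2) img(2)])
    show "\<rho>j \<noteq> (if c1 \<in> S2 then f c1 else \<pi>2 c1)" using c1S2 \<tau>0\<rho> by (simp add: f_def)
    show "minor_mat \<pi>2 S2 m $ r $ c = (if r = (if c \<in> S2 then f c else \<pi>2 c) then 1 else if r = \<rho>j \<and> c = c1 then 1 else 0)" for r c
    proof (cases "c \<in> S2")
      case True
      show ?thesis
      proof (cases "c = c1")
        case True
        then show ?thesis using m_S2[OF c1S2, of r] c1(2) c1S2 by (auto simp: minor_mat_def f_def)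
      next
        case False
        then show ?thesis using m_S2[OF True, of r] True by (simp add: minor_mat_def f_def)
      qed
    next
      case False
      then have "c \<noteq> c1" using c1S2 by blast
      then show ?thesis using False by (simp add: minor_mat_def)
    qed
  qed
  moreover have "det (minor_mat \<sigma>1 S1 m) = 0"
  proof -
    \<comment> \<open>The columns in \<open>S1\<close> have entries only in the rows
      \<open>insert \<rho>j N\<close> and \<open>\<tau>0\<close>, and the unit columns avoid
      \<open>insert \<rho>i N\<close>; so row \<open>\<rho>i\<close> vanishes.\<close>
    have "minor_mat \<sigma>1 S1 m $ \<rho>i $ c = 0" for c
    proof (cases "c \<in> S1")
      case True
      then have "\<sigma> c \<in> ?R1" using \<sigma>(2) by blast
      then have "\<rho>i \<noteq> \<sigma> c" using dist by auto
      moreover have "c \<in> S2" using True S(1) by blast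
      ultimately show ?thesis using m_S2[of c \<rho>i] True \<tau>0\<rho>(2)[symmetric] by (simp add: minor_mat_def)
    next
      case False
      have "\<sigma>1 c \<notin> insert \<rho>i N" using False img(3) inj_image_mem_iff[OF bij_is_inj[OF bij(3)], of c S1] by simp
      then show ?thesis using False by (auto simp: minor_mat_def)
    qed
    then have "row \<rho>i (minor_mat \<sigma>1 S1 m) = 0" by (simp add: row_def vec_eq_iff)
    then show ?thesis by (rule det_zero_row)
  qed
  ultimately show ?thesis using that \<open>det m = 1\<close> by blast
qed

section \<open>Choice of the rows of the minors\<close>

lemma terminal_segments:
  fixes X :: "'n::finite set"
  obtains e where "bij_betw e {..<card X} X"
    "\<And>k k'. k < card X \<Longrightarrow> k' < card X \<Longrightarrow> idx (e k) \<le> idx (e k') \<Longrightarrow> k \<le> k'"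
proof -
  obtain e where e: "bij_betw e {..<card X} X" "\<And>k j. k < card X \<Longrightarrow> idx (e k) < j \<longleftrightarrow> k < count_below X j"
    by (rule increasing_enumeration[of X]) (blast intro: that)
  have "k \<le> k'" if "k < card X" "k' < card X" "idx (e k) \<le> idx (e k')" for k k'
  proof -
    have "\<not> idx (e k) < idx (e k)" by simp
    then have "count_below X (idx (e k)) \<le> k" using e(2)[OF that(1), of "idx (e k)"] by simp
    moreover have "count_below X (Suc (idx (e k))) \<le> Suc (count_below X (idx (e k)))"
      using count_below_Suc[of X "e k"] by simp
    moreover have "\<not> k' < count_below X (idx (e k))" using e(2)[OF that(2), of "idx (e k)"] that(3) by simp
    moreover have "k < count_below X (Suc (idx (e k)))" using e(2)[OF that(1), of "Suc (idx (e k))"] by simp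
    ultimately show ?thesis by linarith
  qed
  then show ?thesis using that e(1) by blast
qed

text \<open>A row set that contains with each index all later ones of its block gives a minor that
  is semi-invariant under block diagonal upper triangular matrices. Each of the four sets is
  therefore a union of terminal segments of the blocks; \<open>big\<close> lets \<open>T\<close> fit
  into block \<open>k\<close>.\<close>

lemma terminal_row_sets:
  fixes bl :: "'n::finite \<Rightarrow> nat" and b1 b2 :: nat
  assumes bl: "\<And>r. bl r \<in> {i, j, k}" "i \<noteq> j" "i \<noteq> k" "j \<noteq> k"
    and ne: "\<exists>r. bl r = i" "\<exists>r. bl r = j"
    and b: "0 < b1" "b1 < b2" "b2 < CARD('n)" and big: "b2 - b1 \<le> card {r. bl r = k}"
  obtains N T :: "'n set" and \<rho>i \<rho>j where "N \<inter> T = {}" "\<rho>i \<notin> N \<union> T" "\<rho>j \<notin> N \<union> T" "\<rho>i \<noteq> \<rho>j"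
    "card N = b1 - 1" "card T = b2 - b1"
    "\<forall>R\<in>{insert \<rho>j N, insert \<rho>i N, insert \<rho>i (N \<union> T), insert \<rho>j (N \<union> T)}. \<forall>r\<in>R. \<forall>s.
      idx r \<le> idx s \<longrightarrow> bl r = bl s \<longrightarrow> s \<in> R"
proof -
  define X where "X l = {r. bl r = l}" for l
  define n where "n l = card (X l)" for l
  have "\<exists>e. bij_betw e {..<card (X l)} (X l) \<and> (\<forall>k k'. k < card (X l) \<longrightarrow> k' < card (X l) \<longrightarrow> idx (e k) \<le> idx (e k') \<longrightarrow> k \<le> k')" for l
    by (rule terminal_segments[of "X l"]) blast
  then have "\<forall>l. \<exists>e. bij_betw e {..<card (X l)} (X l) \<and> (\<forall>k k'. k < card (X l) \<longrightarrow> k' < card (X l) \<longrightarrow> idx (e k) \<le> idx (e k') \<longrightarrow> k \<le> k')" by blast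
  from choice[OF this] obtain e where e: "\<forall>l. bij_betw (e l) {..<card (X l)} (X l) \<and>
    (\<forall>k k'. k < card (X l) \<longrightarrow> k' < card (X l) \<longrightarrow> idx (e l k) \<le> idx (e l k') \<longrightarrow> k \<le> k')" ..
  have e_bij: "bij_betw (e l) {..<n l} (X l)" for l using e by (simp add: n_def)
  have e_mono: "p \<le> p'" if "p < n l" "p' < n l" "idx (e l p) \<le> idx (e l p')" for l p p'
    using e that unfolding n_def by blast
  have e_bl: "bl (e l p) = l" if "p < n l" for l p
    using bij_betwE[OF e_bij[of l]] that by (auto simp: X_def)
  have e_inj: "e l p = e l p' \<longleftrightarrow> p = p'" if "p < n l" "p' < n l" for l p p'
    using e_bij[of l] that by (auto simp: bij_betw_def inj_on_def)
  \<comment> \<open>Counted from the top of block \<open>l\<close>: skip the \<open>a\<close>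
    largest indices and continue up to the \<open>c\<close>-th. For \<open>a = 0\<close> this is a
    terminal segment.\<close>
  define seg where "seg l a c = e l ` {n l - c..<n l - a}" for l a c
  have seg_card: "card (seg l a c) = c - a" if "a \<le> c" "c \<le> n l" for l a c
  proof -
    have "inj_on (e l) {n l - c..<n l - a}"
      using e_bij[of l] by (auto simp: bij_betw_def elim!: inj_on_subset)
    then show ?thesis unfolding seg_def using that by (simp add: card_image)
  qed
  have seg_bl: "bl r = l" if "r \<in> seg l a c" for r l a c using that e_bl by (auto simp: seg_def)
  have seg_disj: "seg l a c \<inter> seg l c d = {}" if "a \<le> c" "c \<le> d" for l a c d
    using that by (auto simp: seg_def e_inj)
  have seg_Un: "seg l 0 a \<union> seg l a c = seg l 0 c" if "a \<le> c" "c \<le> n l" for l a c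
  proof -
    have "{n l - a..<n l - 0} \<union> {n l - c..<n l - a} = {n l - c..<n l - 0}" using that by auto
    then show ?thesis unfolding seg_def image_Un[symmetric] by simp
  qed
  have seg_up: "s \<in> seg l 0 c" if r: "r \<in> seg l 0 c" and rs: "idx r \<le> idx s" and s: "bl s = l" for l c r s
  proof -
    obtain p where p: "n l - c \<le> p" "p < n l" "r = e l p" using r by (auto simp: seg_def)
    have "s \<in> X l" using s by (simp add: X_def)
    then have "s \<in> e l ` {..<n l}" using e_bij[of l] by (simp add: bij_betw_def)
    then obtain p' where p': "p' < n l" "s = e l p'" by auto
    then have "p \<le> p'" using e_mono[of p l p'] p rs by simp
    then show ?thesis using p p' by (auto simp: seg_def)
  qed
  have n_sum: "n i + n j + n k = CARD('n)"
  proof -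
    have "X i \<union> X j \<union> X k = UNIV" using bl(1) by (auto simp: X_def)
    moreover have "card (X i \<union> X j \<union> X k) = n i + n j + n k"
      using bl(2-4) by (subst card_Un_disjoint, (auto simp: X_def)[3], subst card_Un_disjoint) (auto simp: X_def n_def)
    ultimately show ?thesis by simp
  qed
  have pos: "0 < n i" "0 < n j" using ne by (auto simp: n_def X_def card_gt_0_iff)
  have bigk: "b2 - b1 \<le> n k" using big by (simp add: n_def X_def)
  \<comment> \<open>Block \<open>j\<close> is used up first, then block \<open>i\<close> except for
    one index reserved for \<open>\<rho>i\<close>, then block \<open>k\<close>. If \<open>w\<close>
    is positive, it equals \<open>b1 - n j - n i + 1\<close>, and \<open>b2 < CARD('n)\<close>
    leaves room for \<open>T\<close>.\<close>
  obtain u v w where uvw: "u < n i" "0 < v" "v \<le> n j" "w + (b2 - b1) \<le> n k" "u + v + w = b1"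
  proof -
    define v where "v = min b1 (n j)"
    define u where "u = min (b1 - v) (n i - 1)"
    define w where "w = b1 - v - u"
    show ?thesis
      by (rule that[of u v w]) (use pos bigk b n_sum in \<open>auto simp: u_def v_def w_def min_def\<close>)
  qed
  define \<rho>i where "\<rho>i = e i (n i - Suc u)"
  define \<rho>j where "\<rho>j = e j (n j - v)"
  define N where "N = seg i 0 u \<union> seg j 0 (v - 1) \<union> seg k 0 w"
  define T where "T = seg k w (w + (b2 - b1))"
  have Si: "seg i u (Suc u) = {\<rho>i}" and Sj: "seg j (v - 1) v = {\<rho>j}"
  proof -
    have "{n i - Suc u..<n i - u} = {n i - Suc u}" using uvw(1) by auto
    then show "seg i u (Suc u) = {\<rho>i}" by (simp add: seg_def \<rho>i_def)
    have "{n j - v..<n j - (v - 1)} = {n j - v}" using uvw(2,3) by auto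
    then show "seg j (v - 1) v = {\<rho>j}" by (simp add: seg_def \<rho>j_def)
  qed
  have bl_ij: "bl \<rho>i = i" "bl \<rho>j = j" 
    using seg_bl[of \<rho>i i u "Suc u"] seg_bl[of \<rho>j j "v - 1" v] Si Sj by simp_all
  have bl_T: "bl r = k" if "r \<in> T" for r using that seg_bl by (simp add: T_def)
  have disj_parts: "seg i a a' \<inter> seg j c c' = {}" "seg i a a' \<inter> seg k c c' = {}" "seg j a a' \<inter> seg k c c' = {}" for a a' c c'
    using seg_bl bl(2-4) by blast+
  have ni: "\<rho>i \<notin> seg i 0 u" using seg_disj[of 0 u "Suc u" i] Si by auto
  have nj: "\<rho>j \<notin> seg j 0 (v - 1)" using seg_disj[of 0 "v - 1" v j] Sj by auto
  have closed: "s \<in> R"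
    if R: "R \<in> {insert \<rho>j N, insert \<rho>i N, insert \<rho>i (N \<union> T), insert \<rho>j (N \<union> T)}"
      and rs: "r \<in> R" "idx r \<le> idx s" "bl r = bl s" for R r s
  proof -
    have up: "s \<in> seg i 0 a \<union> seg j 0 c \<union> seg k 0 d" if "r \<in> seg i 0 a \<union> seg j 0 c \<union> seg k 0 d" for a c d
      using that seg_up[OF _ rs(2)] seg_bl rs(3) by (metis Un_iff)
    have i1: "seg i 0 (Suc u) = insert \<rho>i (seg i 0 u)" using seg_Un[of u "Suc u" i] uvw(1) by (simp add: Si)
    have j1: "seg j 0 v = insert \<rho>j (seg j 0 (v - 1))" 
      using seg_Un[of "v - 1" v j, unfolded Sj] uvw by auto
    have k1: "seg k 0 (w + (b2 - b1)) = seg k 0 w \<union> T" using seg_Un[of w "w + (b2 - b1)" k] uvw by (simp add: T_def)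
    have "insert \<rho>j N = seg i 0 u \<union> seg j 0 v \<union> seg k 0 w"
      "insert \<rho>i N = seg i 0 (Suc u) \<union> seg j 0 (v - 1) \<union> seg k 0 w"
      "insert \<rho>i (N \<union> T) = seg i 0 (Suc u) \<union> seg j 0 (v - 1) \<union> seg k 0 (w + (b2 - b1))"
      "insert \<rho>j (N \<union> T) = seg i 0 u \<union> seg j 0 v \<union> seg k 0 (w + (b2 - b1))"
      unfolding N_def i1 j1 k1 by blast+
    then obtain a c d where "R = seg i 0 a \<union> seg j 0 c \<union> seg k 0 d" using R by blast
    then show ?thesis using up rs(1) by blast
  qed
  have "N \<inter> T = {}"
    unfolding N_def T_def by (simp add: Int_Un_distrib2 disj_parts seg_disj)
  moreover have "\<rho>i \<notin> N \<union> T" 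
    using ni bl_ij bl(2-4) by (auto simp: N_def dest: seg_bl bl_T)
  moreover have "\<rho>j \<notin> N \<union> T" 
    using nj bl_ij bl(2-4) by (auto simp: N_def dest: seg_bl bl_T)
  moreover have "\<rho>i \<noteq> \<rho>j" using bl_ij bl(2) by auto
  moreover have "card N = b1 - 1"
  proof -
    have "card N = card (seg i 0 u) + card (seg j 0 (v - 1)) + card (seg k 0 w)"
      unfolding N_def by (simp add: card_Un_disjoint Int_Un_distrib2 disj_parts)
    then show ?thesis using seg_card[of 0 u i] seg_card[of 0 "v - 1" j] seg_card[of 0 w k] uvw by simp
  qed
  moreover have "card T = b2 - b1" unfolding T_def using seg_card[of w "w + (b2 - b1)" k] uvw by simp
  moreover have "\<forall>R\<in>{insert \<rho>j N, insert \<rho>i N, insert \<rho>i (N \<union> T), insert \<rho>j (N \<union> T)}. \<forall>r\<in>R. \<forall>s.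
      idx r \<le> idx s \<longrightarrow> bl r = bl s \<longrightarrow> s \<in> R"
    by (intro ballI allI impI) (rule closed)
  ultimately show ?thesis by (rule that)
qed

text \<open>Nonempty open subsets of the irreducible \<open>SL\<close> are dense.\<close>

lemma poly_fun_vanishing_on_open:
  fixes h :: "complex^'n^'n \<Rightarrow> complex"
  assumes h: "h \<in> poly_funs mat_coords" and U: "openin SL_topology U" "U \<noteq> {}"
    and vanish: "\<And>y. y \<in> U \<Longrightarrow> h y = 0" and y: "det y = 1"
  shows "h y = 0"
proof (rule ccontr)
  assume "h y \<noteq> 0"
  have "openin SL_topology {y\<in>carrier SL. h y \<noteq> 0}"
    unfolding openin_SL_topology using h by auto
  then have "U \<inter> {y\<in>carrier SL. h y \<noteq> 0} \<noteq> {}"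
    by (rule SL_open_meet[OF U(1) _ U(2)]) (use \<open>h y \<noteq> 0\<close> y in auto)
  then show False using vanish by blast
qed

text \<open>The two products of minors below have the same weight under the block diagonal upper triangular
  matrices, so their ratio is constant on \<open>U\<close> and hence everywhere.\<close>

lemma no_open_orbit_aux:
  fixes W Wq :: "complex^'n^'n" and bl :: "'n \<Rightarrow> nat"
  assumes det: "det W = 1" "det Wq = 1"
    and b: "0 < b1" "b1 < b2" "b2 < CARD('n)"
    and bl: "\<And>r. bl r \<in> {i, j, k}" "i \<noteq> j" "i \<noteq> k" "j \<noteq> k" "\<exists>r. bl r = i" "\<exists>r. bl r = j"
    and big: "b2 - b1 \<le> card {r. bl r = k}"
    and U: "openin SL_topology U" "U \<noteq> {}"
    and trans: "\<And>y y'. y \<in> U \<Longrightarrow> y' \<in> U \<Longrightarrow> \<exists>\<kappa> q. upper \<kappa> \<and> det \<kappa> = 1 \<and> (\<forall>r s. \<kappa> $ r $ s \<noteq> 0 \<longrightarrow> bl r = bl s)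
      \<and> (\<forall>r c l. l \<in> {b1, b2} \<longrightarrow> l \<le> idx r \<longrightarrow> idx c < l \<longrightarrow> q $ r $ c = 0)
      \<and> inv\<^bsub>SL\<^esub> W ** y' ** Wq = \<kappa> ** (inv\<^bsub>SL\<^esub> W ** y ** Wq) ** q"
  shows False
proof -
  obtain N T :: "'n set" and \<rho>i \<rho>j where NT: "N \<inter> T = {}" "\<rho>i \<notin> N \<union> T" "\<rho>j \<notin> N \<union> T" "\<rho>i \<noteq> \<rho>j"
    "card N = b1 - 1" "card T = b2 - b1"
    "\<forall>R\<in>{insert \<rho>j N, insert \<rho>i N, insert \<rho>i (N \<union> T), insert \<rho>j (N \<union> T)}. \<forall>r\<in>R. \<forall>s.
      idx r \<le> idx s \<longrightarrow> bl r = bl s \<longrightarrow> s \<in> R"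
    by (rule terminal_row_sets[OF bl b big])
  define S1 where "S1 = {c::'n. idx c < b1}"
  define S2 where "S2 = {c::'n. idx c < b2}"
  have S12: "S1 \<subseteq> S2" using b by (auto simp: S1_def S2_def)
  have cS: "card S1 = b1" "card S2 = b2" using b by (auto simp: S1_def S2_def card_idx_less)
  have S2ne: "S2 \<noteq> UNIV" using cS(2) b(3) by auto
  have cNT: "card (N \<union> T) = b2 - 1" using NT(1,5,6) b by (simp add: card_Un_disjoint)
  have cards: "card S1 = card (insert \<rho>j N)" "card S1 = card (insert \<rho>i N)"
    "card S2 = card (insert \<rho>i (N \<union> T))" "card S2 = card (insert \<rho>j (N \<union> T))"
    using cS NT(2,3,5) cNT b by auto
  have ex_bij: "\<exists>\<pi>. bij \<pi> \<and> \<pi> ` S = R" if "card S = card R" for S R :: "'n set"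
    by (rule nested_bijection[of S S R R]) (use that in auto)
  obtain \<pi>1 where \<pi>1: "bij \<pi>1" "\<pi>1 ` S1 = insert \<rho>j N" using ex_bij[OF cards(1)] by blast
  obtain \<sigma>1 where \<sigma>1: "bij \<sigma>1" "\<sigma>1 ` S1 = insert \<rho>i N" using ex_bij[OF cards(2)] by blast
  obtain \<pi>2 where \<pi>2: "bij \<pi>2" "\<pi>2 ` S2 = insert \<rho>i (N \<union> T)" using ex_bij[OF cards(3)] by blast
  obtain \<sigma>2 where \<sigma>2: "bij \<sigma>2" "\<sigma>2 ` S2 = insert \<rho>j (N \<union> T)" using ex_bij[OF cards(4)] by blast
  define f where "f m = det (minor_mat \<pi>1 S1 m) * det (minor_mat \<pi>2 S2 m)" for m
  define g where "g m = det (minor_mat \<sigma>1 S1 m) * det (minor_mat \<sigma>2 S2 m)" for m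
  define M where "M y = inv\<^bsub>SL\<^esub> W ** y ** Wq" for y
  have inv_fg: "f (M y') * g (M y) = f (M y) * g (M y')" if y: "y \<in> U" "y' \<in> U" for y y'
  proof -
    obtain \<kappa> q where \<kappa>: "upper \<kappa>" "det \<kappa> = 1" "\<forall>r s. \<kappa> $ r $ s \<noteq> 0 \<longrightarrow> bl r = bl s"
      and q: "\<forall>r c l. l \<in> {b1, b2} \<longrightarrow> l \<le> idx r \<longrightarrow> idx c < l \<longrightarrow> q $ r $ c = 0"
      and eq: "M y' = \<kappa> ** M y ** q" using trans[OF y] unfolding M_def by blast
    have stab: "\<kappa> $ r $ s = 0"
      if R: "R \<in> {insert \<rho>j N, insert \<rho>i N, insert \<rho>i (N \<union> T), insert \<rho>j (N \<union> T)}" "r \<in> R" "s \<notin> R" for R r s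
    proof (rule ccontr)
      assume nz: "\<kappa> $ r $ s \<noteq> 0"
      then have "bl r = bl s" using \<kappa>(3) by blast
      moreover have "idx r \<le> idx s" using nz upperD[OF \<kappa>(1), of s r] by force
      ultimately show False using bspec[OF bspec[OF NT(7) R(1)] R(2)] R(3) by simp
    qed
    show ?thesis unfolding f_def g_def eq
    proof (rule minor_ratio_invariant[OF \<kappa>(1) _ \<pi>1(1) \<pi>2(1) \<sigma>1(1) \<sigma>2(1)])
      fix \<pi> S r s assume "(\<pi>, S) \<in> {(\<pi>1, S1), (\<pi>2, S2), (\<sigma>1, S1), (\<sigma>2, S2)}" "r \<in> \<pi> ` S" "s \<notin> \<pi> ` S"
      then show "\<kappa> $ r $ s = 0"
        using stab[of "\<pi> ` S" r s] \<pi>1(2) \<pi>2(2) \<sigma>1(2) \<sigma>2(2) by auto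
    next
      fix r show "(of_bool (r \<in> \<pi>1 ` S1) + of_bool (r \<in> \<pi>2 ` S2) :: nat) = of_bool (r \<in> \<sigma>1 ` S1) + of_bool (r \<in> \<sigma>2 ` S2)"
        unfolding \<pi>1(2) \<pi>2(2) \<sigma>1(2) \<sigma>2(2) using NT(2,3,4) by (auto simp: of_bool_def)
    qed (use \<kappa>(2) q in \<open>auto simp: S1_def S2_def not_less\<close>)
  qed
  have poly_minor: "(\<lambda>y. det (minor_mat \<pi> S (M y))) \<in> poly_funs mat_coords" for \<pi> S
  proof (rule poly_funs_det)
    fix r c
    have "(\<lambda>y. M y $ r $ c) \<in> poly_funs mat_coords" unfolding M_def
      by (intro poly_funs_matrix_mult poly_funs.const poly_funs_mat_coord)
    then show "(\<lambda>y. minor_mat \<pi> S (M y) $ r $ c) \<in> poly_funs mat_coords"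
      by (cases "c \<in> S") (simp_all add: minor_mat_def poly_funs.const)
  qed
  have pf: "(\<lambda>y. f (M y)) \<in> poly_funs mat_coords" and pg: "(\<lambda>y. g (M y)) \<in> poly_funs mat_coords"
    unfolding f_def g_def by (intro poly_funs.mult poly_minor)+
  \<comment> \<open>Density is used in one variable at a time: here for \<open>y'\<close>, next for
    \<open>y\<close>.\<close>
  have half: "f (M y') * g (M y) = f (M y) * g (M y')" if "y \<in> U" "det y' = 1" for y y'
  proof -
    have "(\<lambda>y'. f (M y') * g (M y) - f (M y) * g (M y')) \<in> poly_funs mat_coords"
      by (intro poly_funs_diff poly_funs.mult poly_funs.const pf pg)
    from poly_fun_vanishing_on_open[OF this U _ that(2)] inv_fg[OF that(1)] show ?thesis by simp
  qed
  have full: "f (M y') * g (M y) = f (M y) * g (M y')" if "det y = 1" "det y' = 1" for y y'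
  proof -
    have "(\<lambda>y. f (M y') * g (M y) - f (M y) * g (M y')) \<in> poly_funs mat_coords"
      by (intro poly_funs_diff poly_funs.mult poly_funs.const pf pg)
    from poly_fun_vanishing_on_open[OF this U _ that(1)] half that(2) show ?thesis by simp
  qed
  \<comment> \<open>Multiplication by fixed matrices is a bijection of \<open>SL\<close>, so
    \<open>M y\<close> runs through all of it.\<close>
  have all: "f m' * g m = f m * g m'" if m: "det m = 1" "det m' = 1" for m m'
  proof -
    have "M (W ** m ** inv\<^bsub>SL\<^esub> Wq) = m" for m
      by (simp add: M_def matrix_mul_rassoc SL_cancel SL_inv det)
    then show ?thesis
      using full[of "W ** m ** inv\<^bsub>SL\<^esub> Wq" "W ** m' ** inv\<^bsub>SL\<^esub> Wq"] m by (simp add: det_mul SL_inv det)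
  qed
  have Tne: "T \<noteq> {}" using NT(6) b by auto
  have c12: "card S1 = card N + 1" "card S2 = card N + card T + 1" using cS NT(5,6) b by auto
  \<comment> \<open>At \<open>m\<close> only \<open>f\<close> is nonzero and at \<open>m'\<close>
    only \<open>g\<close>, which contradicts proportionality.\<close>
  obtain m where m: "det m = 1" "det (minor_mat \<pi>1 S1 m) \<noteq> 0" "det (minor_mat \<pi>2 S2 m) \<noteq> 0"
    "det (minor_mat \<sigma>1 S1 m) = 0"
    by (rule separating_matrix[OF S12 S2ne NT(1-4) Tne c12 \<pi>1(1) \<pi>2(1) \<sigma>1(1) \<pi>1(2) \<pi>2(2) \<sigma>1(2)])
  obtain m' where m': "det m' = 1" "det (minor_mat \<sigma>1 S1 m') \<noteq> 0" "det (minor_mat \<sigma>2 S2 m') \<noteq> 0"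
    "det (minor_mat \<pi>1 S1 m') = 0"
    by (rule separating_matrix[OF S12 S2ne NT(1,3,2) NT(4)[symmetric] Tne c12 \<sigma>1(1) \<sigma>2(1) \<pi>1(1) \<sigma>1(2) \<sigma>2(2) \<pi>1(2)])
  show False using all[OF m(1) m'(1)] m m' by (simp add: f_def g_def)
qed

section \<open>Slices of an open orbit at a generic flag\<close>

lemma openin_SL_slice_fst:
  fixes V :: "((complex^'n^'n) \<times> (complex^'n^'n)) set"
  assumes "openin SL_pairs V" "det y = 1"
  shows "openin SL_topology {x. (x, y) \<in> V}"
proof -
  have V: "V \<subseteq> carrier SL \<times> carrier SL" using openin_subset[OF assms(1)] by simp
  have "continuous_map SL_topology SL_pairs (\<lambda>x. (x, y))"
    unfolding SL_topology_def
  proof (rule continuous_map_zariski)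
    fix c assume "c \<in> (mat_pair_coords :: ((complex^'n^'n) \<times> (complex^'n^'n) \<Rightarrow> complex) set)"
    then consider i j where "c = (\<lambda>z. fst z $ i $ j)" | i j where "c = (\<lambda>z. snd z $ i $ j)"
      by (auto simp: mat_pair_coords_def mat_coords_def comp_def)
    then show "\<exists>g\<in>poly_funs mat_coords. \<forall>x\<in>carrier SL. c (x, y) = g x"
    proof cases
      case (1 i j)
      show ?thesis by (rule bexI[OF _ poly_funs_mat_coord[of i j]]) (simp add: 1)
    next
      case (2 i j)
      show ?thesis by (rule bexI[OF _ poly_funs.const[of "y $ i $ j"]]) (simp add: 2)
    qed
  qed (use assms(2) in auto)
  from openin_continuous_map_preimage[OF this assms(1)]
  have "openin SL_topology {x \<in> carrier SL. (x, y) \<in> V}" by simp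
  moreover have "{x \<in> carrier SL. (x, y) \<in> V} = {x. (x, y) \<in> V}" using V by auto
  ultimately show ?thesis by simp
qed

lemma openin_SL_slice_snd:
  fixes V :: "((complex^'n^'n) \<times> (complex^'n^'n)) set"
  assumes "openin SL_pairs V" "det x = 1"
  shows "openin SL_topology {y. (x, y) \<in> V}"
proof -
  have V: "V \<subseteq> carrier SL \<times> carrier SL" using openin_subset[OF assms(1)] by simp
  have "continuous_map SL_topology SL_pairs (\<lambda>y. (x, y))"
    unfolding SL_topology_def
  proof (rule continuous_map_zariski)
    fix c assume "c \<in> (mat_pair_coords :: ((complex^'n^'n) \<times> (complex^'n^'n) \<Rightarrow> complex) set)"
    then consider i j where "c = (\<lambda>z. fst z $ i $ j)" | i j where "c = (\<lambda>z. snd z $ i $ j)"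
      by (auto simp: mat_pair_coords_def mat_coords_def comp_def)
    then show "\<exists>g\<in>poly_funs mat_coords. \<forall>y\<in>carrier SL. c (x, y) = g y"
    proof cases
      case (1 i j)
      show ?thesis by (rule bexI[OF _ poly_funs.const[of "x $ i $ j"]]) (simp add: 1)
    next
      case (2 i j)
      show ?thesis by (rule bexI[OF _ poly_funs_mat_coord[of i j]]) (simp add: 2)
    qed
  qed (use assms(2) in auto)
  from openin_continuous_map_preimage[OF this assms(1)]
  have "openin SL_topology {y \<in> carrier SL. (x, y) \<in> V}" by simp
  moreover have "{y \<in> carrier SL. (x, y) \<in> V} = {y. (x, y) \<in> V}" using V by auto
  ultimately show ?thesis by simp
qed

text \<open>Dimension 0 is the smallest value, so semicontinuity gives openness; the coordinate
  space on the last \<open>a\<close> indices provides a point.\<close>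

lemma generic_opposite:
  fixes Wb Wp :: "complex^'n^'n"
  assumes W: "det Wb = 1" "det Wp = 1" and a: "a \<le> CARD('n)"
  shows "openin SL_topology {x. det x = 1 \<and> vec.dim ((*v) (x ** Wp) ` std a \<inter> (*v) Wb ` std (CARD('n) - a)) = 0}" (is "openin _ ?O")
    and "{x. det x = 1 \<and> vec.dim ((*v) (x ** Wp) ` std a \<inter> (*v) Wb ` std (CARD('n) - a)) = 0} \<noteq> {}"
proof -
  have "openin SL_topology {x. (x, mat 1) \<in> {z \<in> carrier SL \<times> carrier SL.
      vec.dim ((*v) (fst z ** Wp) ` std a \<inter> (*v) (snd z ** Wb) ` std (CARD('n) - a)) \<le> 0}}"
    by (rule openin_SL_slice_fst[OF open_dim_Int_le[OF W(2,1) a]]) auto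
  then show "openin SL_topology ?O" by simp
  define I where "I = {i::'n. CARD('n) - a \<le> idx i}"
  have "card I = a"
  proof -
    have "I = - {i. idx i < CARD('n) - a}" by (auto simp: I_def)
    then show ?thesis using card_idx_less[of "CARD('n) - a", where 'n='n] a
      by (simp add: Compl_eq_Diff_UNIV card_Diff_subset)
  qed
  then obtain X :: "complex^'n^'n" where X: "det X = 1" "\<And>j. vec.dim ((*v) X ` std a \<inter> std j) = count_below I j"
    by (rule pair_with_counts) (blast intro: that)
  define x where "x = Wb ** X ** inv\<^bsub>SL\<^esub> Wp"
  have "(*v) (x ** Wp) ` std a = (*v) Wb ` ((*v) X ` std a)"
    by (simp add: x_def matrix_mul_rassoc SL_inv W image_image flip: matrix_vector_mul_assoc)
  then have "vec.dim ((*v) (x ** Wp) ` std a \<inter> (*v) Wb ` std (CARD('n) - a)) = count_below I (CARD('n) - a)"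
    using W by (simp add: matrix_image_Int dim_matrix_image X)
  also have "\<dots> = 0" by (auto simp: count_below_def I_def)
  finally have "x \<in> ?O" using W X by (simp add: x_def det_mul SL_inv)
  then show "?O \<noteq> {}" by blast
qed

text \<open>Fixing a flag \<open>x\<close> in general position to the Borel flag leaves an open set
  \<open>U\<close> of second components, on whose flags the stabilizer of the first flag in the
  Borel subgroup still acts transitively.\<close>

lemma no_open_orbit:
  fixes Wb Wp Wq :: "complex^'n^'n" and Y :: "((complex^'n^'n) \<times> (complex^'n^'n)) set"
  assumes W: "det Wb = 1" "det Wp = 1" "det Wq = 1"
    and a: "0 < a1" "a1 < a2" "a2 < CARD('n)" and b: "0 < b1" "b1 < b2" "b2 < CARD('n)"
    and big: "b2 - b1 \<le> a1 \<or> b2 - b1 \<le> a2 - a1 \<or> b2 - b1 \<le> CARD('n) - a2"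
    and Y: "Y \<subseteq> carrier SL \<times> carrier SL" "Y \<noteq> {}"
      "\<And>y. det y = 1 \<Longrightarrow> openin SL_topology {x. (x, y) \<in> Y}" "\<And>x. det x = 1 \<Longrightarrow> openin SL_topology {y. (x, y) \<in> Y}"
    and trans: "\<And>x y x' y'. (x, y) \<in> Y \<Longrightarrow> (x', y') \<in> Y \<Longrightarrow> \<exists>h\<in>borel_of Wb.
      (\<forall>l\<in>{a1, a2}. (*v) (h ** x ** Wp) ` std l = (*v) (x' ** Wp) ` std l) \<and>
      (\<forall>l\<in>{b1, b2}. (*v) (h ** y ** Wq) ` std l = (*v) (y' ** Wq) ` std l)"
  shows False
proof -
  let ?n = "CARD('n)"
  define O' where "O' l = {x. det x = 1 \<and> vec.dim ((*v) (x ** Wp) ` std l \<inter> (*v) Wb ` std (?n - l)) = 0}" for l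
  obtain x0 y0 where xy0: "(x0, y0) \<in> Y" using Y(2) by auto
  then have det0: "det y0 = 1" using Y(1) by auto
  have O1: "openin SL_topology (O' a1)" "O' a1 \<noteq> {}" and O2: "openin SL_topology (O' a2)" "O' a2 \<noteq> {}"
    unfolding O'_def using generic_opposite[OF W(1,2), of a1] generic_opposite[OF W(1,2), of a2] a by simp_all
  have "O' a1 \<inter> O' a2 \<noteq> {}" by (rule SL_open_meet[OF O1(1) O2(1) O1(2) O2(2)])
  moreover have "openin SL_topology (O' a1 \<inter> O' a2)" by (rule openin_Int[OF O1(1) O2(1)])
  moreover have "{x. (x, y0) \<in> Y} \<noteq> {}" using xy0 by blast
  ultimately have "(O' a1 \<inter> O' a2) \<inter> {x. (x, y0) \<in> Y} \<noteq> {}" using SL_open_meet Y(3)[OF det0] by blast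
  then obtain x where x: "x \<in> O' a1" "x \<in> O' a2" "(x, y0) \<in> Y" by blast
  have detx: "det x = 1" using x(1) by (simp add: O'_def)
  define U where "U = {y. (x, y) \<in> Y}"
  have U: "openin SL_topology U" "U \<noteq> {}" using Y(4)[OF detx] x(3) by (auto simp: U_def)
  have "det (x ** Wp) = 1" by (simp add: det_mul detx W)
  then obtain Z and \<tau> :: "'n \<Rightarrow> 'n" where Z: "det Z = 1" "bij \<tau>" "\<And>j. (*v) Z ` std j = (*v) Wb ` std j"
    "\<And>a. (*v) (x ** Wp) ` std a = (*v) Z ` coord_space (\<tau> ` {i. idx i < a})"
    by (rule flag_pair_normal_form[OF _ W(1)]) (blast intro: that)
  \<comment> \<open>In the basis \<open>Z\<close> the Borel flag is standard, and general position
    forces the step of dimension \<open>l\<close> onto the last \<open>l\<close>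
    coordinates.\<close>
  define H where "H l = {i::'n. ?n - l \<le> idx i}" for l
  have xA: "(*v) (x ** Wp) ` std l = (*v) Z ` coord_space (H l)" if l: "l \<in> {a1, a2}" for l
  proof -
    have ln: "l \<le> ?n" using l a by auto
    have "x \<in> O' l" using l x by auto
    then have "count_below (\<tau> ` {i. idx i < l}) (?n - l) = 0"
      using dim_normal_form[OF Z(1,3,4), of l "?n - l"] by (simp add: O'_def del: vec.dim_eq_0)
    then have "\<tau> ` {i. idx i < l} \<subseteq> H l" by (auto simp: count_below_def H_def)
    moreover have "card (H l) = card (\<tau> ` {i. idx i < l})"
    proof -
      have "H l = - {i. idx i < ?n - l}" by (auto simp: H_def)
      then show ?thesis using card_idx_less[of "?n - l", where 'n='n] ln card_bij_image_idx_less[OF Z(2) ln]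
        by (simp add: Compl_eq_Diff_UNIV card_Diff_subset)
    qed
    ultimately have "\<tau> ` {i. idx i < l} = H l" by (intro card_subset_eq) auto
    then show ?thesis using Z(4)[of l] by simp
  qed
  \<comment> \<open>The three diagonal blocks, of sizes \<open>?n - a2\<close>,
    \<open>a2 - a1\<close> and \<open>a1\<close>: an upper triangular matrix that preserves the
    coordinate spaces of \<open>H a1\<close> and \<open>H a2\<close> has no entries outside
    them.\<close>
  define bl :: "'n \<Rightarrow> nat" where "bl r = (if idx r < ?n - a2 then 0 else if idx r < ?n - a1 then 1 else 2)" for r
  have bl_eq: "bl r = bl s" if "idx r \<le> idx s" "\<And>l. l \<in> {a1, a2} \<Longrightarrow> s \<in> H l \<Longrightarrow> r \<in> H l" for r s
    using that(1) that(2)[of a1] that(2)[of a2] by (auto simp: bl_def H_def not_less)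
  have trans': "\<exists>\<kappa> q. upper \<kappa> \<and> det \<kappa> = 1 \<and> (\<forall>r s. \<kappa> $ r $ s \<noteq> 0 \<longrightarrow> bl r = bl s)
      \<and> (\<forall>r c l. l \<in> {b1, b2} \<longrightarrow> l \<le> idx r \<longrightarrow> idx c < l \<longrightarrow> q $ r $ c = 0)
      \<and> inv\<^bsub>SL\<^esub> Z ** y' ** Wq = \<kappa> ** (inv\<^bsub>SL\<^esub> Z ** y ** Wq) ** q"
    if y: "y \<in> U" "y' \<in> U" for y y'
  proof -
    obtain h where h: "h \<in> borel_of Wb"
      "\<forall>l\<in>{a1, a2}. (*v) (h ** x ** Wp) ` std l = (*v) (x ** Wp) ` std l"
      "\<forall>l\<in>{b1, b2}. (*v) (h ** y ** Wq) ` std l = (*v) (y' ** Wq) ` std l"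
      using trans[of x y x y'] y by (auto simp: U_def)
    have dety: "det y = 1" "det y' = 1" using y Y(1) by (auto simp: U_def)
    have deth: "det h = 1" using h(1) by (simp add: borel_of_def)
    have h_std: "(*v) h ` ((*v) Z ` std l) = (*v) Z ` std l" for l
    proof -
      have "(*v) (inv\<^bsub>SL\<^esub> Wb ** h ** Wb) ` std l = std l"
        using h(1) by (intro upper_image_std) (auto simp: borel_of_def det_mul SL_inv W)
      then have "(*v) Wb ` ((*v) (inv\<^bsub>SL\<^esub> Wb ** h ** Wb) ` std l) = (*v) Wb ` std l" by simp
      then have "(*v) h ` ((*v) Wb ` std l) = (*v) Wb ` std l"
        by (simp add: image_image SL_cancel W flip: matrix_vector_mul_assoc)
      then show ?thesis by (simp add: Z(3))
    qed
    define \<kappa> where "\<kappa> = inv\<^bsub>SL\<^esub> Z ** h ** Z"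
    \<comment> \<open>\<open>h y\<close> and \<open>y'\<close> agree only as flags; \<open>q\<close>
      records the difference and preserves the steps \<open>b1\<close> and
      \<open>b2\<close>.\<close>
    define q where "q = inv\<^bsub>SL\<^esub> Wq ** inv\<^bsub>SL\<^esub> (h ** y) ** y' ** Wq"
    have dethy: "det (h ** y) = 1" by (simp add: det_mul deth dety)
    have \<kappa>_img: "(*v) \<kappa> ` S = S" if "(*v) h ` ((*v) Z ` S) = (*v) Z ` S" for S
    proof -
      have "(*v) \<kappa> ` S = (*v) (inv\<^bsub>SL\<^esub> Z) ` ((*v) h ` ((*v) Z ` S))"
        by (simp add: \<kappa>_def image_image flip: matrix_vector_mul_assoc)
      then show ?thesis unfolding that by (simp add: image_image SL_cancel Z(1))
    qed
    have up\<kappa>: "upper \<kappa>" unfolding upper_iff_std using \<kappa>_img[OF h_std] by blast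
    have det\<kappa>: "det \<kappa> = 1" by (simp add: \<kappa>_def det_mul SL_inv Z(1) deth)
    have \<kappa>H: "\<kappa> $ r $ s = 0" if l: "l \<in> {a1, a2}" and rs: "s \<in> H l" "r \<notin> H l" for l r s
    proof -
      have "(*v) h ` ((*v) Z ` coord_space (H l)) = (*v) Z ` coord_space (H l)"
        using bspec[OF h(2) l] unfolding xA[OF l, symmetric]
        by (simp add: image_image matrix_vector_mul_assoc matrix_mul_assoc)
      from \<kappa>_img[OF this] have "\<kappa> *v axis s 1 \<in> coord_space (H l)" using axis_in_coord_space[OF rs(1)] by blast
      then have "(\<kappa> *v axis s 1) $ r = 0" using rs(2) by (simp add: coord_space_def)
      then show ?thesis by (simp add: matrix_vector_mult_axis)
    qed
    have "bl r = bl s" if nz: "\<kappa> $ r $ s \<noteq> 0" for r s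
    proof (rule bl_eq)
      show "idx r \<le> idx s" using nz upperD[OF up\<kappa>, of s r] by force
      show "r \<in> H l" if "l \<in> {a1, a2}" "s \<in> H l" for l using \<kappa>H[OF that] nz by blast
    qed
    moreover have "q $ r $ c = 0" if l: "l \<in> {b1, b2}" "l \<le> idx r" "idx c < l" for r c l
    proof -
      have "(*v) (y' ** Wq) ` std l = (*v) (h ** y ** Wq) ` std l" using bspec[OF h(3) l(1)] by (rule sym)
      then have "(*v) q ` std l = std l"
      proof -
        have "(*v) q ` std l = (*v) (inv\<^bsub>SL\<^esub> Wq) ` ((*v) (inv\<^bsub>SL\<^esub> (h ** y)) ` ((*v) (y' ** Wq) ` std l))"
          by (simp add: q_def image_image flip: matrix_vector_mul_assoc)
        also have "\<dots> = (*v) (inv\<^bsub>SL\<^esub> Wq) ` ((*v) (inv\<^bsub>SL\<^esub> (h ** y)) ` ((*v) (h ** y) ` ((*v) Wq ` std l)))"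
          unfolding \<open>(*v) (y' ** Wq) ` std l = (*v) (h ** y ** Wq) ` std l\<close> by (simp only: image_mult)
        also have "\<dots> = std l" by (simp only: image_image SL_cancel[OF dethy] SL_cancel[OF W(3)] image_ident)
        finally show ?thesis .
      qed
      then have "q *v axis c 1 \<in> std l" using l(3) by (auto simp: axis_in_std)
      then have "(q *v axis c 1) $ r = 0" using l(2) by (simp add: std_def)
      then show ?thesis by (simp add: matrix_vector_mult_axis)
    qed
    moreover have "inv\<^bsub>SL\<^esub> Z ** y' ** Wq = \<kappa> ** (inv\<^bsub>SL\<^esub> Z ** y ** Wq) ** q"
    proof -
      have "\<kappa> ** (inv\<^bsub>SL\<^esub> Z ** y ** Wq) ** q = inv\<^bsub>SL\<^esub> Z ** ((h ** y) ** (inv\<^bsub>SL\<^esub> (h ** y) ** (y' ** Wq)))"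
        by (simp add: \<kappa>_def q_def SL_cancel Z(1) W(3) matrix_mul_rassoc)
      also have "\<dots> = inv\<^bsub>SL\<^esub> Z ** (y' ** Wq)" by (simp only: SL_cancel(1)[OF dethy])
      finally show ?thesis by (simp add: matrix_mul_assoc)
    qed
    ultimately show ?thesis using up\<kappa> det\<kappa> by (intro exI[of _ \<kappa>] exI[of _ q]) auto
  qed
  have blcard: "card {r. bl r = 0} = ?n - a2" "card {r. bl r = 1} = a2 - a1" "card {r. bl r = 2} = a1"
  proof -
    have c: "card {i::'n. idx i < l} = l" if "l \<le> ?n" for l using card_idx_less[OF that] .
    have "{r. bl r = 0} = {i. idx i < ?n - a2}" using a by (auto simp: bl_def)
    then show "card {r. bl r = 0} = ?n - a2" using c[of "?n - a2"] by simp
    have "{r. bl r = 1} = {i. idx i < ?n - a1} - {i. idx i < ?n - a2}" using a by (auto simp: bl_def)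
    moreover have "{i::'n. idx i < ?n - a2} \<subseteq> {i. idx i < ?n - a1}" using a by auto
    ultimately show "card {r. bl r = 1} = a2 - a1" using c[of "?n - a1"] c[of "?n - a2"] a
      by (simp add: card_Diff_subset)
    have "{r. bl r = 2} = UNIV - {i. idx i < ?n - a1}" using a by (auto simp: bl_def)
    then show "card {r. bl r = 2} = a1" using c[of "?n - a1"] a by (simp add: card_Diff_subset)
  qed
  have ne: "\<exists>r. bl r = l" if l: "l \<in> {0, 1, 2}" for l
  proof -
    have "card {r. bl r = l} > 0" using l blcard a by auto
    then show ?thesis by (auto simp: card_gt_0_iff)
  qed
  have rng: "bl r \<in> {0, 1, 2}" for r by (simp add: bl_def)
  \<comment> \<open>Block \<open>k\<close> has to hold the \<open>b2 - b1\<close> additional rows;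
    the other two provide \<open>\<rho>i\<close> and \<open>\<rho>j\<close>.\<close>
  have aux: False if ijk: "{i, j, k} = {0, 1, 2}" "i \<noteq> j" "i \<noteq> k" "j \<noteq> k" and le: "b2 - b1 \<le> card {r. bl r = k}" for i j k
  proof (rule no_open_orbit_aux[OF Z(1) W(3) b _ ijk(2-4) _ _ le U trans'])
    show "bl r \<in> {i, j, k}" for r using rng ijk(1) by simp
    have "i \<in> {0, 1, 2}" "j \<in> {0, 1, 2}" unfolding ijk(1)[symmetric] by simp_all
    then show "\<exists>r. bl r = i" "\<exists>r. bl r = j" by (auto intro: ne)
  qed
  from big show False
  proof (elim disjE)
    assume "b2 - b1 \<le> a1"
    then show False by (intro aux[of 0 1 2]) (use blcard in auto)
  next
    assume "b2 - b1 \<le> a2 - a1"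
    then show False by (intro aux[of 0 2 1]) (use blcard in auto)
  next
    assume "b2 - b1 \<le> ?n - a2"
    then show False by (intro aux[of 1 2 0]) (use blcard in auto)
  qed
qed

text \<open>An open Borel orbit pulls back to an open set of pairs whose flags are permuted
  transitively by the Borel subgroup. Two steps of each flag suffice for
  \<open>no_open_orbit\<close>.\<close>

lemma spherical_flag_stabilizers:
  fixes Wp Wq :: "complex^'n^'n"
  assumes W: "det Wp = 1" "det Wq = 1"
    and J: "Jp \<subseteq> {0<..<CARD('n)}" "Jq \<subseteq> {0<..<CARD('n)}"
    and PQ: "P = flag_stabilizer Wp Jp" "Q = flag_stabilizer Wq Jq" "subgroup P SL" "subgroup Q SL"
    and a: "a1 \<in> Jp" "a2 \<in> Jp" "a1 < a2" and b: "b1 \<in> Jq" "b2 \<in> Jq" "b1 < b2"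
  shows "\<not> spherical_double_flag P Q"
proof
  assume "spherical_double_flag P Q"
  then obtain B V where B: "borel_subgroup B" and V: "V \<in> orbits (SL\<lparr>carrier := B\<rparr>) (double_flag P Q) diag_act"
    "openin (double_flag_topology P Q) V" by (auto simp: spherical_double_flag_def)
  obtain Wb where Wb: "det Wb = 1" "B = borel_of Wb" by (rule borel_subgroup_eq_borel_of[OF B])
  have subB: "subgroup B SL" using B by (simp add: borel_subgroup_def conn_solv_subgroup_def)
  obtain w where w: "w \<in> double_flag P Q" "V = orbit (SL\<lparr>carrier := B\<rparr>) diag_act w"
    using V(1) unfolding orbits_def by blast
  then obtain x0 y0 where xy0: "det x0 = 1" "det y0 = 1" "w = proj P Q x0 y0" by (auto simp: double_flag_iff)
  have V_eq: "V = {proj P Q (g ** x0) (g ** y0) | g. g \<in> B}" unfolding w(2) xy0(3) orbit_proj ..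
  define Y where "Y = {z \<in> carrier SL \<times> carrier SL. proj P Q (fst z) (snd z) \<in> V}"
  have openY: "openin SL_pairs Y" using V(2) unfolding openin_double_flag Y_def by blast
  have Y_sub: "Y \<subseteq> carrier SL \<times> carrier SL" by (auto simp: Y_def)
  have "mat 1 \<in> B" using subgroup.one_closed[OF subB] by simp
  then have "proj P Q (mat 1 ** x0) (mat 1 ** y0) \<in> V" unfolding V_eq by blast
  then have "(x0, y0) \<in> Y" using xy0 by (simp add: Y_def)
  then have Y_ne: "Y \<noteq> {}" by blast
  have slices: "\<And>y. det y = 1 \<Longrightarrow> openin SL_topology {x. (x, y) \<in> Y}" "\<And>x. det x = 1 \<Longrightarrow> openin SL_topology {y. (x, y) \<in> Y}"
    by (rule openin_SL_slice_fst[OF openY], assumption) (rule openin_SL_slice_snd[OF openY])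
  have trans: "\<exists>h\<in>borel_of Wb. (\<forall>l\<in>Jp. (*v) (h ** x ** Wp) ` std l = (*v) (x' ** Wp) ` std l) \<and>
      (\<forall>l\<in>Jq. (*v) (h ** y ** Wq) ` std l = (*v) (y' ** Wq) ` std l)"
    if "(x, y) \<in> Y" "(x', y') \<in> Y" for x y x' y'
  proof -
    have det: "det x = 1" "det y = 1" "det x' = 1" "det y' = 1" using that by (auto simp: Y_def)
    have "proj P Q x y \<in> V" "proj P Q x' y' \<in> V" using that by (auto simp: Y_def)
    then obtain g g' where g: "g \<in> B" "proj P Q x y = proj P Q (g ** x0) (g ** y0)"
      and g': "g' \<in> B" "proj P Q x' y' = proj P Q (g' ** x0) (g' ** y0)" unfolding V_eq by blast
    have dg: "det g = 1" "det g' = 1" using g(1) g'(1) subgroup.mem_carrier[OF subB] by auto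
    define h where "h = g' ** inv\<^bsub>SL\<^esub> g"
    have "h \<in> B" unfolding h_def
      using subgroup.m_closed[OF subB g'(1) subgroup.m_inv_closed[OF subB g(1)]] by simp
    have moved: "(*v) (h ** z ** W) ` std l = (*v) (z' ** W) ` std l"
      if "(*v) (z ** W) ` std l = (*v) (g ** z0 ** W) ` std l" "(*v) (z' ** W) ` std l = (*v) (g' ** z0 ** W) ` std l"
      for z z' z0 W :: "complex^'n^'n" and l
    proof -
      have "(*v) (h ** z ** W) ` std l = (*v) h ` ((*v) (z ** W) ` std l)"
        by (simp add: image_image flip: matrix_vector_mul_assoc)
      also have "\<dots> = (*v) (z' ** W) ` std l"
        unfolding that by (simp add: h_def image_image SL_cancel dg flip: matrix_vector_mul_assoc)
      finally show ?thesis .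
    qed
    have "(*v) (h ** x ** Wp) ` std l = (*v) (x' ** Wp) ` std l" if l: "l \<in> Jp" for l
    proof (rule moved)
      show "(*v) (x ** Wp) ` std l = (*v) (g ** x0 ** Wp) ` std l"
        using g(2) l_coset_flag_stabilizer[of Wp Jp x "g ** x0"] PQ(1,3) det dg xy0 l by (simp add: proj_def det_mul)
      show "(*v) (x' ** Wp) ` std l = (*v) (g' ** x0 ** Wp) ` std l"
        using g'(2) l_coset_flag_stabilizer[of Wp Jp x' "g' ** x0"] PQ(1,3) det dg xy0 l by (simp add: proj_def det_mul)
    qed
    moreover have "(*v) (h ** y ** Wq) ` std l = (*v) (y' ** Wq) ` std l" if l: "l \<in> Jq" for l
    proof (rule moved)
      show "(*v) (y ** Wq) ` std l = (*v) (g ** y0 ** Wq) ` std l"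
        using g(2) l_coset_flag_stabilizer[of Wq Jq y "g ** y0"] PQ(2,4) det dg xy0 l by (simp add: proj_def det_mul)
      show "(*v) (y' ** Wq) ` std l = (*v) (g' ** y0 ** Wq) ` std l"
        using g'(2) l_coset_flag_stabilizer[of Wq Jq y' "g' ** y0"] PQ(2,4) det dg xy0 l by (simp add: proj_def det_mul)
    qed
    ultimately show ?thesis using \<open>h \<in> B\<close> Wb(2) by blast
  qed
  have ran: "0 < a1" "a2 < CARD('n)" "0 < b1" "b2 < CARD('n)" using a b J by auto
  define Y' where "Y' = {(y, x). (x, y) \<in> Y}"
  \<comment> \<open>Exchanging the flags if necessary, the middle step of the second is at most that of the first.\<close>
  show False
  proof (cases "b2 - b1 \<le> a2 - a1")
    case True
    show False
    proof (rule no_open_orbit[OF Wb(1) W ran(1) a(3) ran(2,3) b(3) ran(4) _ Y_sub Y_ne slices])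
      fix x y x' y' assume "(x, y) \<in> Y" "(x', y') \<in> Y"
      from trans[OF this] obtain h where h: "h \<in> borel_of Wb"
        "\<forall>l\<in>Jp. (*v) (h ** x ** Wp) ` std l = (*v) (x' ** Wp) ` std l"
        "\<forall>l\<in>Jq. (*v) (h ** y ** Wq) ` std l = (*v) (y' ** Wq) ` std l" by (elim bexE conjE) (rule that)
      show "\<exists>h\<in>borel_of Wb.
        (\<forall>l\<in>{a1, a2}. (*v) (h ** x ** Wp) ` std l = (*v) (x' ** Wp) ` std l) \<and>
        (\<forall>l\<in>{b1, b2}. (*v) (h ** y ** Wq) ` std l = (*v) (y' ** Wq) ` std l)"
        by (intro bexI[OF _ h(1)]) (use h(2,3) a b in simp)
    qed (use True in auto)
  next
    case False
    show False
    proof (rule no_open_orbit[OF Wb(1) W(2,1) ran(3) b(3) ran(4,1) a(3) ran(2), of Y'])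
      show "Y' \<subseteq> carrier SL \<times> carrier SL" using Y_sub by (auto simp: Y'_def)
      show "Y' \<noteq> {}" using \<open>(x0, y0) \<in> Y\<close> by (auto simp: Y'_def)
      fix y x y' x' assume "(y, x) \<in> Y'" "(y', x') \<in> Y'"
      then have "(x, y) \<in> Y" "(x', y') \<in> Y" by (auto simp: Y'_def)
      from trans[OF this] obtain h where h: "h \<in> borel_of Wb"
        "\<forall>l\<in>Jp. (*v) (h ** x ** Wp) ` std l = (*v) (x' ** Wp) ` std l"
        "\<forall>l\<in>Jq. (*v) (h ** y ** Wq) ` std l = (*v) (y' ** Wq) ` std l" by (elim bexE conjE) (rule that)
      show "\<exists>h\<in>borel_of Wb.
        (\<forall>l\<in>{b1, b2}. (*v) (h ** y ** Wq) ` std l = (*v) (y' ** Wq) ` std l) \<and>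
        (\<forall>l\<in>{a1, a2}. (*v) (h ** x ** Wp) ` std l = (*v) (x' ** Wp) ` std l)"
        by (intro bexI[OF _ h(1)]) (use h(2,3) a b in simp)
    qed (use False slices in \<open>auto simp: Y'_def\<close>)
  qed
qed

section \<open>The lattice property\<close>

lemma dim_translate_Int:
  fixes g X Y :: "complex^'n^'n"
  assumes "det g = 1"
  shows "vec.dim ((*v) (g ** X) ` S \<inter> (*v) (g ** Y) ` T) = vec.dim ((*v) X ` S \<inter> (*v) Y ` T)"
  unfolding image_mult using assms by (simp add: matrix_image_Int dim_matrix_image)

lemma poly_entries_mult:
  fixes g :: "complex \<Rightarrow> complex^'n^'n"
  assumes "\<And>i j. \<exists>p. \<forall>t. g t $ i $ j = poly p t"
  shows "\<exists>p. \<forall>t. (g t ** x) $ i $ j = poly p t"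
proof -
  have "\<forall>k. \<exists>p. \<forall>t. g t $ i $ k = poly p t" using assms by blast
  from choice[OF this] obtain p where p: "\<forall>k t. g t $ i $ k = poly (p k) t" by blast
  have "(g t ** x) $ i $ j = poly (\<Sum>k\<in>UNIV. smult (x $ k $ j) (p k)) t" for t
    by (simp add: matrix_mult_nth p poly_sum mult.commute)
  then show ?thesis by blast
qed

lemma lattice_first_one_step:
  fixes Wp Wq :: "complex^'n^'n"
  assumes W: "det Wp = 1" "det Wq = 1" and a: "a \<le> CARD('n)" and J: "J \<subseteq> {..CARD('n)}"
    and PQ: "P = flag_stabilizer Wp {a}" "Q = flag_stabilizer Wq J" "subgroup P SL" "subgroup Q SL"
  shows "lattice \<lparr>carrier = orbit_closures P Q, eq = (=), le = (\<subseteq>)\<rparr>"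
proof -
  define r where "r x y j = vec.dim ((*v) (x ** Wp) ` std a \<inter> (*v) (y ** Wq) ` std j)"
    for x y :: "complex^'n^'n" and j
  have proj_iff: "proj P Q x' y' = proj P Q x y \<longleftrightarrow> (*v) (x' ** Wp) ` std a = (*v) (x ** Wp) ` std a \<and>
      (\<forall>j\<in>J. (*v) (y' ** Wq) ` std j = (*v) (y ** Wq) ` std j)"
    if "det x = 1" "det y = 1" "det x' = 1" "det y' = 1" for x y x' y'
    using l_coset_flag_stabilizer[of Wp "{a}" x' x] l_coset_flag_stabilizer[of Wq J y' y] PQ that
    by (simp add: proj_def)
  show ?thesis
  proof (rule lattice_of_rank_function[where r = r and J = J])
    fix x y x' y' g :: "complex^'n^'n" and j
    assume det: "det x = 1" "det y = 1" "det x' = 1" "det y' = 1" "det g = 1" and j: "j \<in> J"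
      and eq: "proj P Q x' y' = proj P Q (g ** x) (g ** y)"
    have "(*v) (x' ** Wp) ` std a = (*v) (g ** (x ** Wp)) ` std a"
      "(*v) (y' ** Wq) ` std j = (*v) (g ** (y ** Wq)) ` std j"
      using eq proj_iff[of "g ** x" "g ** y" x' y'] det j by (simp_all add: det_mul matrix_mul_assoc)
    then show "r x' y' j = r x y j" by (simp add: r_def dim_translate_Int det(5))
  next
    fix j c assume "j \<in> J"
    then show "openin SL_pairs {z \<in> carrier SL \<times> carrier SL. r (fst z) (snd z) j \<le> c}"
      unfolding r_def using J by (intro open_dim_Int_le[OF W a]) auto
  next
    fix x y x' y' :: "complex^'n^'n"
    assume det: "det x = 1" "det y = 1" "det x' = 1" "det y' = 1" and le: "\<forall>j\<in>J. r x y j \<le> r x' y' j"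
    have dets: "det (x ** Wp) = 1" "det (y ** Wq) = 1" "det (x' ** Wp) = 1" "det (y' ** Wq) = 1"
      by (simp_all add: det_mul det W)
    obtain g where g: "g 0 = mat 1" "\<And>i j. \<exists>p. \<forall>t. g t $ i $ j = poly p t" "\<And>t. det (g t) = 1"
      "\<And>t. t \<noteq> 0 \<Longrightarrow> \<exists>h. det h = 1 \<and> (*v) (h ** (x ** Wp)) ` std a = (*v) (g t ** (x' ** Wp)) ` std a \<and>
       (\<forall>j\<in>J. (*v) (h ** (y ** Wq)) ` std j = (*v) (y' ** Wq) ` std j)"
      by (rule pair_degeneration[OF dets a J]) (use le in \<open>auto simp: r_def intro: that\<close>)
    \<comment> \<open>The degeneration moves only the single subspace, so the second component stays
      constant.\<close>
    define \<phi> where "\<phi> t = (g t ** x', y')" for t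
    have "\<exists>h. det h = 1 \<and> proj P Q (fst (\<phi> t)) (snd (\<phi> t)) = proj P Q (h ** x) (h ** y)" if "t \<noteq> 0" for t
    proof -
      obtain h where "det h = 1" "(*v) (h ** (x ** Wp)) ` std a = (*v) (g t ** (x' ** Wp)) ` std a"
        "\<forall>j\<in>J. (*v) (h ** (y ** Wq)) ` std j = (*v) (y' ** Wq) ` std j" using g(4)[OF \<open>t \<noteq> 0\<close>]
        by (elim exE conjE) (rule that)
      then show ?thesis
        by (intro exI[of _ h]) (simp add: \<phi>_def proj_iff det_mul det g(3) matrix_mul_assoc)
    qed
    then show "\<exists>\<phi>. \<phi> 0 = (x', y') \<and> (\<forall>i j. \<exists>p. \<forall>t. fst (\<phi> t) $ i $ j = poly p t)
        \<and> (\<forall>i j. \<exists>p. \<forall>t. snd (\<phi> t) $ i $ j = poly p t) \<and> (\<forall>t. det (fst (\<phi> t)) = 1 \<and> det (snd (\<phi> t)) = 1)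
        \<and> (\<forall>t. t \<noteq> 0 \<longrightarrow> (\<exists>g. det g = 1 \<and> proj P Q (fst (\<phi> t)) (snd (\<phi> t)) = proj P Q (g ** x) (g ** y)))"
      using poly_entries_mult[OF g(2), of x'] g(1,3) det
      by (intro exI[of _ \<phi>]) (auto simp: \<phi>_def det_mul intro: exI[of _ "[:_:]"])
  next
    fix x y x' y' :: "complex^'n^'n"
    assume det: "det x = 1" "det y = 1" "det x' = 1" "det y' = 1"
    show "\<exists>u v. det u = 1 \<and> det v = 1 \<and> (\<forall>j\<in>J. r u v j = min (r x y j) (r x' y' j))"
      using pair_dims_lattice_op[OF W a det, of min] J unfolding r_def by (meson atMost_iff subsetD)
    show "\<exists>u v. det u = 1 \<and> det v = 1 \<and> (\<forall>j\<in>J. r u v j = max (r x y j) (r x' y' j))"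
      using pair_dims_lattice_op[OF W a det, of max] J unfolding r_def by (meson atMost_iff subsetD)
  qed
qed

text \<open>The factors are exchanged in the rank function while the action stays diagonal; the
  curve now runs in the second component.\<close>

lemma lattice_second_one_step:
  fixes Wp Wq :: "complex^'n^'n"
  assumes W: "det Wp = 1" "det Wq = 1" and a: "a \<le> CARD('n)" and J: "J \<subseteq> {..CARD('n)}"
    and PQ: "P = flag_stabilizer Wp J" "Q = flag_stabilizer Wq {a}" "subgroup P SL" "subgroup Q SL"
  shows "lattice \<lparr>carrier = orbit_closures P Q, eq = (=), le = (\<subseteq>)\<rparr>"
proof -
  define r where "r x y j = vec.dim ((*v) (y ** Wq) ` std a \<inter> (*v) (x ** Wp) ` std j)"
    for x y :: "complex^'n^'n" and j
  have proj_iff: "proj P Q x' y' = proj P Q x y \<longleftrightarrow> (*v) (y' ** Wq) ` std a = (*v) (y ** Wq) ` std a \<and>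
      (\<forall>j\<in>J. (*v) (x' ** Wp) ` std j = (*v) (x ** Wp) ` std j)"
    if "det x = 1" "det y = 1" "det x' = 1" "det y' = 1" for x y x' y'
    using l_coset_flag_stabilizer[of Wp J x' x] l_coset_flag_stabilizer[of Wq "{a}" y' y] PQ that
    by (auto simp: proj_def)
  show ?thesis
  proof (rule lattice_of_rank_function[where r = r and J = J])
    fix x y x' y' g :: "complex^'n^'n" and j
    assume det: "det x = 1" "det y = 1" "det x' = 1" "det y' = 1" "det g = 1" and j: "j \<in> J"
      and eq: "proj P Q x' y' = proj P Q (g ** x) (g ** y)"
    have "(*v) (y' ** Wq) ` std a = (*v) (g ** (y ** Wq)) ` std a"
      "(*v) (x' ** Wp) ` std j = (*v) (g ** (x ** Wp)) ` std j"
      using eq proj_iff[of "g ** x" "g ** y" x' y'] det j by (simp_all add: det_mul matrix_mul_assoc)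
    then show "r x' y' j = r x y j" by (simp add: r_def dim_translate_Int det(5))
  next
    fix j c assume "j \<in> J"
    then show "openin SL_pairs {z \<in> carrier SL \<times> carrier SL. r (fst z) (snd z) j \<le> c}"
      unfolding r_def using J by (subst Int_commute) (intro open_dim_Int_le[OF W _ a], auto)
  next
    fix x y x' y' :: "complex^'n^'n"
    assume det: "det x = 1" "det y = 1" "det x' = 1" "det y' = 1" and le: "\<forall>j\<in>J. r x y j \<le> r x' y' j"
    have dets: "det (y ** Wq) = 1" "det (x ** Wp) = 1" "det (y' ** Wq) = 1" "det (x' ** Wp) = 1"
      by (simp_all add: det_mul det W)
    obtain g where g: "g 0 = mat 1" "\<And>i j. \<exists>p. \<forall>t. g t $ i $ j = poly p t" "\<And>t. det (g t) = 1"
      "\<And>t. t \<noteq> 0 \<Longrightarrow> \<exists>h. det h = 1 \<and> (*v) (h ** (y ** Wq)) ` std a = (*v) (g t ** (y' ** Wq)) ` std a \<and>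
       (\<forall>j\<in>J. (*v) (h ** (x ** Wp)) ` std j = (*v) (x' ** Wp) ` std j)"
      by (rule pair_degeneration[OF dets a J]) (use le in \<open>auto simp: r_def intro: that\<close>)
    define \<phi> where "\<phi> t = (x', g t ** y')" for t
    have "\<exists>h. det h = 1 \<and> proj P Q (fst (\<phi> t)) (snd (\<phi> t)) = proj P Q (h ** x) (h ** y)" if "t \<noteq> 0" for t
    proof -
      obtain h where "det h = 1" "(*v) (h ** (y ** Wq)) ` std a = (*v) (g t ** (y' ** Wq)) ` std a"
        "\<forall>j\<in>J. (*v) (h ** (x ** Wp)) ` std j = (*v) (x' ** Wp) ` std j" using g(4)[OF \<open>t \<noteq> 0\<close>]
        by (elim exE conjE) (rule that)
      then show ?thesis
        by (intro exI[of _ h]) (simp add: \<phi>_def proj_iff det_mul det g(3) matrix_mul_assoc)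
    qed
    then show "\<exists>\<phi>. \<phi> 0 = (x', y') \<and> (\<forall>i j. \<exists>p. \<forall>t. fst (\<phi> t) $ i $ j = poly p t)
        \<and> (\<forall>i j. \<exists>p. \<forall>t. snd (\<phi> t) $ i $ j = poly p t) \<and> (\<forall>t. det (fst (\<phi> t)) = 1 \<and> det (snd (\<phi> t)) = 1)
        \<and> (\<forall>t. t \<noteq> 0 \<longrightarrow> (\<exists>g. det g = 1 \<and> proj P Q (fst (\<phi> t)) (snd (\<phi> t)) = proj P Q (g ** x) (g ** y)))"
      using poly_entries_mult[OF g(2), of y'] g(1,3) det
      by (intro exI[of _ \<phi>]) (auto simp: \<phi>_def det_mul intro: exI[of _ "[:_:]"])
  next
    fix x y x' y' :: "complex^'n^'n"
    assume det: "det x = 1" "det y = 1" "det x' = 1" "det y' = 1"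
    show "\<exists>u v. det u = 1 \<and> det v = 1 \<and> (\<forall>j\<in>J. r u v j = min (r x y j) (r x' y' j))"
      using pair_dims_lattice_op[OF W(2,1) a det(2,1,4,3), of min] J unfolding r_def by (meson atMost_iff subsetD)
    show "\<exists>u v. det u = 1 \<and> det v = 1 \<and> (\<forall>j\<in>J. r u v j = max (r x y j) (r x' y' j))"
      using pair_dims_lattice_op[OF W(2,1) a det(2,1,4,3), of max] J unfolding r_def by (meson atMost_iff subsetD)
  qed
qed

theorem theorem1p1:
  fixes P Q :: "(complex^'n^'n) set"
  assumes "parabolic_subgroup P" and "parabolic_subgroup Q"
    and "spherical_double_flag P Q"
  shows "lattice \<lparr>carrier = orbit_closures P Q, eq = (=), le = (\<subseteq>)\<rparr>"
proof -
  obtain Wp Jp where P: "det Wp = 1" "Jp \<subseteq> {0<..<CARD('n)}" "P = flag_stabilizer Wp Jp"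
    by (rule parabolic_eq_flag_stabilizer[OF assms(1)])
  obtain Wq Jq where Q: "det Wq = 1" "Jq \<subseteq> {0<..<CARD('n)}" "Q = flag_stabilizer Wq Jq"
    by (rule parabolic_eq_flag_stabilizer[OF assms(2)])
  have sub: "subgroup P SL" "subgroup Q SL" using assms(1,2) by (auto simp: parabolic_subgroup_def)
  \<comment> \<open>For empty \<open>J\<close> the group is all of \<open>SL\<close>, the stabilizer
    of the whole space; \<open>a = CARD('n)\<close> brings this case under the same lemmas.\<close>
  have small: "\<exists>a\<le>CARD('n). flag_stabilizer W J = flag_stabilizer W {a}"
    if W: "det W = 1" and J: "J \<subseteq> {0<..<CARD('n)}" and one: "\<forall>x\<in>J. \<forall>y\<in>J. \<not> x < y" for W :: "complex^'n^'n" and J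
  proof (cases "J = {}")
    case True
    have "(*v) (g ** W) ` UNIV = (*v) W ` UNIV" if "det g = 1" for g
    proof -
      have "surj ((*v) A)" if "det A = 1" for A :: "complex^'n^'n"
        by (rule surjI[of _ "(*v) (inv\<^bsub>SL\<^esub> A)"]) (simp add: SL_cancel that)
      then show ?thesis using W that by (metis det_mul mult_1)
    qed
    then have "flag_stabilizer W J = flag_stabilizer W {CARD('n)}" using True by (auto simp: flag_stabilizer_def)
    then show ?thesis by blast
  next
    case False
    then obtain a where a: "a \<in> J" by blast
    then have "J = {a}" using one by (auto dest: nat_neq_iff[THEN iffD1])
    then show ?thesis using J by (intro exI[of _ a]) auto
  qed
  have J': "Jp \<subseteq> {..CARD('n)}" "Jq \<subseteq> {..CARD('n)}" using P(2) Q(2) by auto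
  \<comment> \<open>Two distinct elements in both index sets would give two proper steps in each
    flag, which sphericality excludes.\<close>
  consider "\<forall>x\<in>Jp. \<forall>y\<in>Jp. \<not> x < y" | "\<forall>x\<in>Jq. \<forall>y\<in>Jq. \<not> x < y"
    using spherical_flag_stabilizers[OF P(1) Q(1) P(2) Q(2) P(3) Q(3) sub] assms(3) by blast
  then show ?thesis
  proof cases
    case 1
    obtain a where a: "a \<le> CARD('n)" "flag_stabilizer Wp Jp = flag_stabilizer Wp {a}"
      using small[OF P(1,2) 1] by blast
    show ?thesis by (rule lattice_first_one_step[OF P(1) Q(1) a(1) J'(2) trans[OF P(3) a(2)] Q(3) sub])
  next
    case 2
    obtain a where a: "a \<le> CARD('n)" "flag_stabilizer Wq Jq = flag_stabilizer Wq {a}"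
      using small[OF Q(1,2) 2] by blast
    show ?thesis by (rule lattice_second_one_step[OF P(1) Q(1) a(1) J'(1) P(3) trans[OF Q(3) a(2)] sub])
  qed
qed

end
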